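(* Let $K,V:\mathbb{R}^d\to\mathbb{R}$ satisfy: (i) $K\ge 0$, $K(x)=K(-x)$, and $\int_{\mathbb{R}^d} (K\ast\xi)\cdot\xi\,dx\ge 0$ for all test functions $\xi:\mathbb{R}^d\to\mathbb{R}^d$; (ii) $V$ is smooth and nonnegative; (iii) there exist $p>0$, $C_0>0$, $R>0$ such that for all $|x|>R$: $\frac{1}{C_0}(|x|^{p}-1)\le V(x)\le C_0(|x|^p+1)$, $\frac{1}{C_0}(|x|^{p-1}-1)\le |\nabla V(x)|\le C_0(|x|^{p-1}+1)$, $\frac{1}{C_0}(|x|^{p-2}-1)\le |\nabla^2 V(x)|\le C_0(|x|^{p-2}+1)$; (iv) $K\in W^{3,\infty}(\mathbb{R}^d)$; (v) $\displaystyle\sup_{x\in\mathbb{R}^d}\left\|\frac{\nabla V(x)}{1+V(\cdot)}\cdot\nabla K(x-\cdot)\right\|_{BL}<\infty$ and $\displaystyle\sup_{x\in\mathbb{R}^d}\left\|\frac{\nabla V(x)\cdot\nabla V(\cdot)}{1+V(\cdot)}K(x-\cdot)\right\|_{BL}<\infty$. Let $\rho_\infty=e^{-V}/Z$ with $Z=\int_{\mathbb{R}^d}e^{-V}dx$. Then there exists a constant $C$ depending only on $V$ and $K$ such that the following holds. Let $\{\rho_t\}_{t\ge0}$ be a measure solution of $\partial_t\rho_t=\operatorname{div}(\rho_t\,K\ast(\nabla\rho_t+\nabla V\,\rho_t))$ and set $\mu_t=\rho_t-\rho_\infty$. Let $T>0$, let $g=g(t,x)$ be a smooth test function, and let $\varphi$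 be a solution on $[0,T]\times\mathbb{R}^d$ of $$\partial_t\varphi=\nabla\varphi\cdot K\ast(\nabla\mu_t+\mu_t\nabla V)+(\nabla\rho_\infty\,\varphi)\ast\nabla K-(\nabla\rho_\infty\,\varphi)\ast K\cdot\nabla V-(\rho_\infty\varphi)\ast\Delta K+(\rho_\infty\varphi)\ast\nabla K\cdot\nabla V+g\,(1+V)$$ with terminal condition $\varphi(T,\cdot)=0$. Then, for all $t\in[0,T]$, $$\mathcal{Q}(\varphi(t,\cdot))\le C\int_t^T\|g(s,\cdot)\|_{L^\infty(\mathbb{R}^d)}\,ds\;e^{C\int_t^T\|\mu_s\|_{BL^*_V}\,ds},\qquad \mathcal{Q}(\varphi):=\left(\int_{\mathbb{R}^d}\rho_\infty(x)|\varphi(x)|^2\,dx\right)^{1/2}.$$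
   Context: $BL(\mathbb{R}^d)$ is the space of bounded Lipschitz functions, with $|\psi|_{Lip}=\sup_{x\ne y}\frac{|\psi(x)-\psi(y)|}{|x-y|}$ and $\|\psi\|_{BL}=\max(\|\psi\|_{L^\infty},|\psi|_{Lip})$. For a signed measure $\mu$ with $\int(1+V)\,d|\mu|<\infty$, $$\|\mu\|_{BL^*_V}=\sup_{\|\psi\|_{BL}\le1}\int_{\mathbb{R}^d}\psi(x)(1+V(x))\,d\mu(x).$$ For a measure $\mu$, $K\ast(\nabla\mu+\mu\nabla V)$ denotes $\nabla K\ast\mu+K\ast(\mu\,\nabla V)$. In convolutions of two vector fields, such as $(\nabla\rho_\infty\varphi)\ast\nabla K$, the scalar product is taken: $\sum_i(\partial_i\rho_\infty\,\varphi)\ast\partial_iK$. Measure solution: a family of probability measures $\{\rho_t\}_{t\ge0}$ is a measure solution if $t\mapsto\rho_t$ is narrowly continuous, for each $T>0$ $\sup_{t\in[0,T]}\int(1+V)\,d\rho_t\le C(T)<\infty$, and for all $\phi\in C_c^\infty([0,\infty)\times\mathbb{R}^d)$ $$\int_0^\infty\int_{\mathbb{R}^d}\big(\partial_t\phi-\nabla\phi\cdot K\ast(\nabla\rho_t+\rho_t\nabla V)\big)\,d\rho_t\,dt+\int_{\mathbb{R}^d}\phi(0,x)\,d\rho_0(x)=0.$$ *)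

theory Defs
  imports "HOL-Probability.Probability" "HOL-Probability.Essential_Supremum"
begin

text \<open>
  The space \<open>\<real>\<^sup>d\<close> is an arbitrary type of class \<^class>\<open>euclidean_space\<close>; coordinate directions are the
  elements of \<^const>\<open>Basis\<close>.
\<close>

section \<open>Differential operators and function spaces\<close>

definition pd :: "'a::euclidean_space \<Rightarrow> ('a \<Rightarrow> 'b::real_normed_vector) \<Rightarrow> 'a \<Rightarrow> 'b" where
  "pd b f x = frechet_derivative f (at x) b"

definition iter_pd :: "'a::euclidean_space list \<Rightarrow> ('a \<Rightarrow> 'b::real_normed_vector) \<Rightarrow> 'a \<Rightarrow> 'b" where
  "iter_pd bs f = foldr pd bs f"

definition grad :: "('a::euclidean_space \<Rightarrow> real) \<Rightarrow> 'a \<Rightarrow> 'a" where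
  "grad f x = (\<Sum>b\<in>Basis. pd b f x *\<^sub>R b)"

definition laplacian :: "('a::euclidean_space \<Rightarrow> real) \<Rightarrow> 'a \<Rightarrow> real" where
  "laplacian f x = (\<Sum>b\<in>Basis. pd b (pd b f) x)"

definition hessian_norm :: "('a::euclidean_space \<Rightarrow> real) \<Rightarrow> 'a \<Rightarrow> real" where
  "hessian_norm f x = sqrt (\<Sum>b\<in>Basis. \<Sum>c\<in>Basis. (pd b (pd c f) x)\<^sup>2)"

definition smooth :: "('a::euclidean_space \<Rightarrow> 'b::real_normed_vector) \<Rightarrow> bool" where
  "smooth f \<longleftrightarrow> (\<forall>bs\<in>lists Basis. iter_pd bs f differentiable_on UNIV)"

definition test_function :: "('a::euclidean_space \<Rightarrow> 'b::real_normed_vector) \<Rightarrow> bool" where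
  "test_function f \<longleftrightarrow> smooth f \<and> compact (closure {x. f x \<noteq> 0})"

definition Linf_norm :: "('a::euclidean_space \<Rightarrow> real) \<Rightarrow> ereal" where
  "Linf_norm f = esssup lborel (\<lambda>x. ereal \<bar>f x\<bar>)"

definition Linf :: "('a::euclidean_space \<Rightarrow> real) \<Rightarrow> bool" where
  "Linf f \<longleftrightarrow> f \<in> borel_measurable lborel \<and> Linf_norm f < \<infinity>"

definition weak_deriv ::
    "'a::euclidean_space list \<Rightarrow> ('a \<Rightarrow> real) \<Rightarrow> ('a \<Rightarrow> real) \<Rightarrow> bool" where
  "weak_deriv bs u v \<longleftrightarrow> (\<forall>\<eta>::'a \<Rightarrow> real. test_function \<eta> \<longrightarrow>
     (\<integral>x. u x * iter_pd bs \<eta> x \<partial>lborel) = (- 1) ^ length bs * (\<integral>x. v x * \<eta> x \<partial>lborel))"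

text \<open>\<open>W\<^sup>k\<^sup>,\<^sup>\<infinity>\<close>; a list of basis vectors plays the role of a multi-index.
  This property only depends on the almost-everywhere class of \<open>u\<close>: where values of \<open>u\<close> at points
  matter (as in \<open>u * \<mu>\<close> for a singular measure \<open>\<mu>\<close>), continuity of \<open>u\<close> has to be stated separately,
  i.e. \<open>u\<close> is the continuous representative.\<close>

definition sobolev_Winf :: "nat \<Rightarrow> ('a::euclidean_space \<Rightarrow> real) \<Rightarrow> bool" where
  "sobolev_Winf k u \<longleftrightarrow> Linf u \<and>
     (\<forall>bs\<in>lists Basis. length bs \<le> k \<longrightarrow> (\<exists>v. Linf v \<and> weak_deriv bs u v))"

text \<open>
  The bounded Lipschitz norm is extended-valued: it is finite exactly on bounded Lipschitz functions.
\<close>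

definition Lip_seminorm :: "('a::euclidean_space \<Rightarrow> real) \<Rightarrow> ereal" where
  "Lip_seminorm \<psi> = (SUP (x, y)\<in>{(x, y). x \<noteq> y}. ereal (\<bar>\<psi> x - \<psi> y\<bar> / norm (x - y)))"

definition BL_norm :: "('a::euclidean_space \<Rightarrow> real) \<Rightarrow> ereal" where
  "BL_norm \<psi> = max (Linf_norm \<psi>) (Lip_seminorm \<psi>)"

text \<open>
  A signed measure \<open>\<mu> = M - N\<close> is given by the pair \<open>M, N\<close>, and
  \<open>\<integral> f d\<mu> = \<integral> f dM - \<integral> f dN\<close>. The supremum below is one of real numbers; it is over a nonempty
  set, bounded above as soon as \<open>1 + V\<close> is integrable with respect to \<open>M\<close> and \<open>N\<close>.
\<close>

definition BLV_dual_norm ::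
    "('a::euclidean_space \<Rightarrow> real) \<Rightarrow> 'a measure \<Rightarrow> 'a measure \<Rightarrow> real" where
  "BLV_dual_norm V M N =
     (SUP \<psi>\<in>{\<psi>. BL_norm \<psi> \<le> 1}. (\<integral>x. \<psi> x * (1 + V x) \<partial>M) - (\<integral>x. \<psi> x * (1 + V x) \<partial>N))"

section \<open>The Stein gradient flow\<close>

definition partition_const :: "('a::euclidean_space \<Rightarrow> real) \<Rightarrow> real" where
  "partition_const V = (\<integral>x. exp (- V x) \<partial>lborel)"

definition rho_inf :: "('a::euclidean_space \<Rightarrow> real) \<Rightarrow> 'a \<Rightarrow> real" where
  "rho_inf V x = exp (- V x) / partition_const V"

definition rho_inf_measure :: "('a::euclidean_space \<Rightarrow> real) \<Rightarrow> 'a measure" where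
  "rho_inf_measure V = density lborel (\<lambda>x. ennreal (rho_inf V x))"

text \<open>
  Convolution \<open>f * k\<close>, where \<open>opr\<close> is the product used: multiplication, scalar multiplication
  or the inner product.
\<close>

definition conv ::
    "('b \<Rightarrow> 'c \<Rightarrow> 'd::{banach, second_countable_topology}) \<Rightarrow> ('a::euclidean_space \<Rightarrow> 'b) \<Rightarrow> ('a \<Rightarrow> 'c) \<Rightarrow> 'a \<Rightarrow> 'd"
  where "conv opr f k x = (\<integral>y. opr (f y) (k (x - y)) \<partial>lborel)"

text \<open>\<open>K * (\<nabla>M + M \<nabla>V) = \<nabla>K * M + K * (M \<nabla>V)\<close> for a nonnegative measure \<open>M\<close>.\<close>

definition stein_field ::
    "('a::euclidean_space \<Rightarrow> real) \<Rightarrow> ('a \<Rightarrow> real) \<Rightarrow> 'a measure \<Rightarrow> 'a \<Rightarrow> 'a" where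
  "stein_field K V M x = (\<integral>y. grad K (x - y) \<partial>M) + (\<integral>y. K (x - y) *\<^sub>R grad V y \<partial>M)"

text \<open>
  Test functions in \<open>C\<^sub>c\<^sup>\<infinity>([0,\<infinity>) \<times> \<real>\<^sup>d)\<close> are taken to be the restrictions of functions in
  \<open>C\<^sub>c\<^sup>\<infinity>(\<real> \<times> \<real>\<^sup>d)\<close>; in particular they need not vanish at time \<open>0\<close>.
\<close>

definition measure_solution ::
    "('a::euclidean_space \<Rightarrow> real) \<Rightarrow> ('a \<Rightarrow> real) \<Rightarrow> (real \<Rightarrow> 'a measure) \<Rightarrow> bool" where
  "measure_solution K V \<rho> \<longleftrightarrow>
     (\<forall>t\<ge>0. prob_space (\<rho> t) \<and> sets (\<rho> t) = sets borel) \<and>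
     (\<forall>f::'a \<Rightarrow> real. continuous_on UNIV f \<and> bounded (range f) \<longrightarrow>
        continuous_on {0..} (\<lambda>t. \<integral>x. f x \<partial>\<rho> t)) \<and>
     (\<forall>T>0. (SUP t\<in>{0..T}. \<integral>\<^sup>+x. ennreal (1 + V x) \<partial>\<rho> t) < \<infinity>) \<and>
     (\<forall>\<phi>::real \<Rightarrow> 'a \<Rightarrow> real. test_function (\<lambda>(t, x). \<phi> t x) \<longrightarrow>
        (LINT t:{0..}|lborel.
           (\<integral>x. deriv (\<lambda>s. \<phi> s x) t - grad (\<phi> t) x \<bullet> stein_field K V (\<rho> t) x \<partial>\<rho> t))
        + (\<integral>x. \<phi> 0 x \<partial>\<rho> 0) = 0)"

text \<open>
  Right-hand side of the dual equation at a fixed time, where \<open>\<mu> = M - N\<close> and \<open>f\<close>, \<open>h\<close> are the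
  time slices of \<open>\<phi>\<close> and \<open>g\<close>.
\<close>

definition dual_rhs ::
    "('a::euclidean_space \<Rightarrow> real) \<Rightarrow> ('a \<Rightarrow> real) \<Rightarrow> 'a measure \<Rightarrow> 'a measure \<Rightarrow>
     ('a \<Rightarrow> real) \<Rightarrow> ('a \<Rightarrow> real) \<Rightarrow> 'a \<Rightarrow> real" where
  "dual_rhs K V M N h f x =
     grad f x \<bullet> (stein_field K V M x - stein_field K V N x)
     + conv (\<bullet>) (\<lambda>y. f y *\<^sub>R grad (rho_inf V) y) (grad K) x
     - conv (\<lambda>v c. c *\<^sub>R v) (\<lambda>y. f y *\<^sub>R grad (rho_inf V) y) K x \<bullet> grad V x
     - conv (*) (\<lambda>y. rho_inf V y * f y) (laplacian K) x
     + conv (*\<^sub>R) (\<lambda>y. rho_inf V y * f y) (grad K) x \<bullet> grad V x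
     + h x * (1 + V x)"

text \<open>
  Classical solutions on \<open>[0,T] \<times> \<real>\<^sup>d\<close>: \<open>\<phi>\<close> and \<open>\<nabla>\<phi>\<close> are continuous and the equation holds pointwise
  (with one-sided time derivatives at \<open>0\<close> and \<open>T\<close>). So that the convolutions with the bounded
  functions \<open>K\<close>, \<open>\<nabla>K\<close>, \<open>\<Delta>K\<close> make sense uniformly in time, \<open>\<rho>\<^sub>\<infinity>\<phi>\<close> and \<open>\<phi>\<nabla>\<rho>\<^sub>\<infinity>\<close> are bounded in
  \<open>L\<^sup>1(\<real>\<^sup>d)\<close> on \<open>[0,T]\<close>. No integrability of \<open>\<rho>\<^sub>\<infinity>\<phi>\<^sup>2\<close> is required.
\<close>

definition dual_solution ::
    "('a::euclidean_space \<Rightarrow> real) \<Rightarrow> ('a \<Rightarrow> real) \<Rightarrow> (real \<Rightarrow> 'a measure) \<Rightarrow> real \<Rightarrow>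
     (real \<Rightarrow> 'a \<Rightarrow> real) \<Rightarrow> (real \<Rightarrow> 'a \<Rightarrow> real) \<Rightarrow> bool" where
  "dual_solution K V \<rho> T g \<phi> \<longleftrightarrow>
     continuous_on ({0..T} \<times> UNIV) (\<lambda>(t, x). \<phi> t x) \<and>
     (\<forall>t\<in>{0..T}. \<phi> t differentiable_on UNIV) \<and>
     continuous_on ({0..T} \<times> UNIV) (\<lambda>(t, x). grad (\<phi> t) x) \<and>
     (SUP t\<in>{0..T}. \<integral>\<^sup>+x. ennreal \<bar>rho_inf V x * \<phi> t x\<bar> \<partial>lborel) < \<infinity> \<and>
     (SUP t\<in>{0..T}. \<integral>\<^sup>+x. ennreal (norm (\<phi> t x *\<^sub>R grad (rho_inf V) x)) \<partial>lborel) < \<infinity> \<and>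
     (\<forall>t\<in>{0..T}. \<forall>x.
        ((\<lambda>s. \<phi> s x) has_real_derivative
           dual_rhs K V (\<rho> t) (rho_inf_measure V) (g t) (\<phi> t) x) (at t within {0..T}))"

text \<open>A Bochner integral: meaningful when \<open>\<rho>\<^sub>\<infinity>|f|\<^sup>2\<close> is integrable.\<close>

definition Q_norm :: "('a::euclidean_space \<Rightarrow> real) \<Rightarrow> ('a \<Rightarrow> real) \<Rightarrow> real" where
  "Q_norm V f = sqrt (\<integral>x. rho_inf V x * \<bar>f x\<bar>\<^sup>2 \<partial>lborel)"

end

theory Submission
  imports Defs
begin

text \<open>
  Put \<open>w = \<rho>\<^sub>\<infinity>\<close> and \<open>u = w \<phi>\<close>. The nonlocal terms of the dual equation are \<open>- div U + \<nabla>V \<bullet> U\<close> with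
  \<open>U = K * (\<nabla>u + u \<nabla>V)\<close>, so pairing them with \<open>u\<close> gives \<open>\<integral> (\<nabla>u + u \<nabla>V) \<bullet> U \<ge> 0\<close> by positivity of \<open>K\<close>.
  The transport term, with drift \<open>b = K * (\<nabla>\<mu> + \<mu> \<nabla>V)\<close>, contributes \<open>div b - \<nabla>V \<bullet> b\<close>, which is the pairing
  of \<open>(1 + V) \<mu>\<close> with a function of bounded Lipschitz norm at most a constant. Hence
  \<open>- d/dt \<integral> w \<phi>\<^sup>2 \<le> C \<parallel>\<mu>\<parallel> \<integral> w \<phi>\<^sup>2 + C \<parallel>g\<parallel> (\<integral> w \<phi>\<^sup>2)\<^sup>1\<^sup>/\<^sup>2\<close>, and Gronwall's inequality concludes.

  No decay of \<open>\<phi>\<close> is known beforehand, so the energy is localised by a cutoff that shrinks backwards in time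
  at least as fast as the drift moves; the sign of its time derivative then absorbs the boundary term. A first
  Gronwall argument, which bounds the nonlocal term only by \<open>L\<^sup>1\<close> norms, makes the localised energies uniformly
  bounded; letting the cutoff tend to 1 gives the integrability of \<open>w \<phi>\<^sup>2\<close> and restores the sign of the nonlocal
  term.
\<close>

section \<open>Differentiation under the integral and a Gronwall inequality\<close>

text \<open>The rate in the estimate must be the dual norm of \<mu>, so div b - grad V . b at x is
  written as the integral of one function of y against (1 + V) \<mu>. Its pieces carrying the
  unbounded factor grad V(x) are exactly the two functions assumed bounded Lipschitz uniformly in x;
  the others contain V only through quotients such as grad V / (1 + V) and need K to have Lipschitz
  second derivatives. This is why the Sobolev hypothesis is turned into classical regularity.
  Positivity of K gives a sign only when the same function stands on both sides of the form. In the
  localised energy the cutoff multiplies one side only, so the sign returns only in the limit; and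
  as the time derivatives of the energies are not bounded uniformly in the cutoff, the limit is
  taken in the inequality integrated over time. The source g (1 + V) is paired with w phi by
  Cauchy-Schwarz, which costs the moment of (1 + V)^2 under w. The final constant is twice the
  larger of the Lipschitz bound of the kernel and the root of that moment plus 1; the factor 2 stems
  from the elementary Gronwall argument.\<close>

lemma has_real_derivative_integral:
  fixes f f' :: "real \<Rightarrow> 'b \<Rightarrow> real"
  assumes S: "convex S" "t \<in> S"
    and int: "\<And>s. s \<in> S \<Longrightarrow> integrable M (f s)"
    and der: "\<And>s y. s \<in> S \<Longrightarrow> ((\<lambda>s. f s y) has_real_derivative f' s y) (at s within S)"
    and bd: "\<And>s y. s \<in> S \<Longrightarrow> \<bar>f' s y\<bar> \<le> g y"
    and g: "integrable M g" and meas: "f' t \<in> borel_measurable M"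
  shows "((\<lambda>s. \<integral>y. f s y \<partial>M) has_real_derivative (\<integral>y. f' t y \<partial>M)) (at t within S)"
  unfolding has_field_derivative_iff tendsto_at_iff_sequentially
proof (intro allI impI)
  fix X assume X: "\<forall>i. X i \<in> S - {t}" "X \<longlonglongrightarrow> t"
  have XS: "X i \<in> S" "X i \<noteq> t" for i using X by auto
  have "(\<lambda>i. \<integral>y. (f (X i) y - f t y) / (X i - t) \<partial>M) \<longlonglongrightarrow> (\<integral>y. f' t y \<partial>M)"
  proof (rule integral_dominated_convergence[where w=g])
    show "AE y in M. (\<lambda>i. (f (X i) y - f t y) / (X i - t)) \<longlonglongrightarrow> f' t y"
      using der[OF S(2)] X unfolding has_field_derivative_iff tendsto_at_iff_sequentially comp_def by auto
    fix i
    show "AE y in M. norm ((f (X i) y - f t y) / (X i - t)) \<le> g y"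
    proof (intro AE_I2)
      fix y
      \<comment> \<open>Mean value inequality within the convex set \<open>S\<close>: it makes
        \<open>g\<close> a common majorant of all difference quotients, also at the endpoints of a
        time interval, where only one-sided derivatives exist.\<close>
      have "norm (f (X i) y - f t y) \<le> g y * norm (X i - t)"
        by (rule field_differentiable_bound[OF S(1) der]) (use bd XS S in auto)
      then show "norm ((f (X i) y - f t y) / (X i - t)) \<le> g y"
        using XS[of i] by (simp add: field_simps)
    qed
  qed (use int XS S g meas in \<open>auto intro!: borel_measurable_integrable integrable_diff integrable_divide\<close>)
  moreover have "(\<integral>y. (f (X i) y - f t y) / (X i - t) \<partial>M) = ((\<integral>y. f (X i) y \<partial>M) - (\<integral>y. f t y \<partial>M)) / (X i - t)" for i
    using int[OF XS(1)[of i]] int[OF S(2)] by simp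
  ultimately show "((\<lambda>s. ((\<integral>y. f s y \<partial>M) - (\<integral>y. f t y \<partial>M)) / (s - t)) \<circ> X) \<longlonglongrightarrow> (\<integral>y. f' t y \<partial>M)"
    by (simp add: comp_def XS)
qed

section \<open>Invariance of Lebesgue measure and integration by parts\<close>

lemma lborel_integral_shift:
  fixes f :: "'a::euclidean_space \<Rightarrow> 'b::{banach, second_countable_topology}"
  assumes [measurable]: "f \<in> borel_measurable borel"
  shows "(\<integral>x. f (x + c) \<partial>lborel) = (\<integral>x. f x \<partial>lborel)"
proof -
  have "(\<integral>x. f x \<partial>lborel) = (\<integral>x. f x \<partial>distr lborel borel ((+) c))"
    by (simp add: lborel_distr_plus)
  also have "\<dots> = (\<integral>x. f (c + x) \<partial>lborel)"
    by (subst integral_distr) auto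
  finally show ?thesis by (simp add: add.commute)
qed

lemma lborel_integrable_shift:
  fixes f :: "'a::euclidean_space \<Rightarrow> 'b::{banach, second_countable_topology}"
  assumes "integrable lborel f"
  shows "integrable lborel (\<lambda>x. f (x + c))"
proof -
  have "integrable (distr lborel borel ((+) c)) f"
    using assms by (simp add: lborel_distr_plus)
  then show ?thesis
    by (subst (asm) integrable_distr_eq) (use assms in \<open>auto simp: add.commute\<close>)
qed

text \<open>The affine change of variables with factor -1 has Jacobian |-1|^d = 1.\<close>

lemma distr_lborel_reflect: "distr lborel borel (\<lambda>y::'a::euclidean_space. x - y) = lborel"
proof -
  have "lborel = density (distr lborel borel (\<lambda>y::'a. x + (-1) *\<^sub>R y)) (\<lambda>_. ennreal \<bar>-1\<bar> ^ DIM('a))"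
    using lborel_affine[of "-1" x] by simp
  also have "\<dots> = distr lborel borel (\<lambda>y::'a. x - y)"
    by (simp add: density_1)
  finally show ?thesis by simp
qed

lemma lborel_integral_reflect:
  fixes f :: "'a::euclidean_space \<Rightarrow> 'b::{banach, second_countable_topology}"
  assumes [measurable]: "f \<in> borel_measurable borel"
  shows "(\<integral>y. f (x - y) \<partial>lborel) = (\<integral>y. f y \<partial>lborel)"
proof -
  have "(\<integral>y. f y \<partial>lborel) = (\<integral>y. f y \<partial>distr lborel borel (\<lambda>y. x - y))"
    by (simp add: distr_lborel_reflect)
  also have "\<dots> = (\<integral>y. f (x - y) \<partial>lborel)"
    by (subst integral_distr) auto
  finally show ?thesis by simp
qed

lemma lborel_integrable_reflect:
  fixes f :: "'a::euclidean_space \<Rightarrow> 'b::{banach, second_countable_topology}"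
  assumes "integrable lborel f"
  shows "integrable lborel (\<lambda>y. f (x - y))"
proof -
  have "integrable (distr lborel borel (\<lambda>y. x - y)) f"
    using assms by (simp add: distr_lborel_reflect)
  then show ?thesis
    by (subst (asm) integrable_distr_eq) (use assms in auto)
qed

lemma integrable_lborel_bounded_support:
  fixes f :: "'a::euclidean_space \<Rightarrow> 'b::{banach, second_countable_topology}"
  assumes [measurable]: "f \<in> borel_measurable borel"
    and "\<And>x. norm (f x) \<le> B" and "\<And>x. norm x > r \<Longrightarrow> f x = 0"
  shows "integrable lborel f"
proof (rule integrableI_bounded_set[where A="cball 0 r" and B=B])
  show "emeasure lborel (cball 0 r :: 'a set) < \<infinity>"
    using emeasure_bounded_finite[of "cball 0 r"] by simp
qed (use assms in \<open>auto simp: not_le\<close>)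

text \<open>The set |x| > r is open, so the function vanishes along a short segment through x. This
  carries compact support over to directional derivatives.\<close>

lemma has_real_derivative_locally_zero:
  fixes f :: "'a::real_normed_vector \<Rightarrow> real"
  assumes "\<And>s. ((\<lambda>s. f (x + s *\<^sub>R e)) has_real_derivative D (x + s *\<^sub>R e)) (at s)"
    and "\<And>x. norm x > r \<Longrightarrow> f x = 0" and "norm x > r"
  shows "D x = 0"
proof -
  have "((\<lambda>s. x + s *\<^sub>R e) \<longlongrightarrow> x + 0 *\<^sub>R e) (at 0)"
    by (intro tendsto_intros)
  then have "\<forall>\<^sub>F s in at 0. norm (x + s *\<^sub>R e) > r"
    using assms(3) by (intro order_tendstoD(1)[of _ "norm x"]) (auto intro!: tendsto_norm)
  then have "\<forall>\<^sub>F s in at 0. f (x + s *\<^sub>R e) = 0"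
    by eventually_elim (use assms(2) in auto)
  then have "((\<lambda>s. f (x + s *\<^sub>R e)) has_real_derivative 0) (at 0) \<longleftrightarrow> ((\<lambda>s. 0) has_real_derivative 0) (at (0::real))"
    by (intro has_field_derivative_cong_eventually) (use assms in auto)
  then have "((\<lambda>s. f (x + s *\<^sub>R e)) has_real_derivative 0) (at 0)" by simp
  from DERIV_unique[OF this assms(1)[of 0]] show ?thesis by simp
qed

text \<open>By translation invariance the integral of F(x + s e) does not depend on s, so its
  derivative at s = 0 is both 0 and the integral of D. All integrations by parts below rest on
  this.\<close>

lemma integral_directional_derivative_eq_0:
  fixes F D :: "'a::euclidean_space \<Rightarrow> real"
  assumes der: "\<And>x s. ((\<lambda>s. F (x + s *\<^sub>R e)) has_real_derivative D (x + s *\<^sub>R e)) (at s)"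
    and [measurable]: "F \<in> borel_measurable borel" "D \<in> borel_measurable borel"
    and F: "integrable lborel F"
    and D: "\<And>x. \<bar>D x\<bar> \<le> M" and supp: "\<And>x. norm x > r \<Longrightarrow> F x = 0"
  shows "(\<integral>x. D x \<partial>lborel) = 0"
proof -
  have D0: "D x = 0" if "norm x > r" for x
    using has_real_derivative_locally_zero[of F x e D r] der supp that by blast
  \<comment> \<open>For |s| < 1 the translated supports stay in this larger ball, which gives a
    majorant independent of s.\<close>
  let ?r = "r + norm e"
  have "((\<lambda>s. \<integral>x. F (x + s *\<^sub>R e) \<partial>lborel) has_real_derivative (\<integral>x. D (x + 0 *\<^sub>R e) \<partial>lborel)) (at 0 within {-1<..<1})"
  proof (rule has_real_derivative_integral[where g="\<lambda>x. M * indicator (cball 0 ?r) x"])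
    show "integrable lborel (\<lambda>x::'a. M * indicator (cball 0 ?r) x)"
      by (intro integrable_mult_right integrable_real_indicator) (use emeasure_bounded_finite[of "cball 0 ?r"] in auto)
    fix s :: real and x assume s: "s \<in> {-1<..<1}"
    show "((\<lambda>s. F (x + s *\<^sub>R e)) has_real_derivative D (x + s *\<^sub>R e)) (at s within {-1<..<1})"
      using der has_field_derivative_at_within by blast
    show "\<bar>D (x + s *\<^sub>R e)\<bar> \<le> M * indicator (cball 0 ?r) x"
    proof (cases "norm x \<le> ?r")
      case False
      have "norm x \<le> norm (x + s *\<^sub>R e) + norm (s *\<^sub>R e)"
        by (metis add_diff_cancel norm_triangle_ineq4)
      moreover have "norm (s *\<^sub>R e) \<le> norm e" using s by (auto simp: mult_left_le_one_le)
      ultimately have "norm (x + s *\<^sub>R e) > r" using False by simp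
      then show ?thesis using False D0 by simp
    qed (use D in simp)
  qed (use F lborel_integrable_shift in auto)
  then have "((\<lambda>s. \<integral>x. F x \<partial>lborel) has_real_derivative (\<integral>x. D x \<partial>lborel)) (at 0)"
    by (simp add: lborel_integral_shift at_within_open[of _ "{-1<..<1}"])
  from DERIV_unique[OF this DERIV_const] show ?thesis .
qed

lemma integrable_pair_lborel_bounded:
  fixes h :: "'a::euclidean_space \<times> 'b::euclidean_space \<Rightarrow> real"
  assumes [measurable]: "h \<in> borel_measurable (lborel \<Otimes>\<^sub>M lborel)"
    and F: "integrable lborel F" and G: "integrable lborel G"
    and bd: "\<And>x y. \<bar>h (x, y)\<bar> \<le> F x * G y"
  shows "integrable (lborel \<Otimes>\<^sub>M lborel) h"
proof -
  have [measurable]: "F \<in> borel_measurable borel" "G \<in> borel_measurable borel" using F G by auto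
  have i: "integrable lborel (\<lambda>y. h (x, y))" for x
    by (rule Bochner_Integration.integrable_bound[OF integrable_mult_right[OF G, of "F x"]])
       (use bd in \<open>auto intro!: order_trans[OF bd] AE_I2\<close>)
  show ?thesis
  proof (rule lborel_pair.Fubini_integrable)
    show "integrable lborel (\<lambda>x. \<integral>y. norm (h (x, y)) \<partial>lborel)"
    proof (rule Bochner_Integration.integrable_bound[OF integrable_mult_left[OF F, of "\<integral>y. G y \<partial>lborel"]])
      show "AE x in lborel. norm (\<integral>y. norm (h (x, y)) \<partial>lborel) \<le> norm (F x * (\<integral>y. G y \<partial>lborel))"
      proof (intro AE_I2)
        fix x
        have "(\<integral>y. norm (h (x, y)) \<partial>lborel) \<le> (\<integral>y. F x * G y \<partial>lborel)"
          by (intro integral_mono i integrable_norm integrable_mult_right G) (use bd in auto)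
        then show "norm (\<integral>y. norm (h (x, y)) \<partial>lborel) \<le> norm (F x * (\<integral>y. G y \<partial>lborel))"
          by simp
      qed
    qed measurable
  qed (use i in auto)
qed

text \<open>
  The factors 2 allow an elementary proof: on an interval where \<open>\<integral>a \<le> 1/2\<close> one absorbs the supremum of \<open>sqrt E\<close>,
  and the estimates for consecutive short intervals multiply.
\<close>

lemma sqrt_gronwall:
  fixes E a h :: "real \<Rightarrow> real"
  assumes s: "s \<in> {0..T}"
    and E: "\<And>t. t \<in> {0..T} \<Longrightarrow> 0 \<le> E t" "\<And>t. t \<in> {0..T} \<Longrightarrow> E t \<le> B"
    and a: "\<And>t. t \<in> {0..T} \<Longrightarrow> 0 \<le> a t" "\<And>t. t \<in> {0..T} \<Longrightarrow> a t \<le> A"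
    and h: "\<And>t. t \<in> {0..T} \<Longrightarrow> 0 \<le> h t"
    and int: "set_integrable lborel {0..T} a" "set_integrable lborel {0..T} h"
      "set_integrable lborel {0..T} (\<lambda>r. a r * E r + 2 * h r * sqrt (E r))"
    and ineq: "\<And>s t. 0 \<le> s \<Longrightarrow> s \<le> t \<Longrightarrow> t \<le> T \<Longrightarrow>
      E s \<le> E t + (LINT r:{s..t}|lborel. a r * E r + 2 * h r * sqrt (E r))"
  shows "sqrt (E s) \<le> exp (2 * (LINT r:{s..T}|lborel. a r)) * (sqrt (E T) + 2 * (LINT r:{s..T}|lborel. h r))"
proof -
  define \<alpha> where "\<alpha> s t = (LINT r:{s..t}|lborel. a r)" for s t
  define \<beta> where "\<beta> s t = (LINT r:{s..t}|lborel. h r)" for s t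
  have sub: "set_integrable lborel {s..t} f" if "set_integrable lborel {0..T} f" "0 \<le> s" "t \<le> T" for s t and f :: "real \<Rightarrow> real"
    by (rule set_integrable_subset[OF that(1)]) (use that in auto)
  have comb: "(LINT r:{s..t}|lborel. f r) + (LINT r:{t..u}|lborel. f r) = (LINT r:{s..u}|lborel. f r)"
    if "set_integrable lborel {0..T} f" "0 \<le> s" "s \<le> t" "t \<le> u" "u \<le> T" for s t u and f :: "real \<Rightarrow> real"
  proof -
    have "set_integrable lborel {s..t} f" "set_integrable lborel {t..u} f" "set_integrable lborel {s..u} f"
      using that by (auto intro!: sub)
    then show ?thesis
      using that set_borel_integral_eq_integral(1)[of "{s..u}" f]
      by (simp add: set_borel_integral_eq_integral(2) Henstock_Kurzweil_Integration.integral_combine)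
  qed
  have nn: "\<alpha> s t \<ge> 0" "\<beta> s t \<ge> 0" if "0 \<le> s" "t \<le> T" for s t
    unfolding \<alpha>_def \<beta>_def set_lebesgue_integral_def using a h that
    by (auto intro!: integral_nonneg_AE AE_I2 simp: indicator_def)
  have step: "sqrt (E s) \<le> exp (2 * \<alpha> s t) * (sqrt (E t) + 2 * \<beta> s t)"
    if st: "0 \<le> s" "s \<le> t" "t \<le> T" and small: "A * (t - s) \<le> 1/2" for s t
  proof -
    define M where "M = (SUP r\<in>{s..t}. sqrt (E r))"
    have bdd: "bdd_above ((\<lambda>r. sqrt (E r)) ` {s..t})"
      using E(2) st by (intro bdd_aboveI2[of _ _ "sqrt B"]) auto
    have M: "sqrt (E r) \<le> M" if "r \<in> {s..t}" for r
      unfolding M_def by (rule cSUP_upper[OF that bdd])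
    have EM: "E r \<le> M\<^sup>2" "sqrt (E r) \<le> M" if "r \<in> {s..t}" for r
      using M[OF that] E(1)[of r] that st by (auto simp: sqrt_le_D)
    have M0: "0 \<le> M" using M[of t] E(1)[of t] st by (meson atLeastAtMost_iff order_refl order_trans real_sqrt_ge_zero)
    \<comment> \<open>One factor \<open>M\<close> is kept in every term, also in the bound of
      \<open>E t\<close> by sqrt(E t) \<open>M\<close>, so that division by \<open>M\<close> will
      give an inequality linear in the supremum of sqrt E.\<close>
    have 1: "E r \<le> sqrt (E t) * M + \<alpha> s t * M\<^sup>2 + 2 * \<beta> s t * M" if r: "r \<in> {s..t}" for r
    proof -
      have ir: "set_integrable lborel {r..t} a" "set_integrable lborel {r..t} h"
        "set_integrable lborel {r..t} (\<lambda>r. a r * E r + 2 * h r * sqrt (E r))"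
        using r st by (auto intro!: sub int)
      have "E r \<le> E t + (LINT r:{r..t}|lborel. a r * E r + 2 * h r * sqrt (E r))"
        using ineq r st by auto
      also have "(LINT r:{r..t}|lborel. a r * E r + 2 * h r * sqrt (E r)) \<le> (LINT r:{r..t}|lborel. a r * M\<^sup>2 + 2 * h r * M)"
      proof (rule set_integral_mono)
        show "set_integrable lborel {r..t} (\<lambda>r. a r * M\<^sup>2 + 2 * h r * M)"
          using ir by (intro set_integral_add set_integrable_mult_left set_integrable_mult_right) auto
        fix q assume "q \<in> {r..t}"
        then show "a q * E q + 2 * h q * sqrt (E q) \<le> a q * M\<^sup>2 + 2 * h q * M"
          using EM[of q] a(1)[of q] h[of q] r st by (intro add_mono mult_left_mono) auto
      qed (use ir in auto)
      also have "\<dots> = (LINT r:{r..t}|lborel. a r) * M\<^sup>2 + 2 * (LINT r:{r..t}|lborel. h r) * M"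
        using ir by (subst set_integral_add) auto
      also have "\<dots> \<le> \<alpha> s t * M\<^sup>2 + 2 * \<beta> s t * M"
      proof -
        have "(LINT r:{r..t}|lborel. a r) \<le> \<alpha> s t" "(LINT r:{r..t}|lborel. h r) \<le> \<beta> s t"
          using comb[OF int(1), of s r t] comb[OF int(2), of s r t] nn[of s r] r st
          unfolding \<alpha>_def \<beta>_def by auto
        then show ?thesis using M0 by (intro add_mono mult_right_mono mult_left_mono) auto
      qed
      also have "E t \<le> sqrt (E t) * M"
        using mult_left_mono[OF EM(2)[of t], of "sqrt (E t)"] E(1)[of t] st by simp
      finally show ?thesis by simp
    qed
    have "\<alpha> s t \<le> 1/2"
    proof -
      have "\<alpha> s t \<le> (LINT r:{s..t}|lborel. A)"
        unfolding \<alpha>_def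
      proof (rule set_integral_mono)
        show "set_integrable lborel {s..t} a" using sub int(1) st by simp
        show "set_integrable lborel {s..t} (\<lambda>r. A)" by (rule borel_integrable_atLeastAtMost') auto
      qed (use a st in auto)
      also have "\<dots> = A * (t - s)" using st by (simp add: set_lebesgue_integral_def)
      finally show ?thesis using small by simp
    qed
    have "M \<le> sqrt (sqrt (E t) * M + \<alpha> s t * M\<^sup>2 + 2 * \<beta> s t * M)"
      unfolding M_def by (rule cSUP_least) (use 1 st in \<open>auto simp: M_def\<close>)
    then have "M\<^sup>2 \<le> sqrt (E t) * M + \<alpha> s t * M\<^sup>2 + 2 * \<beta> s t * M"
      using power_mono[OF _ M0, of "sqrt (sqrt (E t) * M + \<alpha> s t * M\<^sup>2 + 2 * \<beta> s t * M)" 2] M0 nn[of s t] E(1)[of t] st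
      by simp
    then have "M * M \<le> (sqrt (E t) + \<alpha> s t * M + 2 * \<beta> s t) * M"
      by (simp add: power2_eq_square algebra_simps)
    then have Mle: "M \<le> sqrt (E t) + \<alpha> s t * M + 2 * \<beta> s t"
      using M0 nn[of s t] E(1)[of t] st by (cases "M = 0") auto
    \<comment> \<open>For 0 \<le> \<alpha> \<le> 1/2 this leads to 1 / (1 - \<alpha>) \<le> exp (2
      \<alpha>): absorbing the term \<alpha> M on the left costs the factor 2 in the
      exponent.\<close>
    have "1 \<le> (1 - \<alpha> s t) * (1 + 2 * \<alpha> s t)"
      using nn(1)[of s t] \<open>\<alpha> s t \<le> 1/2\<close> st mult_left_mono[of "\<alpha> s t" "1/2" "\<alpha> s t"] by (simp add: algebra_simps)
    also have "\<dots> \<le> (1 - \<alpha> s t) * exp (2 * \<alpha> s t)"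
      using \<open>\<alpha> s t \<le> 1/2\<close> by (intro mult_left_mono) auto
    finally have e: "1 \<le> (1 - \<alpha> s t) * exp (2 * \<alpha> s t)" .
    have "M \<le> M * ((1 - \<alpha> s t) * exp (2 * \<alpha> s t))"
      using M0 e mult_left_mono[OF e M0] by simp
    also have "\<dots> = exp (2 * \<alpha> s t) * (M - \<alpha> s t * M)" by (simp add: algebra_simps)
    also have "\<dots> \<le> exp (2 * \<alpha> s t) * (sqrt (E t) + 2 * \<beta> s t)"
      using Mle by (intro mult_left_mono) auto
    finally show ?thesis using M[of s] st by auto
  qed
  \<comment> \<open>On an interval of length at most \<open>d\<close> the integral of
    \<open>a\<close> is at most 1/2; the summand 1 avoids division by zero.\<close>
  define d where "d = 1 / (2 * (\<bar>A\<bar> + 1))"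
  have d: "d > 0" "A * u \<le> 1/2" if "0 \<le> u" "u \<le> d" for u
  proof -
    show "d > 0" by (simp add: d_def add_nonneg_pos)
    have "A * u \<le> \<bar>A\<bar> * d" using that by (intro mult_mono) auto
    also have "\<dots> \<le> 1/2" by (simp add: d_def field_simps)
    finally show "A * u \<le> 1/2" .
  qed
  have d0: "d > 0" by (simp add: d_def add_nonneg_pos)
  \<comment> \<open>Induction on the number of steps of length \<open>d\<close> that lead from
    \<open>T\<close> back to \<open>s\<close>.\<close>
  have main: "sqrt (E s) \<le> exp (2 * \<alpha> s T) * (sqrt (E T) + 2 * \<beta> s T)"
    if "0 \<le> s" "s \<le> T" "T - real n * d \<le> s" for n s
    using that
  proof (induction n arbitrary: s)
    case 0
    then have "s = T" by simp
    then show ?case using step[of T T] 0 by auto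
  next
    case (Suc n)
    define t where "t = min T (s + d)"
    have t: "s \<le> t" "t \<le> T" "0 \<le> t" "T - real n * d \<le> t" "t - s \<le> d"
      using Suc.prems d0 by (auto simp: t_def algebra_simps min_def)
    have ih: "sqrt (E t) \<le> exp (2 * \<alpha> t T) * (sqrt (E T) + 2 * \<beta> t T)" using Suc.IH t by auto
    have "sqrt (E s) \<le> exp (2 * \<alpha> s t) * (sqrt (E t) + 2 * \<beta> s t)"
      using step[of s t] Suc.prems t d(2)[of "t - s"] by auto
    also have "\<dots> \<le> exp (2 * \<alpha> s t) * (exp (2 * \<alpha> t T) * (sqrt (E T) + 2 * \<beta> t T) + exp (2 * \<alpha> t T) * (2 * \<beta> s t))"
    proof (intro mult_left_mono add_mono ih)
      \<comment> \<open>The source of the short interval is enlarged by a factor at least 1, so that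
        it can share the exponential of the remaining interval.\<close>
      have "1 \<le> exp (2 * \<alpha> t T)" using nn(1)[of t T] t by simp
      then show "2 * \<beta> s t \<le> exp (2 * \<alpha> t T) * (2 * \<beta> s t)"
        using mult_right_mono[of 1 "exp (2 * \<alpha> t T)" "2 * \<beta> s t"] nn(2)[of s t] t Suc.prems by auto
    qed auto
    also have "\<dots> = exp (2 * (\<alpha> s t + \<alpha> t T)) * (sqrt (E T) + 2 * (\<beta> s t + \<beta> t T))"
      by (simp add: exp_add algebra_simps)
    also have "\<alpha> s t + \<alpha> t T = \<alpha> s T"
      unfolding \<alpha>_def using comb int Suc.prems t by auto
    also have "\<beta> s t + \<beta> t T = \<beta> s T"
      unfolding \<beta>_def using comb int Suc.prems t by auto
    finally show ?case .
  qed
  obtain n where "real n * d \<ge> T" using d0 ex_less_of_nat_mult[of d T] less_imp_le by blast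
  then show ?thesis using main[of s n] s unfolding \<alpha>_def \<beta>_def by auto
qed

section \<open>Smooth functions and bump functions\<close>

lemma pd_eqI: "(f has_derivative f') (at x) \<Longrightarrow> pd b f x = f' b"
  unfolding pd_def using frechet_derivative_at by metis

lemma has_derivative_pd:
  assumes "f differentiable at x"
  shows "(f has_derivative (\<lambda>h. \<Sum>b\<in>Basis. (h \<bullet> b) *\<^sub>R pd b f x)) (at x)"
proof -
  let ?D = "frechet_derivative f (at x)"
  have D: "(f has_derivative ?D) (at x)" using assms frechet_derivative_works by blast
  interpret D: linear ?D using D has_derivative_linear by blast
  have "?D = (\<lambda>h. \<Sum>b\<in>Basis. (h \<bullet> b) *\<^sub>R pd b f x)"
  proof
    fix h
    have "?D h = ?D (\<Sum>b\<in>Basis. (h \<bullet> b) *\<^sub>R b)" by (simp add: euclidean_representation)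
    also have "\<dots> = (\<Sum>b\<in>Basis. (h \<bullet> b) *\<^sub>R pd b f x)" by (simp add: D.sum D.scale pd_def)
    finally show "?D h = (\<Sum>b\<in>Basis. (h \<bullet> b) *\<^sub>R pd b f x)" .
  qed
  with D show ?thesis by simp
qed

lemma grad_inner_Basis: "b \<in> Basis \<Longrightarrow> grad f x \<bullet> b = pd b f x"
  unfolding grad_def by (simp add: inner_sum_left inner_Basis if_distrib sum.delta' cong: if_cong)

lemma has_derivative_grad:
  fixes f :: "'a::euclidean_space \<Rightarrow> real"
  assumes "f differentiable at x"
  shows "(f has_derivative (\<lambda>h. grad f x \<bullet> h)) (at x)"
proof -
  have "(\<Sum>b\<in>Basis. (h \<bullet> b) *\<^sub>R pd b f x) = grad f x \<bullet> h" for h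
    unfolding grad_def inner_sum_left by (simp add: inner_commute mult.commute)
  then show ?thesis using has_derivative_pd[OF assms] by simp
qed

lemma has_derivative_along_line:
  fixes f :: "'a::real_normed_vector \<Rightarrow> real" and x e :: 'a
  assumes "(f has_derivative f') (at (x + s *\<^sub>R e))"
  shows "((\<lambda>s. f (x + s *\<^sub>R e)) has_real_derivative f' e) (at s)"
proof -
  interpret linear f' using assms has_derivative_linear by blast
  have "((\<lambda>s. x + s *\<^sub>R e) has_derivative (\<lambda>r. r *\<^sub>R e)) (at s)"
    by (auto intro!: derivative_eq_intros)
  moreover have "(\<lambda>r. f' (r *\<^sub>R e)) = (*) (f' e)" by (simp add: fun_eq_iff scale mult.commute)
  ultimately show ?thesis
    unfolding has_field_derivative_def
    using has_derivative_compose[of "\<lambda>s. x + s *\<^sub>R e" "\<lambda>r. r *\<^sub>R e" s UNIV f f'] assms by simp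
qed

lemma has_real_derivative_pd_line:
  fixes f :: "'a::euclidean_space \<Rightarrow> real" and x e :: 'a
  assumes "f differentiable_on UNIV" 
  shows "((\<lambda>s. f (x + s *\<^sub>R e)) has_real_derivative pd e f (x + s *\<^sub>R e)) (at s)"
proof -
  have "f differentiable at (x + s *\<^sub>R e)" using assms by (simp add: differentiable_on_def)
  from has_derivative_along_line[OF this[unfolded frechet_derivative_works]] show ?thesis
    by (simp add: pd_def)
qed

text \<open>Iterated partial derivatives never leave a family closed under \<open>pd\<close>.
  Exhibiting such a family of differentiable functions proves smoothness of bumps, reflections and
  convolutions without computing higher derivatives.\<close>

lemma smooth_coinduct:
  assumes "f \<in> X" and "\<And>f. f \<in> X \<Longrightarrow> f differentiable_on UNIV"
    and "\<And>f b. f \<in> X \<Longrightarrow> b \<in> Basis \<Longrightarrow> pd b f \<in> X"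
  shows "smooth f"
proof -
  have "iter_pd bs f \<in> X" if "set bs \<subseteq> Basis" for bs
    using that by (induction bs) (use assms in \<open>auto simp: iter_pd_def\<close>)
  then show ?thesis unfolding smooth_def using assms(2) by (auto simp: lists_eq_set)
qed

lemma smooth_pd:
  fixes f :: "'a::euclidean_space \<Rightarrow> 'b::real_normed_vector"
  shows "smooth f \<Longrightarrow> b \<in> Basis \<Longrightarrow> smooth (pd b f)"
  unfolding smooth_def
proof
  fix bs :: "'a list" assume *: "\<forall>bs\<in>lists Basis. iter_pd bs f differentiable_on UNIV" "b \<in> Basis" "bs \<in> lists Basis"
  \<comment> \<open>\<open>foldr\<close> applies the last entry of the list first, so appending
    \<open>b\<close> means differentiating by \<open>b\<close> before all of
    \<open>bs\<close>.\<close>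
  then have "iter_pd (bs @ [b]) f differentiable_on UNIV" by auto
  then show "iter_pd bs (pd b f) differentiable_on UNIV" by (simp add: iter_pd_def)
qed

lemma smooth_differentiable: "smooth f \<Longrightarrow> f differentiable_on UNIV"
  unfolding smooth_def by (auto simp: iter_pd_def dest: bspec[of _ _ "[]"])

lemma smooth_continuous: "smooth f \<Longrightarrow> continuous_on UNIV f"
  by (simp add: differentiable_imp_continuous_on smooth_differentiable)

lemma test_functionD:
  fixes f :: "'a::euclidean_space \<Rightarrow> 'b::real_normed_vector"
  assumes "test_function f"
  shows "\<exists>r>0. \<forall>x. norm x > r \<longrightarrow> f x = 0"
proof -
  have "bounded (closure {x. f x \<noteq> 0})" using assms by (simp add: test_function_def compact_imp_bounded)
  then obtain r where r: "r > 0" "\<And>x. x \<in> closure {x. f x \<noteq> 0} \<Longrightarrow> norm x \<le> r"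
    by (auto simp: bounded_pos)
  have "f x = 0" if "norm x > r" for x
    using r(2)[of x] closure_subset[of "{x. f x \<noteq> 0}"] that by auto
  with r(1) show ?thesis by blast
qed

lemma test_functionI:
  fixes f :: "'a::euclidean_space \<Rightarrow> 'b::real_normed_vector"
  assumes "smooth f" and "\<And>x. norm x > r \<Longrightarrow> f x = 0"
  shows "test_function f"
proof -
  have "{x. f x \<noteq> 0} \<subseteq> cball 0 r" using assms(2) by force
  then show ?thesis
    using assms(1) bounded_closure[OF bounded_subset[OF bounded_cball]]
    by (auto simp: test_function_def compact_eq_bounded_closed)
qed

lemma test_function_pd:
  fixes f :: "'a::euclidean_space \<Rightarrow> real"
  assumes "test_function f" "b \<in> Basis"
  shows "test_function (pd b f)"
proof -
  obtain r where r: "r > 0" "\<And>x. norm x > r \<Longrightarrow> f x = 0" using test_functionD[OF assms(1)] by blast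
  have sm: "smooth f" using assms by (simp add: test_function_def)
  show ?thesis
  proof (rule test_functionI[of _ r])
    show "smooth (pd b f)" using sm assms smooth_pd by blast
    show "pd b f x = 0" if "norm x > r" for x
      using has_real_derivative_locally_zero[of f x b "pd b f" r, OF has_real_derivative_pd_line] 
        smooth_differentiable[OF sm] r that by blast
  qed
qed

lemma test_function_continuous:
  "test_function f \<Longrightarrow> continuous_on UNIV f"
  by (simp add: test_function_def smooth_continuous)

lemma bounded_of_continuous_support:
  fixes f :: "'a::euclidean_space \<Rightarrow> real"
  assumes "continuous_on UNIV f" "\<And>x. norm x > r \<Longrightarrow> f x = 0"
  shows "\<exists>B>0. \<forall>x. \<bar>f x\<bar> \<le> B"
proof -
  have "bounded (f ` cball 0 r)"
    by (intro compact_imp_bounded compact_continuous_image continuous_on_subset[OF assms(1)]) auto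
  then obtain B where B: "B > 0" "\<And>x. x \<in> cball 0 r \<Longrightarrow> \<bar>f x\<bar> \<le> B"
    by (auto simp: bounded_pos)
  have "\<bar>f x\<bar> \<le> B" for x
    using B assms(2)[of x] by (cases "norm x \<le> r") auto
  with B(1) show ?thesis by blast
qed

lemma test_function_bounded:
  fixes f :: "'a::euclidean_space \<Rightarrow> real"
  assumes "test_function f"
  shows "\<exists>B>0. \<forall>x. \<bar>f x\<bar> \<le> B"
proof -
  obtain r where r: "r > 0" "\<And>x. norm x > r \<Longrightarrow> f x = 0" using test_functionD[OF assms(1)] by blast
  show ?thesis
    by (rule bounded_of_continuous_support[OF test_function_continuous[OF assms] r(2)])
qed

lemma test_function_measurable: 
  fixes f :: "'a::euclidean_space \<Rightarrow> real"
  shows "test_function f \<Longrightarrow> f \<in> borel_measurable borel"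
  by (simp add: borel_measurable_continuous_onI test_function_continuous)

lemma test_function_integrable:
  fixes f :: "'a::euclidean_space \<Rightarrow> real"
  assumes "test_function f"
  shows "integrable lborel f"
proof -
  obtain r where r: "r > 0" "\<And>x. norm x > r \<Longrightarrow> f x = 0" using test_functionD[OF assms(1)] by blast
  obtain B where B: "B > 0" "\<And>x. \<bar>f x\<bar> \<le> B" using test_function_bounded[OF assms(1)] by blast
  show ?thesis
    by (rule integrable_lborel_bounded_support[of f B r]) (use r B test_function_measurable[OF assms] in auto)
qed

lemma has_derivative_reflect:
  fixes f :: "'a::euclidean_space \<Rightarrow> real"
  assumes "f differentiable_on UNIV"
  shows "((\<lambda>y. c * f (x - y)) has_derivative (\<lambda>h. - c * (grad f (x - y) \<bullet> h))) (at y)"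
proof -
  have d: "f differentiable at (x - y)" using assms by (simp add: differentiable_on_def)
  have "((\<lambda>y. x - y) has_derivative (\<lambda>h. - h)) (at y)" by (auto intro!: derivative_eq_intros)
  from has_derivative_mult_right[OF has_derivative_compose[OF this has_derivative_grad[OF d]], of c]
  show ?thesis by simp
qed

text \<open>Each derivative of a reflection contributes a sign, so the family closed under
  \<open>pd\<close> has to contain scalar multiples.\<close>

lemma smooth_reflect:
  fixes f :: "'a::euclidean_space \<Rightarrow> real"
  assumes "smooth f"
  shows "smooth (\<lambda>y. f (x - y))" and "b \<in> Basis \<Longrightarrow> pd b (\<lambda>y. f (x - y)) = (\<lambda>y. - pd b f (x - y))"
proof -
  have *: "pd b (\<lambda>y. c * f (x - y)) = (\<lambda>y. (- c) * pd b f (x - y))" if "smooth f" "b \<in> Basis"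
    for f :: "'a \<Rightarrow> real" and c b
    using pd_eqI[OF has_derivative_reflect[OF smooth_differentiable[OF that(1)]]] that(2)
    by (auto simp: fun_eq_iff grad_inner_Basis)
  show "smooth (\<lambda>y. f (x - y))"
  proof (rule smooth_coinduct[of _ "{\<lambda>y. c * f (x - y) |c f. smooth f}"])
    show "(\<lambda>y. f (x - y)) \<in> {\<lambda>y. c * f (x - y) |c f. smooth f}"
      using assms by (auto intro!: exI[of _ 1])
    fix g assume "g \<in> {\<lambda>y. c * f (x - y) |c f::'a \<Rightarrow> real. smooth f}"
    then obtain c f where f: "g = (\<lambda>y. c * f (x - y))" "smooth f" by blast
    show "g differentiable_on UNIV"
      unfolding f differentiable_on_def using has_derivative_reflect[OF smooth_differentiable[OF f(2)]]
      by (blast intro: differentiableI)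
    fix b :: 'a assume "b \<in> Basis"
    then show "pd b g \<in> {\<lambda>y. c * f (x - y) |c f. smooth f}"
      unfolding f(1) using *[OF f(2)] smooth_pd[OF f(2)] by blast
  qed
  show "b \<in> Basis \<Longrightarrow> pd b (\<lambda>y. f (x - y)) = (\<lambda>y. - pd b f (x - y))"
    using *[OF assms, of b 1] by simp
qed

lemma test_function_reflect:
  fixes f :: "'a::euclidean_space \<Rightarrow> real"
  assumes "test_function f"
  shows "test_function (\<lambda>y. f (x - y))"
proof -
  obtain r where r: "r > 0" "\<And>x. norm x > r \<Longrightarrow> f x = 0" using test_functionD[OF assms(1)] by blast
  show ?thesis
  proof (rule test_functionI[of _ "norm x + r"])
    show "f (x - y) = 0" if "norm y > norm x + r" for y
      using r(2)[of "x - y"] norm_triangle_ineq2[of y x] that by (simp add: norm_minus_commute)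
  qed (use assms in \<open>auto simp: test_function_def smooth_reflect\<close>)
qed

text \<open>One coordinate is changed at a time: the mean value inequality along that direction and
  continuity of the partial derivative leave an error o(|h|), and the errors are added by induction
  on the set of directions already moved.\<close>

lemma has_derivative_of_partials:
  fixes f :: "'a::euclidean_space \<Rightarrow> real"
  assumes der: "\<And>e x s. e \<in> Basis \<Longrightarrow> ((\<lambda>s. f (x + s *\<^sub>R e)) has_real_derivative D e (x + s *\<^sub>R e)) (at s)"
    and cont: "\<And>e. e \<in> Basis \<Longrightarrow> continuous_on UNIV (D e)"
  shows "(f has_derivative (\<lambda>h. \<Sum>e\<in>Basis. (h \<bullet> e) * D e x)) (at x)"
proof -
  define P where "P S h = (\<Sum>e\<in>S. (h \<bullet> e) *\<^sub>R e)" for S and h :: 'a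
  have P: "norm (P S h) \<le> real DIM('a) * norm h" if "S \<subseteq> Basis" for S h
  proof -
    have "norm (P S h) \<le> (\<Sum>e\<in>S. norm ((h \<bullet> e) *\<^sub>R e))" unfolding P_def by (rule norm_sum)
    also have "\<dots> \<le> (\<Sum>e\<in>S. norm h)"
      using that by (intro sum_mono) (auto simp: Basis_le_norm subset_eq)
    also have "\<dots> \<le> real DIM('a) * norm h"
      using that by (simp add: card_mono mult_right_mono)
    finally show ?thesis .
  qed
  have claim: "\<forall>\<epsilon>>0. \<exists>\<delta>>0. \<forall>h. norm h < \<delta> \<longrightarrow>
      \<bar>f (x + P S h) - f x - (\<Sum>e\<in>S. (h \<bullet> e) * D e x)\<bar> \<le> \<epsilon> * norm h" if "finite S" "S \<subseteq> Basis" for S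
    using that
  proof (induction S)
    case empty
    then show ?case by (auto simp: P_def intro!: exI[of _ 1])
  next
    case (insert e S)
    show ?case
    proof (intro allI impI)
      fix \<epsilon> :: real assume "\<epsilon> > 0"
      then have "\<epsilon> / 2 > 0" by simp
      then obtain \<delta>1 where \<delta>1: "\<delta>1 > 0" "\<And>h. norm h < \<delta>1 \<Longrightarrow>
          \<bar>f (x + P S h) - f x - (\<Sum>e\<in>S. (h \<bullet> e) * D e x)\<bar> \<le> \<epsilon> / 2 * norm h"
        using insert.IH insert.prems by blast
      have "isCont (D e) x" using cont[of e] insert.prems by (simp add: continuous_on_eq_continuous_at)
      then obtain \<delta>2 where \<delta>2: "\<delta>2 > 0" "\<And>y. norm (y - x) < \<delta>2 \<Longrightarrow> \<bar>D e y - D e x\<bar> < \<epsilon> / 2"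
        using \<open>\<epsilon> > 0\<close> unfolding continuous_at_eps_delta by (metis dist_norm half_gt_zero real_norm_def)
      \<comment> \<open>Partial sums of the coordinates of h have norm at most d |h|, and the
        current coordinate adds at most |h|; all intermediate points thus lie within N |h| of
        x.\<close>
      define N where "N = real DIM('a) + 1"
      have N: "N > 0" by (simp add: N_def add_nonneg_pos)
      show "\<exists>\<delta>>0. \<forall>h. norm h < \<delta> \<longrightarrow>
        \<bar>f (x + P (insert e S) h) - f x - (\<Sum>e\<in>insert e S. (h \<bullet> e) * D e x)\<bar> \<le> \<epsilon> * norm h"
      proof (intro exI[of _ "min \<delta>1 (\<delta>2 / N)"] conjI allI impI)
        show "0 < min \<delta>1 (\<delta>2 / N)" using \<delta>1 \<delta>2 N by simp
        fix h :: 'a assume h: "norm h < min \<delta>1 (\<delta>2 / N)"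
        let ?y = "x + P S h" and ?c = "h \<bullet> e"
        have "norm ((f (?y + ?c *\<^sub>R e) - ?c * D e x) - (f (?y + 0 *\<^sub>R e) - 0 * D e x)) \<le> \<epsilon> / 2 * norm (?c - 0)"
        proof (rule field_differentiable_bound[of "cball 0 \<bar>?c\<bar>"])
          fix s :: real assume s: "s \<in> cball 0 \<bar>?c\<bar>"
          show "((\<lambda>s. f (?y + s *\<^sub>R e) - s * D e x) has_field_derivative (D e (?y + s *\<^sub>R e) - D e x)) (at s within cball 0 \<bar>?c\<bar>)"
            using insert.prems by (auto intro!: derivative_eq_intros DERIV_subset[OF der])
          have "norm ((?y + s *\<^sub>R e) - x) \<le> norm (P S h) + norm (s *\<^sub>R e)"
            by (metis add.assoc add_diff_cancel_left' norm_triangle_ineq)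
          also have "\<dots> \<le> real DIM('a) * norm h + norm h"
          proof (intro add_mono P)
            show "norm (s *\<^sub>R e) \<le> norm h"
              using insert.prems s Basis_le_norm[of e h] by auto
          qed (use insert.prems in auto)
          also have "\<dots> = N * norm h" by (simp add: N_def algebra_simps)
          also have "\<dots> < \<delta>2" using h N by (simp add: field_simps)
          finally show "norm (D e (?y + s *\<^sub>R e) - D e x) \<le> \<epsilon> / 2" using \<delta>2(2) by fastforce
        qed auto
        also have "\<dots> \<le> \<epsilon> / 2 * norm h" 
          using \<open>\<epsilon> > 0\<close> insert.prems Basis_le_norm[of e h] by (intro mult_left_mono) auto
        finally have 1: "\<bar>f (?y + ?c *\<^sub>R e) - f ?y - ?c * D e x\<bar> \<le> \<epsilon> / 2 * norm h" by (simp add: algebra_simps)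
        have "P (insert e S) h = P S h + ?c *\<^sub>R e" using insert.hyps by (simp add: P_def)
        moreover have "\<bar>u - w - (c + z)\<bar> \<le> \<epsilon> * norm h"
          if "\<bar>u - v - c\<bar> \<le> \<epsilon> / 2 * norm h" "\<bar>v - w - z\<bar> \<le> \<epsilon> / 2 * norm h" for u v w c z :: real
          using that by linarith
        moreover have "(\<Sum>e\<in>insert e S. (h \<bullet> e) * D e x) = ?c * D e x + (\<Sum>e\<in>S. (h \<bullet> e) * D e x)"
          using insert.hyps by simp
        ultimately show "\<bar>f (x + P (insert e S) h) - f x - (\<Sum>e\<in>insert e S. (h \<bullet> e) * D e x)\<bar> \<le> \<epsilon> * norm h"
          using 1 \<delta>1(2)[of h] h by (simp add: add.assoc)
      qed
    qed
  qed
  show ?thesis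
    unfolding has_derivative_at_alt
  proof (intro conjI allI impI)
    show "bounded_linear (\<lambda>h. \<Sum>e\<in>Basis. (h \<bullet> e) * D e x)"
      by (intro bounded_linear_sum bounded_linear_mult_const bounded_linear_inner_left)
    fix \<epsilon> :: real assume "\<epsilon> > 0"
    then obtain \<delta> where \<delta>: "\<delta> > 0" "\<And>h. norm h < \<delta> \<Longrightarrow>
      \<bar>f (x + P Basis h) - f x - (\<Sum>e\<in>Basis. (h \<bullet> e) * D e x)\<bar> \<le> \<epsilon> * norm h"
      using claim[OF finite_Basis] by blast
    show "\<exists>d>0. \<forall>y. norm (y - x) < d \<longrightarrow> norm (f y - f x - (\<Sum>e\<in>Basis. ((y - x) \<bullet> e) * D e x)) \<le> \<epsilon> * norm (y - x)"
      using \<delta>(1) \<delta>(2)[of "_ - x"] by (intro exI[of _ \<delta>]) (auto simp: P_def euclidean_representation)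
  qed
qed

text \<open>The classical flat function exp(-1/s) and its products with powers of 1/s; the index k
  makes linear combinations of the family closed under differentiation.\<close>

definition flat_exp :: "nat \<Rightarrow> real \<Rightarrow> real" where
  "flat_exp k s = (if s \<le> 0 then 0 else (1 / s) ^ k * exp (- (1 / s)))"

lemma power_le_fact_mult_exp:
  fixes u :: real
  assumes "u \<ge> 0"
  shows "u ^ n \<le> fact n * exp u"
proof -
  have "(\<Sum>i\<in>{n}. u ^ i /\<^sub>R fact i) \<le> exp u"
    using sum_le_suminf[of "\<lambda>i. u ^ i /\<^sub>R fact i" "{n}"] assms exp_converges[of u]
    by (simp add: sums_iff)
  then show ?thesis by (simp add: field_simps)
qed

text \<open>With u = 1/s this is u^(k+2) \<le> (k+2)! exp u. The quadratic bound is what makes the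
  derivative at 0 vanish.\<close>

lemma flat_exp_le: "flat_exp k s \<le> fact (k + 2) * s\<^sup>2"
proof (cases "s \<le> 0")
  case False
  define u where "u = 1 / s"
  have u: "u > 0" "s = 1 / u" using False by (auto simp: u_def)
  define c :: real where "c = fact (k + 2)"
  have "u ^ (k + 2) * exp (- u) \<le> c"
    using power_le_fact_mult_exp[of u "k + 2"] u by (simp add: exp_minus divide_simps c_def)
  then have "u ^ k * exp (- u) \<le> c / u\<^sup>2"
    using u by (simp add: power_add pos_le_divide_eq power2_eq_square ac_simps)
  then show ?thesis using False u unfolding c_def[symmetric]
    by (simp add: flat_exp_def u_def[symmetric] power_divide)
qed (simp add: flat_exp_def)

lemma flat_exp_nonneg: "flat_exp k s \<ge> 0"
  by (simp add: flat_exp_def)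

lemma flat_exp_deriv: "(flat_exp k has_real_derivative (- real k * flat_exp (k + 1) s + flat_exp (k + 2) s)) (at s)"
proof -
  consider "s < 0" | "s = 0" | "s > 0" by linarith
  then show ?thesis
  proof cases
    case 1
    have "\<forall>\<^sub>F x in nhds s. flat_exp k x = 0"
      using eventually_nhds_in_open[of "{..<0}" s] 1 by (auto elim!: eventually_mono simp: flat_exp_def)
    then have "(flat_exp k has_real_derivative 0) (at s) \<longleftrightarrow> ((\<lambda>_. 0) has_real_derivative 0) (at s)"
      by (intro DERIV_cong_ev) auto
    then show ?thesis using 1 by (simp add: flat_exp_def)
  next
    case 2
    have "(flat_exp k has_derivative (\<lambda>h. 0)) (at 0)"
      unfolding has_derivative_at_alt
    proof (intro conjI allI impI)
      fix e :: real assume e: "e > 0"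
      define c :: real where "c = fact (k + 2)"
      have c: "c > 0" by (simp add: c_def)
      show "\<exists>d>0. \<forall>y. norm (y - 0) < d \<longrightarrow> norm (flat_exp k y - flat_exp k 0 - 0) \<le> e * norm (y - 0)"
      proof (intro exI[of _ "e / c"] conjI allI impI)
        fix y :: real assume y: "norm (y - 0) < e / c"
        have "flat_exp k y \<le> (c * \<bar>y\<bar>) * \<bar>y\<bar>" using flat_exp_le[of k y] by (simp add: c_def power2_eq_square)
        also have "\<dots> \<le> e * \<bar>y\<bar>" using y c by (intro mult_right_mono) (auto simp: field_simps)
        finally show "norm (flat_exp k y - flat_exp k 0 - 0) \<le> e * norm (y - 0)"
          using flat_exp_nonneg[of k y] by (simp add: flat_exp_def[of k 0])
      qed (use e c in auto)
    qed auto
    then show ?thesis using 2 by (simp add: has_field_derivative_def flat_exp_def flip: lambda_zero)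
  next
    case 3
    have "\<forall>\<^sub>F x in nhds s. flat_exp k x = (1 / x) ^ k * exp (- (1 / x))"
      using eventually_nhds_in_open[of "{0<..}" s] 3 by (auto elim!: eventually_mono simp: flat_exp_def)
    then have "(flat_exp k has_real_derivative (- real k * flat_exp (k + 1) s + flat_exp (k + 2) s)) (at s) \<longleftrightarrow>
      ((\<lambda>x. (1 / x) ^ k * exp (- (1 / x))) has_real_derivative (- real k * flat_exp (k + 1) s + flat_exp (k + 2) s)) (at s)"
      by (intro DERIV_cong_ev) auto
    moreover have "((\<lambda>x. (1 / x) ^ k * exp (- (1 / x))) has_real_derivative (- real k * flat_exp (k + 1) s + flat_exp (k + 2) s)) (at s)"
    proof -
      define u where "u = 1 / s"
      have d: "((\<lambda>x. 1 / x) has_real_derivative - u\<^sup>2) (at s)"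
        using 3 by (auto intro!: derivative_eq_intros simp: u_def power2_eq_square)
      have "((\<lambda>x. (1 / x) ^ k * exp (- (1 / x))) has_real_derivative
          (real k * (- u\<^sup>2 * u ^ (k - Suc 0))) * exp (- u) + exp (- u) * - (- u\<^sup>2) * u ^ k) (at s)"
        unfolding u_def by (intro DERIV_mult DERIV_power DERIV_fun_exp DERIV_minus d[unfolded u_def])
      then show ?thesis
        using 3 by (cases k) (auto simp: flat_exp_def u_def[symmetric] power2_eq_square algebra_simps)
    qed
    ultimately show ?thesis by simp
  qed
qed

text \<open>The algebra generated by constants, linear forms and the functions
  \<open>flat_exp k\<close> of c - |x|^2. It is invariant under partial derivatives, which is the
  input of \<open>smooth_coinduct\<close>.\<close>

inductive_set flat_span :: "real \<Rightarrow> ('a::euclidean_space \<Rightarrow> real) set" for c :: real where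
  const: "(\<lambda>x. a) \<in> flat_span c"
| inner: "(\<lambda>x. x \<bullet> b) \<in> flat_span c"
| flat: "(\<lambda>x. flat_exp k (c - x \<bullet> x)) \<in> flat_span c"
| add: "f \<in> flat_span c \<Longrightarrow> g \<in> flat_span c \<Longrightarrow> (\<lambda>x. f x + g x) \<in> flat_span c"
| mult: "f \<in> flat_span c \<Longrightarrow> g \<in> flat_span c \<Longrightarrow> (\<lambda>x. f x * g x) \<in> flat_span c"

lemma flat_span_derivative:
  assumes "f \<in> flat_span c"
  shows "\<exists>f'. (\<forall>x. (f has_derivative f' x) (at x)) \<and> (\<forall>b. (\<lambda>x. f' x b) \<in> flat_span c)"
  using assms
proof induction
  case (const a)
  show ?case
    by (rule exI[of _ "\<lambda>x h. 0"]) (auto intro: flat_span.const)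
next
  case (inner b)
  show ?case
    by (rule exI[of _ "\<lambda>x h. h \<bullet> b"]) (auto intro: flat_span.const intro!: derivative_eq_intros)
next
  case (flat k)
  let ?d = "\<lambda>x. - real k * flat_exp (k + 1) (c - x \<bullet> x) + flat_exp (k + 2) (c - x \<bullet> x)"
  have 1: "((\<lambda>x. flat_exp k (c - x \<bullet> x)) has_derivative (\<lambda>h. ?d x * (- 2 * (x \<bullet> h)))) (at x)" for x :: 'a
  proof -
    have "((\<lambda>x. c - x \<bullet> x) has_derivative (\<lambda>h. - 2 * (x \<bullet> h))) (at x)"
      by (auto intro!: derivative_eq_intros simp: inner_commute)
    from has_derivative_compose[OF this flat_exp_deriv[unfolded has_field_derivative_def]]
    show ?thesis by simp
  qed
  have 2: "(\<lambda>x. ?d x * (- 2 * (x \<bullet> b))) \<in> flat_span c" for b :: 'a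
    by (intro flat_span.intros)
  show ?case
    by (rule exI[of _ "\<lambda>x h. ?d x * (- 2 * (x \<bullet> h))"]) (use 1 2 in auto)
next
  case (add f g)
  then obtain f' g' where "\<forall>x. (f has_derivative f' x) (at x)" "\<forall>b. (\<lambda>x. f' x b) \<in> flat_span c"
    "\<forall>x. (g has_derivative g' x) (at x)" "\<forall>b. (\<lambda>x. g' x b) \<in> flat_span c" by blast
  then show ?case
    by (intro exI[of _ "\<lambda>x h. f' x h + g' x h"]) (auto intro: has_derivative_add flat_span.add)
next
  case (mult f g)
  then obtain f' g' where "\<forall>x. (f has_derivative f' x) (at x)" "\<forall>b. (\<lambda>x. f' x b) \<in> flat_span c"
    "\<forall>x. (g has_derivative g' x) (at x)" "\<forall>b. (\<lambda>x. g' x b) \<in> flat_span c" by blast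
  moreover from this mult.hyps have "(\<lambda>x. f x * g' x b + f' x b * g x) \<in> flat_span c" for b
    by (intro flat_span.add flat_span.mult) auto
  ultimately show ?case
    by (intro exI[of _ "\<lambda>x h. f x * g' x h + f' x h * g x"]) (auto intro: has_derivative_mult)
qed

lemma smooth_flat_span: "f \<in> flat_span c \<Longrightarrow> smooth f"
proof (erule smooth_coinduct)
  fix f :: "'a \<Rightarrow> real" and b assume "f \<in> flat_span c"
  then obtain f' where f': "\<And>x. (f has_derivative f' x) (at x)" "\<And>b. (\<lambda>x. f' x b) \<in> flat_span c"
    using flat_span_derivative by blast
  show "f differentiable_on UNIV" using f'(1) by (auto simp: differentiable_on_def differentiable_def)
  have "pd b f = (\<lambda>x. f' x b)" using f'(1) pd_eqI by blast
  then show "pd b f \<in> flat_span c" using f'(2) by simp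
qed

lemma emeasure_lborel_open_pos:
  fixes S :: "'a::euclidean_space set"
  assumes "open S" "x \<in> S"
  shows "emeasure lborel S > 0"
proof -
  obtain e where e: "e > 0" "ball x e \<subseteq> S" using assms open_contains_ball by blast
  have "0 < emeasure lborel (ball x e)"
    using e(1) by (simp add: emeasure_ball unit_ball_vol_pos)
  also have "\<dots> \<le> emeasure lborel S" using e assms by (intro emeasure_mono) auto
  finally show ?thesis .
qed

text \<open>The set where the bound fails is open, and a nonempty open set has positive measure.
  This turns essential bounds of continuous functions into pointwise ones.\<close>

lemma AE_lborel_le_continuous:
  fixes f :: "'a::euclidean_space \<Rightarrow> real"
  assumes "AE x in lborel. f x \<le> c" and "continuous_on UNIV f"
  shows "f x \<le> c"
proof (rule ccontr)
  assume "\<not> f x \<le> c"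
  have o: "open {x. f x > c}" using assms(2) by (intro open_Collect_less) auto
  then have "emeasure lborel {x. f x > c} > 0" by (rule emeasure_lborel_open_pos[of _ x]) (use \<open>\<not> f x \<le> c\<close> in auto)
  moreover have "emeasure lborel {x. f x > c} = 0"
    using AE_iff_measurable[OF _ refl, of "lborel" "\<lambda>x. f x \<le> c"] assms(1) o by (auto simp: not_le)
  ultimately show False by simp
qed

lemma bump_function_exists:
  fixes \<epsilon> :: real
  assumes "\<epsilon> > 0"
  shows "\<exists>\<eta>::'a::euclidean_space \<Rightarrow> real. test_function \<eta> \<and> (\<forall>x. \<eta> x \<ge> 0) \<and> (\<integral>x. \<eta> x \<partial>lborel) = 1 \<and>
    (\<forall>x. norm x > \<epsilon> \<longrightarrow> \<eta> x = 0)"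
proof -
  define \<eta> where "\<eta> x = flat_exp 0 (\<epsilon>\<^sup>2 - x \<bullet> x)" for x :: 'a
  have supp: "\<eta> x = 0" if "norm x > \<epsilon>" for x
  proof -
    have "\<epsilon>\<^sup>2 \<le> (norm x)\<^sup>2" using that assms by (intro power_mono) auto
    then show ?thesis by (simp add: \<eta>_def flat_exp_def power2_norm_eq_inner)
  qed
  have "\<eta> \<in> flat_span (\<epsilon>\<^sup>2)" unfolding \<eta>_def by (rule flat_span.flat)
  then have test: "test_function \<eta>" using test_functionI[of \<eta> \<epsilon>] smooth_flat_span supp by blast
  have nn: "\<eta> x \<ge> 0" for x by (simp add: \<eta>_def flat_exp_nonneg)
  \<comment> \<open>A vanishing integral would force the continuous nonnegative function to vanish
    everywhere, but at 0 it equals exp(-1/\<epsilon>^2).\<close>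
  have "(\<integral>x. \<eta> x \<partial>lborel) \<noteq> 0"
  proof
    assume "(\<integral>x. \<eta> x \<partial>lborel) = 0"
    then have "AE x in lborel. \<eta> x = 0"
      using integral_nonneg_eq_0_iff_AE[OF test_function_integrable[OF test]] nn by auto
    then have "AE x in lborel. \<eta> x \<le> 0" by auto
    from AE_lborel_le_continuous[OF this test_function_continuous[OF test], of 0] show False
      using assms by (simp add: \<eta>_def flat_exp_def not_le split: if_splits)
  qed
  moreover have "(\<integral>x. \<eta> x \<partial>lborel) \<ge> 0" using nn by simp
  ultimately have pos: "(\<integral>x. \<eta> x \<partial>lborel) > 0" by simp
  define c where "c = 1 / (\<integral>x. \<eta> x \<partial>lborel)"
  have "(\<lambda>x. c * \<eta> x) \<in> flat_span (\<epsilon>\<^sup>2)" unfolding \<eta>_def by (intro flat_span.intros)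
  then have "test_function (\<lambda>x. c * \<eta> x)" using test_functionI[of "\<lambda>x. c * \<eta> x" \<epsilon>] smooth_flat_span supp by fastforce
  then show ?thesis using nn supp pos by (intro exI[of _ "\<lambda>x. c * \<eta> x"]) (auto simp: c_def)
qed

text \<open>One fixed approximate identity. The radius 1 / (n + 1) is meaningful for n = 0 and never
  exceeds 1.\<close>

definition bump :: "nat \<Rightarrow> 'a::euclidean_space \<Rightarrow> real" where
  "bump n = (SOME \<eta>. test_function \<eta> \<and> (\<forall>x. \<eta> x \<ge> 0) \<and> (\<integral>x. \<eta> x \<partial>lborel) = 1 \<and>
    (\<forall>x. norm x > 1 / Suc n \<longrightarrow> \<eta> x = 0))"

lemma
  shows test_function_bump: "test_function (bump n :: 'a::euclidean_space \<Rightarrow> real)"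
    and bump_nonneg: "bump n (x::'a) \<ge> 0" 
    and integral_bump: "(\<integral>x. bump n (x::'a) \<partial>lborel) = 1"
    and bump_support: "norm x > 1 / Suc n \<Longrightarrow> bump n (x::'a) = 0"
proof -
  have "1 / real (Suc n) > 0" by simp
  from someI_ex[OF bump_function_exists[where 'a='a, OF this]]
  have "test_function (bump n :: 'a \<Rightarrow> real) \<and> (\<forall>x::'a. bump n x \<ge> 0) \<and> (\<integral>x. bump n (x::'a) \<partial>lborel) = 1 \<and>
    (\<forall>x::'a. norm x > 1 / Suc n \<longrightarrow> bump n x = 0)"
    unfolding bump_def .
  then show "test_function (bump n :: 'a::euclidean_space \<Rightarrow> real)" "bump n (x::'a) \<ge> 0"
    "(\<integral>x. bump n (x::'a) \<partial>lborel) = 1" "norm x > 1 / Suc n \<Longrightarrow> bump n (x::'a) = 0" by auto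
qed

section \<open>Mollification and Sobolev regularity\<close>

lemma conv_integrable:
  fixes u \<eta> :: "'a::euclidean_space \<Rightarrow> real"
  assumes [measurable]: "u \<in> borel_measurable borel" and u: "\<And>x. \<bar>u x\<bar> \<le> M" and \<eta>: "integrable lborel \<eta>"
  shows "integrable lborel (\<lambda>y. u y * \<eta> (x - y))"
proof (rule Bochner_Integration.integrable_bound[OF integrable_mult_right[OF lborel_integrable_reflect[OF \<eta>], of M x]])
  have [measurable]: "\<eta> \<in> borel_measurable borel" using \<eta> by simp
  show "(\<lambda>y. u y * \<eta> (x - y)) \<in> borel_measurable lborel" by measurable
  show "AE y in lborel. norm (u y * \<eta> (x - y)) \<le> norm (M * \<eta> (x - y))"
    by (intro AE_I2) (auto simp: abs_mult intro!: mult_right_mono order_trans[OF u])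
qed

text \<open>The convolution at x averages u over the points that the density \<eta> sees from x.
  With c = u x this yields approximation, with c = 0 a sup bound.\<close>

lemma conv_close:
  fixes u \<eta> :: "'a::euclidean_space \<Rightarrow> real"
  assumes um: "u \<in> borel_measurable borel" and u: "\<And>x. \<bar>u x\<bar> \<le> M" and \<eta>: "integrable lborel \<eta>"
    and \<eta>0: "\<And>x. \<eta> x \<ge> 0" and \<eta>1: "(\<integral>x. \<eta> x \<partial>lborel) = 1"
    and cl: "\<And>y. \<eta> (x - y) \<noteq> 0 \<Longrightarrow> \<bar>u y - c\<bar> \<le> \<epsilon>"
  shows "\<bar>conv (*) u \<eta> x - c\<bar> \<le> \<epsilon>"
proof -
  have i: "integrable lborel (\<lambda>y. \<eta> (x - y))" using \<eta> by (rule lborel_integrable_reflect)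
  have i1: "(\<integral>y. \<eta> (x - y) \<partial>lborel) = 1" using lborel_integral_reflect[of \<eta> x] \<eta> \<eta>1 by auto
  have ui: "integrable lborel (\<lambda>y. u y * \<eta> (x - y))" by (rule conv_integrable[OF um u \<eta>])
  have "conv (*) u \<eta> x - c = (\<integral>y. u y * \<eta> (x - y) - c * \<eta> (x - y) \<partial>lborel)"
    unfolding conv_def using ui i i1 by simp
  also have "\<bar>\<dots>\<bar> \<le> (\<integral>y. \<epsilon> * \<eta> (x - y) \<partial>lborel)"
  proof (rule integral_abs_bound_integral)
    show "integrable lborel (\<lambda>y. u y * \<eta> (x - y) - c * \<eta> (x - y))" "integrable lborel (\<lambda>y. \<epsilon> * \<eta> (x - y))"
      using ui i by auto
    fix y
    have "\<bar>u y - c\<bar> * \<eta> (x - y) \<le> \<epsilon> * \<eta> (x - y)"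
      using cl[of y] \<eta>0[of "x - y"] by (cases "\<eta> (x - y) = 0") (auto intro: mult_right_mono)
    then show "\<bar>u y * \<eta> (x - y) - c * \<eta> (x - y)\<bar> \<le> \<epsilon> * \<eta> (x - y)"
      using \<eta>0[of "x - y"] by (simp add: left_diff_distrib[symmetric] abs_mult)
  qed
  also have "\<dots> = \<epsilon>" using i1 by simp
  finally show ?thesis .
qed

text \<open>The derivative is put on \<eta>, so u may be merely bounded and measurable.\<close>

lemma conv_pd:
  fixes u \<eta> :: "'a::euclidean_space \<Rightarrow> real"
  assumes um[measurable]: "u \<in> borel_measurable borel" and u: "\<And>x. \<bar>u x\<bar> \<le> M"
    and \<eta>: "test_function \<eta>" and b: "b \<in> Basis"
  shows "((\<lambda>s. conv (*) u \<eta> (x + s *\<^sub>R b)) has_real_derivative conv (*) u (pd b \<eta>) (x + s *\<^sub>R b)) (at s)"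
proof -
  obtain r where r: "r > 0" "\<forall>x. norm x > r \<longrightarrow> pd b \<eta> x = 0"
    using test_functionD[OF test_function_pd[OF \<eta> b]] by blast
  obtain B where B: "B > 0" "\<forall>x. \<bar>pd b \<eta> x\<bar> \<le> B"
    using test_function_bounded[OF test_function_pd[OF \<eta> b]] by blast
  have M: "0 \<le> M" using u[of 0] by linarith
  have [measurable]: "pd b \<eta> \<in> borel_measurable borel" "\<eta> \<in> borel_measurable borel"
    using test_function_measurable \<eta> b test_function_pd by blast+
  \<comment> \<open>For t within distance 1 of s the derivative of the integrand is supported in
    this ball.\<close>
  let ?R = "norm x + \<bar>s\<bar> + 1 + r"
  have "((\<lambda>s. \<integral>y. u y * \<eta> (x + s *\<^sub>R b - y) \<partial>lborel) has_real_derivative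
      (\<integral>y. u y * pd b \<eta> (x + s *\<^sub>R b - y) \<partial>lborel)) (at s within {s-1<..<s+1})"
  proof (rule has_real_derivative_integral[where g="\<lambda>y. M * B * indicator (cball 0 ?R) y"])
    show "integrable lborel (\<lambda>y::'a. M * B * indicator (cball 0 ?R) y)"
      by (intro integrable_mult_right integrable_real_indicator) (use emeasure_bounded_finite[of "cball 0 ?R"] in auto)
    show "integrable lborel (\<lambda>y. u y * \<eta> (x + t *\<^sub>R b - y))" for t
      by (rule conv_integrable[OF um u test_function_integrable[OF \<eta>]])
    fix t y assume t: "t \<in> {s-1<..<s+1}"
    have "((\<lambda>t. \<eta> ((x - y) + t *\<^sub>R b)) has_real_derivative pd b \<eta> ((x - y) + t *\<^sub>R b)) (at t)"
      by (rule has_real_derivative_pd_line) (use \<eta> in \<open>simp add: test_function_def smooth_differentiable\<close>)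
    then show "((\<lambda>t. u y * \<eta> (x + t *\<^sub>R b - y)) has_real_derivative u y * pd b \<eta> (x + t *\<^sub>R b - y)) (at t within {s-1<..<s+1})"
      by (intro DERIV_cmult) (auto intro: has_field_derivative_at_within simp: algebra_simps)
    show "\<bar>u y * pd b \<eta> (x + t *\<^sub>R b - y)\<bar> \<le> M * B * indicator (cball 0 ?R) y"
    proof (cases "norm y \<le> ?R")
      case True
      then show ?thesis using u B M by (simp add: abs_mult mult_mono)
    next
      case False
      have "norm y \<le> norm (y - x - t *\<^sub>R b) + norm (x + t *\<^sub>R b)"
        using norm_triangle_ineq[of "y - x - t *\<^sub>R b" "x + t *\<^sub>R b"] by simp
      moreover have "norm (x + t *\<^sub>R b) \<le> norm x + \<bar>t\<bar>"
        using norm_triangle_ineq[of x "t *\<^sub>R b"] b by simp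
      moreover have "norm (y - x - t *\<^sub>R b) = norm (x + t *\<^sub>R b - y)"
        by (metis diff_diff_eq norm_minus_commute)
      ultimately have "norm (x + t *\<^sub>R b - y) > r" using t False by auto
      then show ?thesis using r False by simp
    qed
  qed auto
  then show ?thesis unfolding conv_def by (simp add: at_within_open[of s "{s-1<..<s+1}"])
qed

lemma conv_continuous:
  fixes u \<eta> :: "'a::euclidean_space \<Rightarrow> real"
  assumes um[measurable]: "u \<in> borel_measurable borel" and u: "\<And>x. \<bar>u x\<bar> \<le> M" and \<eta>: "test_function \<eta>"
  shows "continuous_on UNIV (conv (*) u \<eta>)"
proof (rule continuous_on_sequentiallyI)
  fix X :: "nat \<Rightarrow> 'a" and a assume X: "X \<longlonglongrightarrow> a"
  obtain r where r: "r > 0" "\<forall>x. norm x > r \<longrightarrow> \<eta> x = 0" using test_functionD[OF \<eta>] by blast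
  obtain B where B: "B > 0" "\<forall>x. \<bar>\<eta> x\<bar> \<le> B" using test_function_bounded[OF \<eta>] by blast
  have M: "0 \<le> M" using u[of 0] by linarith
  obtain C where C: "\<And>n. norm (X n) \<le> C"
    using convergent_imp_bounded[OF X] by (auto simp: bounded_iff)
  have [measurable]: "\<eta> \<in> borel_measurable borel"
    using test_function_measurable \<eta> by blast
  show "(\<lambda>n. conv (*) u \<eta> (X n)) \<longlonglongrightarrow> conv (*) u \<eta> a"
    unfolding conv_def
  proof (rule integral_dominated_convergence[where w="\<lambda>y. M * B * indicator (cball 0 (C + r)) y"])
    show "integrable lborel (\<lambda>y::'a. M * B * indicator (cball 0 (C + r)) y)"
      by (intro integrable_mult_right integrable_real_indicator) (use emeasure_bounded_finite[of "cball 0 (C+r)"] in auto)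
    show "AE y in lborel. (\<lambda>n. u y * \<eta> (X n - y)) \<longlonglongrightarrow> u y * \<eta> (a - y)"
    proof (intro AE_I2 tendsto_mult tendsto_const)
      fix y
      have "isCont \<eta> (a - y)" using test_function_continuous[OF \<eta>] by (simp add: continuous_on_eq_continuous_at)
      then show "(\<lambda>n. \<eta> (X n - y)) \<longlonglongrightarrow> \<eta> (a - y)"
        by (rule isCont_tendsto_compose) (intro tendsto_intros X)
    qed
    show "AE y in lborel. norm (u y * \<eta> (X n - y)) \<le> M * B * indicator (cball 0 (C + r)) y" for n
    proof (intro AE_I2)
      fix y
      show "norm (u y * \<eta> (X n - y)) \<le> M * B * indicator (cball 0 (C + r)) y"
      proof (cases "norm y \<le> C + r")
        case True
        then show ?thesis using u B M by (simp add: abs_mult mult_mono)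
      next
        case False
        have "norm y \<le> norm (X n) + norm (X n - y)"
          by (metis norm_minus_commute norm_triangle_sub)
        then have "norm (X n - y) > r" using C[of n] False by auto
        then show ?thesis using r False by simp
      qed
    qed
  qed auto
qed

lemma conv_has_derivative:
  fixes u \<eta> :: "'a::euclidean_space \<Rightarrow> real"
  assumes um: "u \<in> borel_measurable borel" and u: "\<And>x. \<bar>u x\<bar> \<le> M" and \<eta>: "test_function \<eta>"
  shows "(conv (*) u \<eta> has_derivative (\<lambda>h. \<Sum>e\<in>Basis. (h \<bullet> e) * conv (*) u (pd e \<eta>) x)) (at x)"
  by (rule has_derivative_of_partials[OF conv_pd[OF um u \<eta>] conv_continuous[OF um u test_function_pd[OF \<eta>]]])

lemma sum_Basis_inner: "b \<in> Basis \<Longrightarrow> (\<Sum>e\<in>Basis. (b \<bullet> e) * f e) = (f b :: real)"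
  by (simp add: inner_Basis if_distrib[of "\<lambda>x. x * _"] sum.delta cong: if_cong)

text \<open>Partial derivatives of a convolution with a test function are again convolutions of the
  same u with a test function.\<close>

lemma conv_smooth:
  fixes u \<eta> :: "'a::euclidean_space \<Rightarrow> real"
  assumes um: "u \<in> borel_measurable borel" and u: "\<And>x. \<bar>u x\<bar> \<le> M" and \<eta>: "test_function \<eta>"
  shows "smooth (conv (*) u \<eta>)"
proof (rule smooth_coinduct[of _ "{conv (*) u \<eta> |\<eta>. test_function \<eta>}"])
  fix f assume "f \<in> {conv (*) u \<eta> |\<eta>. test_function \<eta>}"
  then obtain \<eta> where \<eta>: "f = conv (*) u \<eta>" "test_function \<eta>" by blast
  show "f differentiable_on UNIV"
    unfolding \<eta>(1) differentiable_on_def using conv_has_derivative[OF um u \<eta>(2)] by (blast intro: differentiableI)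
  fix b :: 'a assume b: "b \<in> Basis"
  have "pd b f = conv (*) u (pd b \<eta>)"
    unfolding \<eta>(1) using pd_eqI[OF conv_has_derivative[OF um u \<eta>(2)], of b] b by (auto simp: sum_Basis_inner)
  then show "pd b f \<in> {conv (*) u \<eta> |\<eta>. test_function \<eta>}" using test_function_pd[OF \<eta>(2) b] by blast
qed (use \<eta> in blast)

lemma conv_test_function:
  fixes u \<eta> :: "'a::euclidean_space \<Rightarrow> real"
  assumes um: "u \<in> borel_measurable borel" and u: "\<And>x. \<bar>u x\<bar> \<le> M" and \<eta>: "test_function \<eta>"
    and supp: "\<And>x. norm x > R \<Longrightarrow> u x = 0" and supp2: "\<And>x. norm x > r \<Longrightarrow> \<eta> x = 0"
  shows "test_function (conv (*) u \<eta>)" and "norm x > R + r \<Longrightarrow> conv (*) u \<eta> x = 0"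
proof -
  have 0: "conv (*) u \<eta> x = 0" if "norm x > R + r" for x
  proof -
    have "u y * \<eta> (x - y) = 0" for y
      using supp[of y] supp2[of "x - y"] norm_triangle_sub[of x y] that by (cases "norm y > R") auto
    then have "(\<lambda>y. u y * \<eta> (x - y)) = (\<lambda>y. 0)" by blast
    then show ?thesis unfolding conv_def by simp
  qed
  then show "norm x > R + r \<Longrightarrow> conv (*) u \<eta> x = 0" by blast
  show "test_function (conv (*) u \<eta>)"
    by (rule test_functionI[OF conv_smooth[OF um u \<eta>] 0])
qed

text \<open>By Fubini both sides integrate u(z) against the same double convolution of \<eta> and
  \<theta>.\<close>

lemma conv_conv_commute:
  fixes u \<eta> \<theta> :: "'a::euclidean_space \<Rightarrow> real"
  assumes um[measurable]: "u \<in> borel_measurable borel" and u: "\<And>x. \<bar>u x\<bar> \<le> M"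
    and \<eta>: "test_function \<eta>" and \<theta>: "test_function \<theta>"
  shows "conv (*) (conv (*) u \<eta>) \<theta> x = conv (*) (conv (*) u \<theta>) \<eta> x"
proof -
  have M: "0 \<le> M" using u[of 0] by linarith
  have fub: "conv (*) (conv (*) u \<eta>) \<theta> x = (\<integral>z. \<integral>y. u z * \<eta> (y - z) * \<theta> (x - y) \<partial>lborel \<partial>lborel)"
    if \<eta>: "test_function \<eta>" and \<theta>: "test_function \<theta>" for \<eta> \<theta> :: "'a \<Rightarrow> real"
  proof -
    obtain r where r: "r > 0" "\<forall>x. norm x > r \<longrightarrow> \<eta> x = 0" using test_functionD[OF \<eta>] by blast
    obtain r' where r': "r' > 0" "\<forall>x. norm x > r' \<longrightarrow> \<theta> x = 0" using test_functionD[OF \<theta>] by blast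
    obtain B where B: "B > 0" "\<forall>x. \<bar>\<eta> x\<bar> \<le> B" using test_function_bounded[OF \<eta>] by blast
    have [measurable]: "\<eta> \<in> borel_measurable borel" "\<theta> \<in> borel_measurable borel"
      using test_function_measurable \<eta> \<theta> by blast+
    let ?R = "norm x + r' + r"
    have "integrable (lborel \<Otimes>\<^sub>M lborel) (\<lambda>(z, y). u z * \<eta> (y - z) * \<theta> (x - y))"
    proof (rule integrable_pair_lborel_bounded[where F="\<lambda>z. M * B * indicator (cball 0 ?R) z" and G="\<lambda>y. \<bar>\<theta> (x - y)\<bar>"])
      show "integrable lborel (\<lambda>y::'a. M * B * indicator (cball 0 ?R) y)"
        by (intro integrable_mult_right integrable_real_indicator) (use emeasure_bounded_finite[of "cball 0 ?R"] in auto)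
      show "integrable lborel (\<lambda>y. \<bar>\<theta> (x - y)\<bar>)"
        using lborel_integrable_reflect[OF test_function_integrable[OF \<theta>]] by simp
      fix z y
      show "\<bar>case (z, y) of (z, y) \<Rightarrow> u z * \<eta> (y - z) * \<theta> (x - y)\<bar> \<le> M * B * indicator (cball 0 ?R) z * \<bar>\<theta> (x - y)\<bar>"
      proof (cases "norm z \<le> ?R")
        case True
        then show ?thesis using u B M by (simp add: abs_mult mult_mono)
      next
        case False
        have "norm z \<le> norm y + norm (y - z)" "norm y \<le> norm x + norm (x - y)"
          by (metis norm_minus_commute norm_triangle_sub)+
        then have "norm (y - z) > r \<or> norm (x - y) > r'" using False by linarith
        then show ?thesis using r r' False by auto
      qed
    qed measurable
    from lborel_pair.Fubini_integral[OF this]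
    show ?thesis unfolding conv_def by simp
  qed
  have [measurable]: "\<eta> \<in> borel_measurable borel" "\<theta> \<in> borel_measurable borel"
    using test_function_measurable \<eta> \<theta> by blast+
  \<comment> \<open>The substitution y -> x + z - y exchanges the two test functions.\<close>
  have "(\<integral>y. u z * \<eta> (y - z) * \<theta> (x - y) \<partial>lborel) = (\<integral>y. u z * \<theta> (y - z) * \<eta> (x - y) \<partial>lborel)" for z
    using lborel_integral_reflect[of "\<lambda>y. u z * \<eta> (y - z) * \<theta> (x - y)" "x + z", symmetric]
    by (simp add: ac_simps)
  then show ?thesis unfolding fub[OF \<eta> \<theta>] fub[OF \<theta> \<eta>] by simp
qed

section \<open>From weak derivatives to Lipschitz and classical derivatives\<close>

lemma lipschitz_imp_continuous:
  fixes f :: "'a::real_normed_vector \<Rightarrow> real"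
  assumes "\<And>x y. \<bar>f x - f y\<bar> \<le> L * norm (x - y)"
  shows "continuous_on UNIV f"
proof -
  have "0 \<le> \<bar>L\<bar>" by simp
  moreover have "\<bar>f x - f y\<bar> \<le> \<bar>L\<bar> * norm (x - y)" for x y
    by (rule order_trans[OF assms]) (simp add: mult_right_mono)
  ultimately have "\<bar>L\<bar>-lipschitz_on UNIV f" by (auto simp: lipschitz_on_def dist_norm)
  then show ?thesis by (rule lipschitz_on_continuous_on)
qed

lemma lipschitz_of_partials:
  fixes f :: "'a::euclidean_space \<Rightarrow> real"
  assumes "\<And>x. (f has_derivative (\<lambda>h. \<Sum>e\<in>Basis. (h \<bullet> e) * D e x)) (at x)"
    and "\<And>e x. e \<in> Basis \<Longrightarrow> \<bar>D e x\<bar> \<le> M"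
  shows "\<bar>f x - f y\<bar> \<le> real DIM('a) * M * norm (x - y)"
proof -
  have "norm (f x - f y) \<le> real DIM('a) * M * norm (x - y)"
  proof (rule differentiable_bound[OF convex_UNIV])
    fix x
    show "(f has_derivative (\<lambda>h. \<Sum>e\<in>Basis. (h \<bullet> e) * D e x)) (at x)" by (rule assms)
    show "onorm (\<lambda>h. \<Sum>e\<in>Basis. (h \<bullet> e) * D e x) \<le> real DIM('a) * M"
    proof (rule onorm_le)
      fix h :: 'a
      have "\<bar>\<Sum>e\<in>Basis. (h \<bullet> e) * D e x\<bar> \<le> (\<Sum>e\<in>Basis. \<bar>(h \<bullet> e) * D e x\<bar>)" by (rule sum_abs)
      also have "\<dots> \<le> (\<Sum>e\<in>(Basis::'a set). norm h * M)"
        unfolding abs_mult using assms(2) by (intro sum_mono mult_mono Basis_le_norm) auto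
      finally show "norm (\<Sum>e\<in>Basis. (h \<bullet> e) * D e x) \<le> real DIM('a) * M * norm h" by (simp add: ac_simps)
    qed
  qed auto
  then show ?thesis by simp
qed

text \<open>Test with y -> \<eta>(x - y): the sign from differentiating the reflection cancels the
  sign in the definition of the weak derivative.\<close>

lemma conv_weak_deriv:
  fixes u v \<eta> :: "'a::euclidean_space \<Rightarrow> real"
  assumes "weak_deriv [e] u v" "test_function \<eta>" "e \<in> Basis"
  shows "conv (*) u (pd e \<eta>) x = conv (*) v \<eta> x"
proof -
  have "(\<integral>y. u y * iter_pd [e] (\<lambda>y. \<eta> (x - y)) y \<partial>lborel) = (- 1) ^ length [e] * (\<integral>y. v y * \<eta> (x - y) \<partial>lborel)"
    using assms(1) test_function_reflect[OF assms(2)] unfolding weak_deriv_def by blast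
  then show ?thesis
    using smooth_reflect(2)[of \<eta> e x] assms by (simp add: test_function_def iter_pd_def conv_def)
qed

lemma conv_bump_close:
  fixes u :: "'a::euclidean_space \<Rightarrow> real"
  assumes "\<And>x y. \<bar>u x - u y\<bar> \<le> L * norm (x - y)" "\<And>x. \<bar>u x\<bar> \<le> M" "0 \<le> L"
  shows "\<bar>conv (*) u (bump n) x - u x\<bar> \<le> L / Suc n"
proof (rule conv_close[OF _ assms(2) test_function_integrable[OF test_function_bump] bump_nonneg integral_bump])
  show "u \<in> borel_measurable borel"
    by (intro borel_measurable_continuous_onI lipschitz_imp_continuous[OF assms(1)])
  fix y assume "bump n (x - y) \<noteq> 0"
  then have "norm (x - y) \<le> 1 / Suc n" using bump_support[of n "x - y"] by (meson not_le)
  then have "L * norm (x - y) \<le> L * (1 / Suc n)" by (intro mult_left_mono assms(3))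
  then show "\<bar>u y - u x\<bar> \<le> L / Suc n" using assms(1)[of x y] by simp
qed

lemma conv_bump_tendsto:
  fixes u :: "'a::euclidean_space \<Rightarrow> real"
  assumes c: "continuous_on UNIV u" and "\<And>x. \<bar>u x\<bar> \<le> M"
  shows "(\<lambda>n. conv (*) u (bump n) x) \<longlonglongrightarrow> u x"
proof (rule LIMSEQ_I)
  fix r :: real assume r: "r > 0"
  have "isCont u x" using c by (simp add: continuous_on_eq_continuous_at)
  then obtain d where d: "d > 0" "\<And>y. norm (y - x) < d \<Longrightarrow> \<bar>u y - u x\<bar> < r / 2"
    using r unfolding continuous_at_eps_delta by (metis dist_norm half_gt_zero real_norm_def)
  obtain N where N: "1 / Suc N < d" using d(1) nat_approx_posE by blast
  have "\<bar>conv (*) u (bump n) x - u x\<bar> \<le> r / 2" if "n \<ge> N" for n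
  proof (rule conv_close[OF _ assms(2) test_function_integrable[OF test_function_bump] bump_nonneg integral_bump])
    show "u \<in> borel_measurable borel"
      by (intro borel_measurable_continuous_onI c)
    fix y assume "bump n (x - y) \<noteq> 0"
    then have "norm (x - y) \<le> 1 / Suc n" using bump_support[of n "x - y"] by (meson not_le)
    also have "\<dots> \<le> 1 / Suc N" using that by (simp add: field_simps)
    finally have "norm (y - x) < d" using N by (simp add: norm_minus_commute)
    then show "\<bar>u y - u x\<bar> \<le> r / 2" using d(2) less_imp_le by blast
  qed
  then show "\<exists>no. \<forall>n\<ge>no. norm (conv (*) u (bump n) x - u x) < r"
    using r by (intro exI[of _ N]) fastforce
qed

text \<open>
  The mollifications are Cauchy since they are uniformly Lipschitz and mollifications commute:
  \<open>u * \<eta>\<^sub>n * \<eta>\<^sub>m\<close> is close to both \<open>u * \<eta>\<^sub>n\<close> and \<open>u * \<eta>\<^sub>m\<close>.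
\<close>

lemma weak_derivs_bounded_imp_lipschitz:
  fixes u :: "'a::euclidean_space \<Rightarrow> real"
  assumes um: "u \<in> borel_measurable borel" and u: "\<And>x. \<bar>u x\<bar> \<le> M"
    and vm: "\<And>e. e \<in> Basis \<Longrightarrow> v e \<in> borel_measurable borel"
    and v: "\<And>e x. e \<in> Basis \<Longrightarrow> \<bar>v e x\<bar> \<le> M'"
    and w: "\<And>e. e \<in> Basis \<Longrightarrow> weak_deriv [e] u (v e)"
  shows "\<exists>w L. (\<forall>x. \<bar>w x\<bar> \<le> M) \<and> (\<forall>x y. \<bar>w x - w y\<bar> \<le> L * norm (x - y)) \<and>
    (\<forall>\<theta>. test_function \<theta> \<longrightarrow> (\<integral>x. u x * \<theta> x \<partial>lborel) = (\<integral>x. w x * \<theta> x \<partial>lborel))"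
proof -
  let ?U = "\<lambda>n. conv (*) u (bump n)"
  define L where "L = real DIM('a) * M'"
  obtain e0 :: 'a where e0: "e0 \<in> Basis" using nonempty_Basis by blast
  have M': "0 \<le> M'" using v[OF e0, of 0] by linarith
  have L: "0 \<le> L" using M' by (simp add: L_def)
  \<comment> \<open>Closeness to the constant 0 with tolerance C is a sup bound that does not depend
    on n.\<close>
  have bd: "\<bar>conv (*) f (bump n) x\<bar> \<le> C" if "f \<in> borel_measurable borel" "\<And>x. \<bar>f x\<bar> \<le> C" for f C n and x :: 'a
    using conv_close[OF that test_function_integrable[OF test_function_bump] bump_nonneg integral_bump, of n x 0 C] that(2) by simp
  have lip: "\<bar>?U n x - ?U n y\<bar> \<le> L * norm (x - y)" for n x y
    unfolding L_def
  proof (rule lipschitz_of_partials[OF conv_has_derivative[OF um u test_function_bump]])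
    fix e x :: 'a assume e: "e \<in> Basis"
    show "\<bar>conv (*) u (pd e (bump n)) x\<bar> \<le> M'"
      unfolding conv_weak_deriv[OF w[OF e] test_function_bump e] by (rule bd[OF vm[OF e] v[OF e]])
  qed
  have close: "\<bar>?U n x - ?U m x\<bar> \<le> L / Suc n + L / Suc m" for n m x
  proof -
    have "\<bar>conv (*) (?U n) (bump m) x - ?U n x\<bar> \<le> L / Suc m" "\<bar>conv (*) (?U m) (bump n) x - ?U m x\<bar> \<le> L / Suc n"
      by (rule conv_bump_close[OF lip bd[OF um u] L])+
    moreover have "conv (*) (?U n) (bump m) x = conv (*) (?U m) (bump n) x"
      by (rule conv_conv_commute[OF um u test_function_bump test_function_bump])
    ultimately show ?thesis by linarith
  qed
  have lim0: "(\<lambda>n. L / Suc n) \<longlonglongrightarrow> 0"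
    using LIMSEQ_Suc[OF lim_const_over_n[of L]] .
  have conv: "convergent (\<lambda>n. ?U n x)" for x
  proof -
    have "Cauchy (\<lambda>n. ?U n x)"
    proof (rule metric_CauchyI)
      fix e :: real assume "e > 0"
      then have "\<forall>\<^sub>F n in sequentially. L / Suc n < e / 2"
        using order_tendstoD(2)[OF lim0, of "e / 2"] by simp
      then obtain N where N: "\<And>n. n \<ge> N \<Longrightarrow> L / Suc n < e / 2" by (auto simp: eventually_sequentially)
      then have "dist (?U m x) (?U n x) < e" if "m \<ge> N" "n \<ge> N" for m n
        using close[of m x n] N[OF that(1)] N[OF that(2)] unfolding dist_real_def by linarith
      then show "\<exists>N. \<forall>m\<ge>N. \<forall>n\<ge>N. dist (?U m x) (?U n x) < e" by blast
    qed
    then show ?thesis by (rule Cauchy_convergent)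
  qed
  define w where "w x = lim (\<lambda>n. ?U n x)" for x
  have wl: "(\<lambda>n. ?U n x) \<longlonglongrightarrow> w x" for x
    using conv[of x] unfolding w_def by (simp add: convergent_LIMSEQ_iff)
  have 1: "\<bar>w x\<bar> \<le> M" for x
    by (rule LIMSEQ_le_const2[OF tendsto_rabs[OF wl]]) (use bd[OF um u] in auto)
  have 2: "\<bar>w x - w y\<bar> \<le> L * norm (x - y)" for x y
    by (rule LIMSEQ_le_const2[OF tendsto_rabs[OF tendsto_diff[OF wl wl]]]) (use lip in auto)
  have 3: "(\<integral>x. u x * \<theta> x \<partial>lborel) = (\<integral>x. w x * \<theta> x \<partial>lborel)" if \<theta>: "test_function \<theta>" for \<theta>
  proof -
    \<comment> \<open>Pairing with \<theta> is convolution with its reflection evaluated at 0, so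
      limits of pairings become limits of convolutions.\<close>
    define \<theta>' where "\<theta>' = (\<lambda>y. \<theta> (0 - y))"
    have \<theta>': "test_function \<theta>'" unfolding \<theta>'_def by (rule test_function_reflect[OF \<theta>])
    have c0: "conv (*) f \<theta>' 0 = (\<integral>x. f x * \<theta> x \<partial>lborel)" for f by (simp add: conv_def \<theta>'_def)
    have l1: "(\<lambda>n. conv (*) (?U n) \<theta>' 0) \<longlonglongrightarrow> conv (*) w \<theta>' 0"
      unfolding c0
    proof (rule integral_dominated_convergence[where w="\<lambda>x. M * \<bar>\<theta> x\<bar>"])
      have [measurable]: "\<theta> \<in> borel_measurable borel" using \<theta> test_function_measurable by blast
      have [measurable]: "w \<in> borel_measurable borel"
        by (intro borel_measurable_continuous_onI lipschitz_imp_continuous[OF 2])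
      have [measurable]: "?U n \<in> borel_measurable borel" for n
        by (intro borel_measurable_continuous_onI lipschitz_imp_continuous[OF lip])
      show "(\<lambda>x. w x * \<theta> x) \<in> borel_measurable lborel" "(\<lambda>x. ?U n x * \<theta> x) \<in> borel_measurable lborel" for n
        by measurable
      show "integrable lborel (\<lambda>x. M * \<bar>\<theta> x\<bar>)" using test_function_integrable[OF \<theta>] by simp
      show "AE x in lborel. (\<lambda>n. ?U n x * \<theta> x) \<longlonglongrightarrow> w x * \<theta> x"
        by (intro AE_I2 tendsto_intros wl)
      show "AE x in lborel. norm (?U n x * \<theta> x) \<le> M * \<bar>\<theta> x\<bar>" for n
        using bd[OF um u] by (intro AE_I2) (auto simp: abs_mult intro!: mult_right_mono)
    qed
    \<comment> \<open>The same sequence is computed in two ways: its limit is the pairing of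
      \<open>w\<close> if u is mollified first, and the pairing of \<open>u\<close> if the
      convolution with \<theta>' is mollified. So \<open>w\<close> represents \<open>u\<close> as a
      distribution, without a pointwise claim.\<close>
    have e1: "conv (*) (?U n) \<theta>' 0 = conv (*) (conv (*) u \<theta>') (bump n) 0" for n
      by (rule conv_conv_commute[OF um u test_function_bump \<theta>'])
    have l2: "(\<lambda>n. conv (*) (conv (*) u \<theta>') (bump n) 0) \<longlonglongrightarrow> conv (*) u \<theta>' 0"
    proof (rule conv_bump_tendsto[OF conv_continuous[OF um u \<theta>']])
      fix x
      have "norm (conv (*) u \<theta>' x) \<le> (\<integral>y. norm (u y * \<theta>' (x - y)) \<partial>lborel)"
        unfolding conv_def by (rule integral_norm_bound)
      also have "\<dots> \<le> (\<integral>y. M * \<bar>\<theta>' (x - y)\<bar> \<partial>lborel)"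
      proof (rule integral_mono)
        show "integrable lborel (\<lambda>y. norm (u y * \<theta>' (x - y)))"
          by (intro integrable_norm conv_integrable[OF um u test_function_integrable[OF \<theta>']])
        show "integrable lborel (\<lambda>y. M * \<bar>\<theta>' (x - y)\<bar>)"
          using lborel_integrable_reflect[OF test_function_integrable[OF \<theta>']] by simp
      qed (use u in \<open>auto simp: abs_mult intro!: mult_right_mono\<close>)
      also have "\<dots> = (\<integral>y. M * \<bar>\<theta>' y\<bar> \<partial>lborel)"
        using lborel_integral_reflect[of "\<lambda>y. M * \<bar>\<theta>' y\<bar>" x] test_function_measurable[OF \<theta>'] by measurable
      finally show "\<bar>conv (*) u \<theta>' x\<bar> \<le> (\<integral>y. M * \<bar>\<theta>' y\<bar> \<partial>lborel)" by simp
    qed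
    have "conv (*) w \<theta>' 0 = conv (*) u \<theta>' 0" using LIMSEQ_unique[OF l1 l2[folded e1]] .
    then show ?thesis by (simp add: c0)
  qed
  show ?thesis using 1 2 3 by blast
qed

text \<open>The mollified v are the classical partial derivatives of the mollified u, and they
  converge to v uniformly, each at rate L / (n + 1). Uniform convergence of derivatives hands
  differentiability to the limit, which is u because u is continuous.\<close>

lemma weak_derivs_lipschitz_imp_C1:
  fixes u :: "'a::euclidean_space \<Rightarrow> real"
  assumes u: "continuous_on UNIV u" "\<And>x. \<bar>u x\<bar> \<le> M"
    and v: "\<And>e x. e \<in> Basis \<Longrightarrow> \<bar>v e x\<bar> \<le> M'"
    and L: "\<And>e x y. e \<in> Basis \<Longrightarrow> \<bar>v e x - v e y\<bar> \<le> L * norm (x - y)" "0 \<le> L"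
    and w: "\<And>e. e \<in> Basis \<Longrightarrow> weak_deriv [e] u (v e)"
  shows "(u has_derivative (\<lambda>h. \<Sum>e\<in>Basis. (h \<bullet> e) * v e x)) (at x)"
proof -
  have um: "u \<in> borel_measurable borel" by (intro borel_measurable_continuous_onI u)
  have der: "(conv (*) u (bump n) has_derivative (\<lambda>h. \<Sum>e\<in>Basis. (h \<bullet> e) * conv (*) (v e) (bump n) x)) (at x)" for n x
  proof -
    have "(\<lambda>h. \<Sum>e\<in>Basis. (h \<bullet> e) * conv (*) u (pd e (bump n)) x) = (\<lambda>h. \<Sum>e\<in>Basis. (h \<bullet> e) * conv (*) (v e) (bump n) x)"
      using conv_weak_deriv[OF w test_function_bump] by (intro ext sum.cong) auto
    then show ?thesis using conv_has_derivative[OF um u(2) test_function_bump, of n x] by simp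
  qed
  have lim0: "(\<lambda>n. real DIM('a) * (L / Suc n)) \<longlonglongrightarrow> 0"
    using tendsto_mult_right_zero[OF LIMSEQ_Suc[OF lim_const_over_n[of L]]] .
  have "\<exists>g. \<forall>x\<in>UNIV. (\<lambda>n. conv (*) u (bump n) x) \<longlonglongrightarrow> g x \<and>
      (g has_derivative (\<lambda>h. \<Sum>e\<in>Basis. (h \<bullet> e) * v e x)) (at x within UNIV)"
  proof (rule has_derivative_sequence[where f="\<lambda>n. conv (*) u (bump n)" and ?x0.0=0 and l="u 0"
        and f'="\<lambda>n x h. \<Sum>e\<in>Basis. (h \<bullet> e) * conv (*) (v e) (bump n) x"])
    show "(\<lambda>n. conv (*) u (bump n) 0) \<longlonglongrightarrow> u 0" by (rule conv_bump_tendsto[OF u])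
    fix \<epsilon> :: real assume "\<epsilon> > 0"
    then have "\<forall>\<^sub>F n in sequentially. real DIM('a) * (L / Suc n) < \<epsilon>"
      using order_tendstoD(2)[OF lim0] by blast
    then show "\<forall>\<^sub>F n in sequentially. \<forall>x\<in>UNIV. \<forall>h::'a. norm ((\<Sum>e\<in>Basis. (h \<bullet> e) * conv (*) (v e) (bump n) x) - (\<Sum>e\<in>Basis. (h \<bullet> e) * v e x)) \<le> \<epsilon> * norm h"
    proof (eventually_elim, intro ballI allI)
      fix n and x h :: 'a assume n: "real DIM('a) * (L / Suc n) < \<epsilon>"
      have "norm ((\<Sum>e\<in>Basis. (h \<bullet> e) * conv (*) (v e) (bump n) x) - (\<Sum>e\<in>Basis. (h \<bullet> e) * v e x))
        = \<bar>\<Sum>e\<in>Basis. (h \<bullet> e) * (conv (*) (v e) (bump n) x - v e x)\<bar>"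
        by (simp add: sum_subtractf[symmetric] right_diff_distrib)
      also have "\<dots> \<le> (\<Sum>e\<in>Basis. \<bar>(h \<bullet> e) * (conv (*) (v e) (bump n) x - v e x)\<bar>)" by (rule sum_abs)
      also have "\<dots> \<le> (\<Sum>e\<in>(Basis::'a set). norm h * (L / Suc n))"
        unfolding abs_mult using conv_bump_close[OF L(1) v L(2)] by (intro sum_mono mult_mono Basis_le_norm) auto
      also have "\<dots> = (real DIM('a) * (L / Suc n)) * norm h" by simp
      also have "\<dots> \<le> \<epsilon> * norm h" using n by (intro mult_right_mono) auto
      finally show "norm ((\<Sum>e\<in>Basis. (h \<bullet> e) * conv (*) (v e) (bump n) x) - (\<Sum>e\<in>Basis. (h \<bullet> e) * v e x)) \<le> \<epsilon> * norm h" .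
    qed
  qed (use der in auto)
  then obtain g where g: "\<And>x. (\<lambda>n. conv (*) u (bump n) x) \<longlonglongrightarrow> g x"
    "\<And>x. (g has_derivative (\<lambda>h. \<Sum>e\<in>Basis. (h \<bullet> e) * v e x)) (at x)" by auto
  have "g = u" using LIMSEQ_unique[OF g(1) conv_bump_tendsto[OF u]] by blast
  then show ?thesis using g(2) by simp
qed

lemma lipschitz_mono:
  fixes f :: "'a::real_normed_vector \<Rightarrow> real"
  assumes "\<forall>x y. \<bar>f x - f y\<bar> \<le> L * norm (x - y)" "L \<le> L'"
  shows "\<forall>x y. \<bar>f x - f y\<bar> \<le> L' * norm (x - y)"
  using assms(1) mult_right_mono[OF assms(2) norm_ge_zero] order_trans by blast

lemma finite_uniform_bound:
  fixes P :: "'b \<Rightarrow> real \<Rightarrow> bool"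
  assumes "finite S" "\<And>e. e \<in> S \<Longrightarrow> \<exists>L. P e L" "\<And>e L L'. P e L \<Longrightarrow> L \<le> L' \<Longrightarrow> P e L'"
  shows "\<exists>L\<ge>0. \<forall>e\<in>S. P e L"
proof -
  obtain L where L: "\<forall>e\<in>S. P e (L e)" using bchoice[of S P] assms(2) by blast
  have "L e \<le> (\<Sum>e\<in>S. \<bar>L e\<bar>)" if "e \<in> S" for e
    using member_le_sum[of e S "\<lambda>e. \<bar>L e\<bar>"] assms(1) that by (auto intro: order_trans[of _ "\<bar>L e\<bar>"])
  then show ?thesis using L assms(3) by (intro exI[of _ "\<Sum>e\<in>S. \<bar>L e\<bar>"]) (auto intro: sum_nonneg)
qed

text \<open>The mollification lemmas ask for bounds at every point; changing the function on a null
  set provides them.\<close>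

lemma Linf_truncate:
  fixes v :: "'a::euclidean_space \<Rightarrow> real"
  assumes "Linf v"
  shows "\<exists>w M. w \<in> borel_measurable borel \<and> (\<forall>x. \<bar>w x\<bar> \<le> M) \<and> (AE x in lborel. v x = w x)"
proof -
  have vm[measurable]: "v \<in> borel_measurable borel" using assms by (simp add: Linf_def)
  obtain M where M: "Linf_norm v \<le> ereal M" 
    using assms by (cases "Linf_norm v") (auto simp: Linf_def)
  have ae: "AE x in lborel. \<bar>v x\<bar> \<le> M"
    using esssup_AE[of "\<lambda>x. ereal \<bar>v x\<bar>" lborel] M unfolding Linf_norm_def
    by (auto elim!: eventually_mono dest: order_trans)
  let ?w = "\<lambda>x. if \<bar>v x\<bar> \<le> M then v x else 0"
  have "?w \<in> borel_measurable borel" by measurable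
  moreover have "\<bar>?w x\<bar> \<le> \<bar>M\<bar>" for x by auto
  moreover have "AE x in lborel. v x = ?w x" using ae by (auto elim: eventually_mono)
  ultimately show ?thesis by blast
qed

text \<open>The derivative of the test function in direction c serves as test function for the
  shorter list, since the last direction of a list is applied first. One sign remains.\<close>

lemma weak_deriv_snoc:
  fixes u v w :: "'a::euclidean_space \<Rightarrow> real"
  assumes "weak_deriv bs u v" "weak_deriv (bs @ [c]) u w" "c \<in> Basis"
  shows "weak_deriv [c] v w"
  unfolding weak_deriv_def
proof (intro allI impI)
  fix \<eta> :: "'a \<Rightarrow> real" assume \<eta>: "test_function \<eta>"
  have "(\<integral>x. u x * iter_pd bs (pd c \<eta>) x \<partial>lborel) = (- 1) ^ length bs * (\<integral>x. v x * pd c \<eta> x \<partial>lborel)"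
    using assms(1) test_function_pd[OF \<eta> assms(3)] unfolding weak_deriv_def by blast
  moreover have "(\<integral>x. u x * iter_pd (bs @ [c]) \<eta> x \<partial>lborel) = (- 1) ^ length (bs @ [c]) * (\<integral>x. w x * \<eta> x \<partial>lborel)"
    using assms(2) \<eta> unfolding weak_deriv_def by blast
  ultimately have "(- 1) ^ length bs * (\<integral>x. v x * pd c \<eta> x \<partial>lborel) = (- 1) ^ length bs * (- (\<integral>x. w x * \<eta> x \<partial>lborel))"
    by (simp add: iter_pd_def)
  then have "(\<integral>x. v x * pd c \<eta> x \<partial>lborel) = - (\<integral>x. w x * \<eta> x \<partial>lborel)"
    by (subst (asm) mult_cancel_left) auto
  then show "(\<integral>x. v x * iter_pd [c] \<eta> x \<partial>lborel) = (- 1) ^ length [c] * (\<integral>x. w x * \<eta> x \<partial>lborel)"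
    by (simp add: iter_pd_def)
qed

lemma weak_deriv_cong_right:
  assumes "weak_deriv bs u v"
    and "\<And>\<theta>. test_function \<theta> \<Longrightarrow> (\<integral>x. v x * \<theta> x \<partial>lborel) = (\<integral>x. w x * \<theta> x \<partial>lborel)"
  shows "weak_deriv bs u w"
  using assms unfolding weak_deriv_def by simp

lemma weak_deriv_cong_left:
  fixes u v w :: "'a::euclidean_space \<Rightarrow> real"
  assumes "weak_deriv [e] u v" "e \<in> Basis"
    and "\<And>\<theta>. test_function \<theta> \<Longrightarrow> (\<integral>x. u x * \<theta> x \<partial>lborel) = (\<integral>x. w x * \<theta> x \<partial>lborel)"
  shows "weak_deriv [e] w v"
  unfolding weak_deriv_def
proof (intro allI impI)
  fix \<eta> :: "'a \<Rightarrow> real" assume \<eta>: "test_function \<eta>"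
  have "(\<integral>x. u x * iter_pd [e] \<eta> x \<partial>lborel) = (- 1) ^ length [e] * (\<integral>x. v x * \<eta> x \<partial>lborel)"
    using assms(1) \<eta> unfolding weak_deriv_def by blast
  then show "(\<integral>x. w x * iter_pd [e] \<eta> x \<partial>lborel) = (- 1) ^ length [e] * (\<integral>x. v x * \<eta> x \<partial>lborel)"
    using assms(3)[OF test_function_pd[OF \<eta> assms(2)]] by (simp add: iter_pd_def)
qed

text \<open>Regularity is gained from the top down. Bounded third weak derivatives give the second
  ones Lipschitz representatives, bounded second ones do the same for the first, and Lipschitz weak
  derivatives of a continuous function are classical. Representatives agree with the original
  functions against test functions, which is all that the next level asks for.\<close>

lemma sobolev_W3inf_imp_C2:
  fixes K :: "'a::euclidean_space \<Rightarrow> real"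
  assumes cont: "continuous_on UNIV K" and sob: "sobolev_Winf 3 K"
  shows "\<exists>K1 K2 L. 0 \<le> L \<and> (\<forall>x. \<bar>K x\<bar> \<le> L) \<and> (\<forall>e\<in>Basis. \<forall>x. \<bar>K1 e x\<bar> \<le> L) \<and>
    (\<forall>e\<in>Basis. \<forall>f\<in>Basis. \<forall>x. \<bar>K2 e f x\<bar> \<le> L) \<and>
    (\<forall>e\<in>Basis. \<forall>f\<in>Basis. \<forall>x y. \<bar>K2 e f x - K2 e f y\<bar> \<le> L * norm (x - y)) \<and>
    (\<forall>x. (K has_derivative (\<lambda>h. \<Sum>e\<in>Basis. (h \<bullet> e) * K1 e x)) (at x)) \<and>
    (\<forall>e\<in>Basis. \<forall>x. (K1 e has_derivative (\<lambda>h. \<Sum>f\<in>Basis. (h \<bullet> f) * K2 e f x)) (at x))"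
proof -
  let ?eq = "\<lambda>u w :: 'a \<Rightarrow> real. \<forall>\<theta>. test_function \<theta> \<longrightarrow> (\<integral>x. u x * \<theta> x \<partial>lborel) = (\<integral>x. w x * \<theta> x \<partial>lborel)"
  have ex: "\<exists>v M. v \<in> borel_measurable borel \<and> (\<forall>x. \<bar>v x\<bar> \<le> M) \<and> weak_deriv bs K v"
    if bs: "bs \<in> lists Basis" "length bs \<le> 3" for bs
  proof -
    obtain v where v: "Linf v" "weak_deriv bs K v" using sob bs unfolding sobolev_Winf_def by blast
    obtain w M where w: "w \<in> borel_measurable borel" "\<forall>x. \<bar>w x\<bar> \<le> M" "AE x in lborel. v x = w x"
      using Linf_truncate[OF v(1)] by blast
    have vm: "v \<in> borel_measurable borel" using v(1) by (simp add: Linf_def)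
    have "weak_deriv bs K w"
    proof (rule weak_deriv_cong_right[OF v(2)])
      fix \<theta> :: "'a \<Rightarrow> real" assume "test_function \<theta>"
      then have "\<theta> \<in> borel_measurable borel" by (rule test_function_measurable)
      then show "(\<integral>x. v x * \<theta> x \<partial>lborel) = (\<integral>x. w x * \<theta> x \<partial>lborel)"
        using w vm by (intro integral_cong_AE) (auto elim: eventually_mono)
    qed
    then show ?thesis using w by blast
  qed
  then obtain v M where v: "\<And>bs. bs \<in> lists Basis \<Longrightarrow> length bs \<le> 3 \<Longrightarrow>
      v bs \<in> borel_measurable borel \<and> (\<forall>x. \<bar>v bs x\<bar> \<le> M bs) \<and> weak_deriv bs K (v bs)"
    by metis
  \<comment> \<open>Only finitely many lists of directions occur, so one bound serves all weak
    derivatives up to order three.\<close>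
  define N where "N = (\<Sum>bs\<in>{bs. set bs \<subseteq> Basis \<and> length bs \<le> 3}. \<bar>M bs\<bar>)"
  have MN: "\<bar>v bs x\<bar> \<le> N" if "bs \<in> lists Basis" "length bs \<le> 3" for bs x
  proof -
    have "\<bar>v bs x\<bar> \<le> \<bar>M bs\<bar>" using v[OF that] by (meson abs_ge_self order_trans)
    also have "\<dots> \<le> N"
      unfolding N_def using that finite_lists_length_le[OF finite_Basis, of 3] by (intro member_le_sum) (auto simp: lists_eq_set)
    finally show ?thesis .
  qed
  have N0: "0 \<le> N" by (simp add: N_def sum_nonneg)
  define Q where "Q bs w L \<longleftrightarrow> (\<forall>x. \<bar>w x\<bar> \<le> N) \<and> (\<forall>x y. \<bar>w x - w y\<bar> \<le> L * norm (x - y)) \<and> ?eq (v bs) w"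
    for bs :: "'a list" and w :: "'a \<Rightarrow> real" and L
  have QD: "\<bar>w x\<bar> \<le> N" "\<bar>w x - w y\<bar> \<le> L * norm (x - y)" "?eq (v bs) w" if "Q bs w L" for bs w L x y
    using that unfolding Q_def by blast+
  define rep where "rep bs = (SOME w. \<exists>L. Q bs w L)" for bs
  have Qrep: "\<exists>L. Q bs (rep bs) L" if "\<exists>w L. Q bs w L" for bs
    unfolding rep_def by (rule someI_ex[OF that])
  define w2 where "w2 a b = rep [a, b]" for a b
  define w1 where "w1 a = rep [a]" for a
  have "\<exists>w L. Q [a, b] w L"
    if "a \<in> Basis" "b \<in> Basis" for a b
    unfolding Q_def by (rule weak_derivs_bounded_imp_lipschitz[where v="\<lambda>c. v [a, b, c]" and M'=N])
       (use that v MN weak_deriv_snoc[of "[a, b]" K "v [a, b]"] in auto)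
  from Qrep[OF this] have ex2: "\<exists>L. Q [a, b] (w2 a b) L" if "a \<in> Basis" "b \<in> Basis" for a b
    using that unfolding w2_def by blast
  have w2: "\<bar>w2 a b x\<bar> \<le> N" "?eq (v [a, b]) (w2 a b)" if "a \<in> Basis" "b \<in> Basis" for a b x
    using ex2[OF that] QD(1,3) by blast+
  have "\<exists>L\<ge>0. \<forall>p\<in>Basis \<times> Basis. \<forall>x y. \<bar>w2 (fst p) (snd p) x - w2 (fst p) (snd p) y\<bar> \<le> L * norm (x - y)"
  proof (rule finite_uniform_bound)
    show "\<exists>L. \<forall>x y. \<bar>w2 (fst p) (snd p) x - w2 (fst p) (snd p) y\<bar> \<le> L * norm (x - y)"
      if "p \<in> Basis \<times> Basis" for p
      using ex2[of "fst p" "snd p"] that QD(2) by (metis mem_Times_iff)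
  qed (assumption | rule finite_cartesian_product finite_Basis lipschitz_mono)+
  then obtain L where L: "L \<ge> 0" "\<And>a b x y. a \<in> Basis \<Longrightarrow> b \<in> Basis \<Longrightarrow> \<bar>w2 a b x - w2 a b y\<bar> \<le> L * norm (x - y)"
    by auto
  have wd2: "weak_deriv [b] (v [a]) (w2 a b)" if "a \<in> Basis" "b \<in> Basis" for a b
    by (rule weak_deriv_cong_right[of _ _ "v [a, b]"])
       (use that v w2(2) weak_deriv_snoc[of "[a]" K "v [a]" b "v [a, b]"] in auto)
  have "\<exists>w L. Q [a] w L"
    if "a \<in> Basis" for a
    unfolding Q_def
  proof (rule weak_derivs_bounded_imp_lipschitz[where v="w2 a" and M'=N])
    show "w2 a e \<in> borel_measurable borel" if "e \<in> Basis" for e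
      by (intro borel_measurable_continuous_onI lipschitz_imp_continuous[OF L(2)]) fact+
  qed (use that v MN wd2 w2 in auto)
  from Qrep[OF this] have ex1: "\<exists>L. Q [a] (w1 a) L" if "a \<in> Basis" for a
    using that unfolding w1_def by blast
  have w1: "\<bar>w1 a x\<bar> \<le> N" "?eq (v [a]) (w1 a)" if "a \<in> Basis" for a x
    using ex1[OF that] QD(1,3) by blast+
  have "\<exists>L\<ge>0. \<forall>a\<in>Basis. \<forall>x y. \<bar>w1 a x - w1 a y\<bar> \<le> L * norm (x - y)"
  proof (rule finite_uniform_bound)
    show "\<exists>L. \<forall>x y. \<bar>w1 a x - w1 a y\<bar> \<le> L * norm (x - y)" if "a \<in> Basis" for a
      using ex1[OF that] QD(2) by metis
  qed (assumption | rule finite_cartesian_product finite_Basis lipschitz_mono)+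
  then obtain L' where L': "L' \<ge> 0" "\<And>a x y. a \<in> Basis \<Longrightarrow> \<bar>w1 a x - w1 a y\<bar> \<le> L' * norm (x - y)"
    by auto
  have Kb: "\<exists>M. \<forall>x. \<bar>K x\<bar> \<le> M"
  proof -
    have lf: "Linf K" using sob by (simp add: sobolev_Winf_def)
    obtain M where M: "Linf_norm K \<le> ereal M" 
      using lf by (cases "Linf_norm K") (auto simp: Linf_def)
    have "AE x in lborel. \<bar>K x\<bar> \<le> M"
      using esssup_AE[of "\<lambda>x. ereal \<bar>K x\<bar>" lborel] M unfolding Linf_norm_def
      by (auto elim!: eventually_mono dest: order_trans)
    from AE_lborel_le_continuous[OF this] cont show ?thesis by (auto intro!: continuous_intros)
  qed
  then obtain M0 where M0: "\<And>x. \<bar>K x\<bar> \<le> M0" by blast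
  \<comment> \<open>Continuity of \<open>K\<close> enters here: \<open>K\<close> itself, and not
    just a function equal to it almost everywhere, is differentiable.\<close>
  have d1: "(K has_derivative (\<lambda>h. \<Sum>e\<in>Basis. (h \<bullet> e) * w1 e x)) (at x)" for x
  proof (rule weak_derivs_lipschitz_imp_C1[OF cont M0 w1(1) L'(2) L'(1)])
    show "weak_deriv [e] K (w1 e)" if "e \<in> Basis" for e
      by (rule weak_deriv_cong_right[of _ _ "v [e]"]) (use v w1(2) that in auto)
  qed
  have d2: "(w1 a has_derivative (\<lambda>h. \<Sum>e\<in>Basis. (h \<bullet> e) * w2 a e x)) (at x)" if a: "a \<in> Basis" for a x
  proof (rule weak_derivs_lipschitz_imp_C1[OF lipschitz_imp_continuous[OF L'(2)[OF a]] w1(1)[OF a] w2(1)[OF a] L(2)[OF a] L(1)])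
    show "weak_deriv [e] (w1 a) (w2 a e)" if "e \<in> Basis" for e
      using weak_deriv_cong_left[OF wd2[OF a that] that] w1(2)[OF a] by blast
  qed
  define C where "C = N + L + \<bar>M0\<bar>"
  have "\<bar>K x\<bar> \<le> C" for x using M0[of x] N0 L(1) by (simp add: C_def)
  moreover have "\<bar>w1 e x\<bar> \<le> C" if "e \<in> Basis" for e x
    using w1(1)[OF that, of x] L(1) by (simp add: C_def)
  moreover have "\<bar>w2 e f x\<bar> \<le> C" if "e \<in> Basis" "f \<in> Basis" for e f x
    using w2(1)[OF that, of x] L(1) by (simp add: C_def)
  moreover have "\<bar>w2 e f x - w2 e f y\<bar> \<le> C * norm (x - y)" if "e \<in> Basis" "f \<in> Basis" for e f x y
    by (rule order_trans[OF L(2)[OF that] mult_right_mono]) (use N0 in \<open>auto simp: C_def\<close>)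
  moreover have "0 \<le> C" using N0 L(1) by (simp add: C_def)
  ultimately show ?thesis
    using d1 d2 by (intro exI[of _ w1] exI[of _ w2] exI[of _ C]) blast
qed

section \<open>Potentials of polynomial growth\<close>

lemma BL_norm_leI:
  fixes f :: "'a::euclidean_space \<Rightarrow> real"
  assumes "\<And>x. \<bar>f x\<bar> \<le> C" "\<And>x y. \<bar>f x - f y\<bar> \<le> C * norm (x - y)"
  shows "BL_norm f \<le> ereal C"
proof -
  have "f \<in> borel_measurable borel"
    by (intro borel_measurable_continuous_onI lipschitz_imp_continuous[OF assms(2)])
  then have "Linf_norm f \<le> ereal C"
    unfolding Linf_norm_def using assms(1) by (intro esssup_I) auto
  moreover have "Lip_seminorm f \<le> ereal C"
    unfolding Lip_seminorm_def using assms(2) by (intro SUP_least) (auto simp: divide_le_eq)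
  ultimately show ?thesis by (simp add: BL_norm_def)
qed

text \<open>The bound on the Lipschitz seminorm makes f continuous, and for continuous functions an
  essential bound holds everywhere.\<close>

lemma BL_norm_leD:
  fixes f :: "'a::euclidean_space \<Rightarrow> real"
  assumes "BL_norm f \<le> ereal C"
  shows "\<bar>f x - f y\<bar> \<le> C * norm (x - y)" and "\<bar>f x\<bar> \<le> C"
proof -
  have lip: "\<bar>f x - f y\<bar> \<le> C * norm (x - y)" for x y
  proof (cases "x = y")
    case False
    then have "ereal (\<bar>f x - f y\<bar> / norm (x - y)) \<le> Lip_seminorm f"
      unfolding Lip_seminorm_def by (intro SUP_upper2[of "(x, y)"]) auto
    also have "\<dots> \<le> ereal C" using assms by (simp add: BL_norm_def)
    finally show ?thesis using False by (simp add: divide_le_eq)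
  qed simp
  have "AE x in lborel. ereal \<bar>f x\<bar> \<le> ereal C"
    using esssup_AE[of "\<lambda>x. ereal \<bar>f x\<bar>" lborel] assms unfolding BL_norm_def Linf_norm_def
    by (auto elim!: eventually_mono dest: order_trans)
  then have "AE x in lborel. \<bar>f x\<bar> \<le> C" by simp
  from AE_lborel_le_continuous[OF this] lipschitz_imp_continuous[OF lip]
  show "\<bar>f x\<bar> \<le> C" by (auto intro!: continuous_intros)
  show "\<bar>f x - f y\<bar> \<le> C * norm (x - y)" by (rule lip)
qed

lemma C2_of_sobolev_W3inf:
  fixes K :: "'a::euclidean_space \<Rightarrow> real"
  assumes "continuous_on UNIV K" "sobolev_Winf 3 K"
  shows "\<exists>L\<ge>0. K differentiable_on UNIV \<and> (\<forall>e\<in>Basis. pd e K differentiable_on UNIV) \<and>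
    (\<forall>x. \<bar>K x\<bar> \<le> L) \<and> (\<forall>e\<in>Basis. \<forall>x. \<bar>pd e K x\<bar> \<le> L) \<and>
    (\<forall>e\<in>Basis. \<forall>f\<in>Basis. \<forall>x. \<bar>pd f (pd e K) x\<bar> \<le> L) \<and>
    (\<forall>e\<in>Basis. \<forall>f\<in>Basis. \<forall>x y. \<bar>pd f (pd e K) x - pd f (pd e K) y\<bar> \<le> L * norm (x - y))"
proof -
  obtain K1 K2 L where L: "0 \<le> L" "\<forall>x. \<bar>K x\<bar> \<le> L" "\<forall>e\<in>Basis. \<forall>x. \<bar>K1 e x\<bar> \<le> L"
    "\<forall>e\<in>Basis. \<forall>f\<in>Basis. \<forall>x. \<bar>K2 e f x\<bar> \<le> L"
    "\<forall>e\<in>Basis. \<forall>f\<in>Basis. \<forall>x y. \<bar>K2 e f x - K2 e f y\<bar> \<le> L * norm (x - y)"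
    and d1: "\<And>x. (K has_derivative (\<lambda>h. \<Sum>e\<in>Basis. (h \<bullet> e) * K1 e x)) (at x)"
    and d2: "\<And>e x. e \<in> Basis \<Longrightarrow> (K1 e has_derivative (\<lambda>h. \<Sum>f\<in>Basis. (h \<bullet> f) * K2 e f x)) (at x)"
    using sobolev_W3inf_imp_C2[OF assms] by blast
  have 1: "pd e K = K1 e" if "e \<in> Basis" for e
    using pd_eqI[OF d1, of e] sum_Basis_inner[OF that, of "\<lambda>e. K1 e _"] by (intro ext) simp
  have 2: "pd f (K1 e) = K2 e f" if "e \<in> Basis" "f \<in> Basis" for e f
    using pd_eqI[OF d2[OF that(1)], of f] sum_Basis_inner[OF that(2), of "\<lambda>f. K2 e f _"] by (intro ext) simp
  have "K differentiable_on UNIV" "\<And>e. e \<in> Basis \<Longrightarrow> K1 e differentiable_on UNIV"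
    unfolding differentiable_on_def using d1 d2 by (blast intro: differentiableI)+
  then show ?thesis
    using L by (intro exI[of _ L]) (auto simp: 1 2)
qed

lemma abs_pd_le_norm_grad: "e \<in> Basis \<Longrightarrow> \<bar>pd e f x\<bar> \<le> norm (grad f x)"
  using Basis_le_norm[of e "grad f x"] by (simp add: grad_inner_Basis)

lemma abs_pd_pd_le_hessian_norm:
  assumes "b \<in> Basis" "e \<in> Basis"
  shows "\<bar>pd b (pd e f) x\<bar> \<le> hessian_norm f x"
proof -
  have "(pd b (pd e f) x)\<^sup>2 \<le> (\<Sum>e\<in>Basis. (pd b (pd e f) x)\<^sup>2)"
    using assms by (intro member_le_sum) auto
  also have "\<dots> \<le> (\<Sum>b\<in>Basis. \<Sum>e\<in>Basis. (pd b (pd e f) x)\<^sup>2)"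
    using assms by (intro member_le_sum[of b]) (auto intro: sum_nonneg)
  finally show ?thesis unfolding hessian_norm_def by (metis real_sqrt_abs real_sqrt_le_iff)
qed

lemma continuous_bounded_on_cball:
  fixes f :: "'a::euclidean_space \<Rightarrow> real"
  assumes "continuous_on UNIV f"
  shows "\<exists>B>0. \<forall>x. norm x \<le> r \<longrightarrow> \<bar>f x\<bar> \<le> B"
proof -
  have "bounded (f ` cball 0 r)"
    by (intro compact_imp_bounded compact_continuous_image continuous_on_subset[OF assms]) auto
  then show ?thesis by (auto simp: bounded_pos)
qed

text \<open>For |x| > 1 the powers |x|^(p-1) and |x|^(p-2) are at most |x|^p, which the lower growth
  bound controls by V. On the remaining ball continuity suffices, because 1 + V \<ge> 1.\<close>

lemma potential_derivative_bounds:
  fixes V :: "'a::euclidean_space \<Rightarrow> real"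
  assumes V: "smooth V" "\<And>x. V x \<ge> 0" and C0: "C0 > 0"
    and gr: "\<And>x. norm x > R \<Longrightarrow> 1 / C0 * (norm x powr p - 1) \<le> V x \<and>
          norm (grad V x) \<le> C0 * (norm x powr (p - 1) + 1) \<and>
          hessian_norm V x \<le> C0 * (norm x powr (p - 2) + 1)"
  shows "\<exists>c\<ge>0. \<forall>e\<in>Basis. \<forall>x. \<bar>pd e V x\<bar> \<le> c * (1 + V x) \<and> (\<forall>b\<in>Basis. \<bar>pd b (pd e V) x\<bar> \<le> c * (1 + V x))"
proof -
  let ?R = "max R 1"
  define c0 where "c0 = C0 * (C0 + 2)"
  have c0: "c0 \<ge> 0" using C0 by (simp add: c0_def)
  have out: "C0 * (norm x powr q + 1) \<le> c0 * (1 + V x)" if x: "norm x > ?R" and q: "q \<le> p" for x q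
  proof -
    have "norm x powr q \<le> norm x powr p" using x q by (intro powr_mono) auto
    also have "norm x powr p \<le> C0 * V x + 1"
      using gr[of x] x C0 by (auto simp: field_simps)
    finally have "norm x powr q + 1 \<le> C0 * V x + 2" by simp
    also have "\<dots> \<le> (C0 + 2) * (1 + V x)" using V(2)[of x] C0 by (simp add: algebra_simps)
    finally show ?thesis unfolding c0_def using C0 by (simp add: mult.assoc)
  qed
  have ext: "\<exists>c. \<forall>x. \<bar>f x\<bar> \<le> c * (1 + V x)"
    if f: "continuous_on UNIV f" "\<And>x. norm x > ?R \<Longrightarrow> \<bar>f x\<bar> \<le> c0 * (1 + V x)" for f :: "'a \<Rightarrow> real"
  proof -
    obtain B where B: "B > 0" "\<And>x. norm x \<le> ?R \<Longrightarrow> \<bar>f x\<bar> \<le> B" using continuous_bounded_on_cball[OF f(1)] by blast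
    have "\<bar>f x\<bar> \<le> (B + c0) * (1 + V x)" for x
    proof (cases "norm x \<le> ?R")
      case True
      have "B * 1 \<le> (B + c0) * (1 + V x)" using B(1) c0 V(2)[of x] by (intro mult_mono) auto
      then show ?thesis using B(2)[OF True] by simp
    next
      case False
      have "c0 * (1 + V x) \<le> (B + c0) * (1 + V x)" using B(1) V(2)[of x] by (intro mult_right_mono) auto
      moreover have "norm x > ?R" using False by linarith
      ultimately show ?thesis using f(2)[of x] by linarith
    qed
    then show ?thesis by blast
  qed
  have mono: "\<bar>a\<bar> \<le> L' * (1 + V x)" if "\<bar>a\<bar> \<le> L * (1 + V x)" "L \<le> L'" for a L L' x
    using that(1) mult_right_mono[OF that(2), of "1 + V x"] V(2)[of x] by linarith
  have "\<exists>c\<ge>0. \<forall>e\<in>Basis. \<forall>x. \<bar>pd e V x\<bar> \<le> c * (1 + V x)"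
  proof (rule finite_uniform_bound)
    fix e :: 'a assume e: "e \<in> Basis"
    show "\<exists>c. \<forall>x. \<bar>pd e V x\<bar> \<le> c * (1 + V x)"
    proof (rule ext)
      show "continuous_on UNIV (pd e V)" using smooth_continuous smooth_pd V e by blast
      fix x :: 'a assume x: "norm x > ?R"
      have "\<bar>pd e V x\<bar> \<le> C0 * (norm x powr (p - 1) + 1)"
        using abs_pd_le_norm_grad[OF e, of V x] gr[of x] x by auto
      then show "\<bar>pd e V x\<bar> \<le> c0 * (1 + V x)" using out[OF x, of "p - 1"] by simp
    qed
  qed (simp, blast intro: mono)
  then obtain c1 where c1: "c1 \<ge> 0" "\<forall>e\<in>Basis. \<forall>x. \<bar>pd e V x\<bar> \<le> c1 * (1 + V x)" by blast
  have "\<exists>c\<ge>0. \<forall>q\<in>Basis \<times> Basis. \<forall>x. \<bar>pd (snd q) (pd (fst q) V) x\<bar> \<le> c * (1 + V x)"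
  proof (rule finite_uniform_bound)
    fix q :: "'a \<times> 'a" assume q: "q \<in> Basis \<times> Basis"
    show "\<exists>c. \<forall>x. \<bar>pd (snd q) (pd (fst q) V) x\<bar> \<le> c * (1 + V x)"
    proof (rule ext)
      show "continuous_on UNIV (pd (snd q) (pd (fst q) V))" using smooth_continuous smooth_pd V q by (metis mem_Times_iff)
      fix x :: 'a assume x: "norm x > ?R"
      have "\<bar>pd (snd q) (pd (fst q) V) x\<bar> \<le> C0 * (norm x powr (p - 2) + 1)"
        using abs_pd_pd_le_hessian_norm[of "snd q" "fst q" V x] q gr[of x] x by auto
      then show "\<bar>pd (snd q) (pd (fst q) V) x\<bar> \<le> c0 * (1 + V x)" using out[OF x, of "p - 2"] by simp
    qed
  qed (simp, blast intro: mono)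
  then obtain c2 where c2: "c2 \<ge> 0" "\<forall>q\<in>Basis \<times> Basis. \<forall>x. \<bar>pd (snd q) (pd (fst q) V) x\<bar> \<le> c2 * (1 + V x)" by blast
  show ?thesis
    using c1 c2 mono[OF _ max.cobounded1[of c1 c2]] mono[OF _ max.cobounded2[of c2 c1]]
    by (intro exI[of _ "max c1 c2"]) force
qed

section \<open>Integrability of exp(-V) (1 + V)^2\<close>

lemma integrable_one_div_1_plus_square: "integrable lborel (\<lambda>s::real. 1 / (1 + s\<^sup>2))"
  using integrable_inverse_1_plus_square by (simp add: set_integrable_def divide_inverse)

text \<open>The product form lets Tonelli reduce the claim to the one-dimensional integral of 1 / (1
  + s^2). It is the comparison function for the weight exp(-V) (1 + V)^2.\<close>

lemma integrable_prod_inverse_1_plus_square: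
  "integrable lborel (\<lambda>x::'a::euclidean_space. \<Prod>b\<in>Basis. 1 / (1 + (x \<bullet> b)\<^sup>2))"
proof (rule integrableI_nonneg)
  have "(\<integral>\<^sup>+x. ennreal (\<Prod>b\<in>Basis. 1 / (1 + (x \<bullet> b)\<^sup>2)) \<partial>(lborel::'a measure))
     = (\<integral>\<^sup>+x. (\<Prod>b\<in>Basis. ennreal (1 / (1 + (x \<bullet> b)\<^sup>2))) \<partial>(lborel::'a measure))"
    by (rule nn_integral_cong) (simp add: prod_ennreal)
  also have "\<dots> = (\<Prod>b\<in>(Basis::'a set). (\<integral>\<^sup>+x. ennreal (1 / (1 + x\<^sup>2)) \<partial>lborel))"
    by (rule nn_integral_lborel_prod) auto
  also have "\<dots> < \<infinity>"
    using integrable_one_div_1_plus_square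
    by (simp add: nn_integral_eq_integral ennreal_power[symmetric] power_less_top_ennreal)
  finally show "(\<integral>\<^sup>+x. ennreal (\<Prod>b\<in>Basis. 1 / (1 + (x \<bullet> b)\<^sup>2)) \<partial>(lborel::'a measure)) < \<infinity>" .
qed (auto intro!: AE_I2 prod_nonneg)

text \<open>Half of the exponent absorbs the factor (1 + V)^2; the other half decays faster than any
  power of |x|, because V grows at least like |x|^p with p > 0.\<close>

lemma potential_integrable:
  fixes V :: "'a::euclidean_space \<Rightarrow> real"
  assumes V: "continuous_on UNIV V" "\<And>x. V x \<ge> 0" and C0: "C0 > 0" and p: "p > 0"
    and gr: "\<And>x. norm x > R \<Longrightarrow> 1 / C0 * (norm x powr p - 1) \<le> V x"
  shows "integrable lborel (\<lambda>x. exp (- V x) * (1 + V x)\<^sup>2)"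
proof -
  let ?P = "\<lambda>x::'a. \<Prod>b\<in>Basis. 1 / (1 + (x \<bullet> b)\<^sup>2)"
  let ?d = "DIM('a)" and ?R = "max R 1"
  have [measurable]: "V \<in> borel_measurable borel" by (intro borel_measurable_continuous_onI V)
  \<comment> \<open>Every coordinate is at most r in absolute value, so \<open>?P\<close> is at
    least (1 + r^2)^(-d). Used with r = |x| far out and with the fixed radius \<open>?R\<close>
    inside.\<close>
  have Plow: "1 \<le> (1 + r\<^sup>2) ^ ?d * ?P x" if "norm x \<le> r" for x r
  proof -
    have "1 = (\<Prod>b\<in>(Basis::'a set). (1 + (x \<bullet> b)\<^sup>2) * (1 / (1 + (x \<bullet> b)\<^sup>2)))"
      by (rule prod.neutral[symmetric]) (auto simp: add_nonneg_eq_0_iff)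
    also have "\<dots> = (\<Prod>b\<in>(Basis::'a set). 1 + (x \<bullet> b)\<^sup>2) * ?P x" by (rule prod.distrib)
    also have "\<dots> \<le> (\<Prod>b\<in>(Basis::'a set). 1 + r\<^sup>2) * ?P x"
    proof (intro mult_right_mono prod_mono conjI prod_nonneg)
      fix b :: 'a assume "b \<in> Basis"
      then have "\<bar>x \<bullet> b\<bar> \<le> r" using Basis_le_norm that order_trans by blast
      then show "1 + (x \<bullet> b)\<^sup>2 \<le> 1 + r\<^sup>2" by (metis abs_ge_zero add_left_mono power2_abs power_mono)
    qed auto
    finally show ?thesis by simp
  qed
  have P0: "?P x \<ge> 0" for x by (intro prod_nonneg) auto
  \<comment> \<open>From t^2 \<le> 2 exp t with t = (1 + V) / 2, which is the origin of 8 exp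
    (1/2).\<close>
  have e1: "exp (- V x) * (1 + V x)\<^sup>2 \<le> 8 * exp (1/2) * exp (- (V x / 2))" for x
  proof -
    have "((1 + V x) / 2)\<^sup>2 \<le> 2 * exp ((1 + V x) / 2)"
      using power_le_fact_mult_exp[of "(1 + V x) / 2" 2] V(2)[of x] by (simp add: fact_2)
    then have "(1 + V x)\<^sup>2 \<le> 8 * exp ((1 + V x) / 2)" by (simp add: power_divide)
    then have "exp (- V x) * (1 + V x)\<^sup>2 \<le> exp (- V x) * (8 * exp ((1 + V x) / 2))" by (intro mult_left_mono) auto
    also have "\<dots> = 8 * (exp (- V x) * exp ((1 + V x) / 2))" by simp
    also have "exp (- V x) * exp ((1 + V x) / 2) = exp (1/2) * exp (- (V x / 2))"
      by (simp add: exp_add[symmetric] field_simps)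
    finally show ?thesis by simp
  qed
  \<comment> \<open>With this n the bound n! / u^n of exp(-u) is at most a multiple of |x|^(-2d),
    which \<open>?P\<close> dominates for |x| > 1.\<close>
  obtain n :: nat where n: "real n * p \<ge> 2 * real ?d"
    using ex_less_of_nat_mult[OF p, of "2 * real ?d"] less_imp_le by blast
  define A where "A = 8 * exp (1/2) * exp (1 / (2 * C0)) * (fact n * (2 * C0) ^ n * 2 ^ ?d)"
  have A0: "A \<ge> 0" using C0 by (simp add: A_def)
  have out: "exp (- V x) * (1 + V x)\<^sup>2 \<le> A * ?P x" if x: "norm x > ?R" for x
  proof -
    define r where "r = norm x"
    have r: "r \<ge> 1" using x by (simp add: r_def)
    define u where "u = r powr p / (2 * C0)"
    have u: "u > 0" using r C0 by (simp add: u_def)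
    have "V x / 2 \<ge> u - 1 / (2 * C0)" using gr[of x] x C0 by (simp add: u_def r_def field_simps)
    then have "exp (- (V x / 2)) \<le> exp (1 / (2 * C0)) * exp (- u)" by (simp add: exp_add[symmetric])
    also have "exp (- u) \<le> fact n / u ^ n"
      using power_le_fact_mult_exp[of u n] u by (simp add: exp_minus field_simps)
    also have "fact n / u ^ n = fact n * (2 * C0) ^ n / (r powr p) ^ n" using C0 by (simp add: u_def power_divide)
    also have "(r powr p) ^ n = r powr (real n * p)" using r by (simp add: powr_power mult.commute)
    also have "fact n * (2 * C0) ^ n / r powr (real n * p) \<le> fact n * (2 * C0) ^ n / r ^ (2 * ?d)"
    proof (rule divide_left_mono)
      have "r ^ (2 * ?d) = r powr (2 * real ?d)" using r by (simp add: powr_realpow[symmetric])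
      also have "\<dots> \<le> r powr (real n * p)" using r n by (intro powr_mono) auto
      finally show "r ^ (2 * ?d) \<le> r powr (real n * p)" .
    qed (use r C0 in auto)
    also have "\<dots> \<le> fact n * (2 * C0) ^ n * 2 ^ ?d * ?P x"
    proof -
      have "1 \<le> (1 + r\<^sup>2) ^ ?d * ?P x" by (rule Plow) (simp add: r_def)
      also have "\<dots> \<le> (2 * r\<^sup>2) ^ ?d * ?P x" using r P0 by (intro mult_right_mono power_mono) auto
      finally have "1 \<le> 2 ^ ?d * r ^ (2 * ?d) * ?P x" by (simp add: power_mult_distrib power_mult)
      then have "1 / r ^ (2 * ?d) \<le> 2 ^ ?d * ?P x" using r by (simp add: field_simps)
      from mult_left_mono[OF this, of "fact n * (2 * C0) ^ n"] show ?thesis using C0 by simp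
    qed
    finally have e2: "exp (- (V x / 2)) \<le> exp (1 / (2 * C0)) * (fact n * (2 * C0) ^ n * 2 ^ ?d * ?P x)"
      by simp
    have "exp (- V x) * (1 + V x)\<^sup>2 \<le> 8 * exp (1/2) * (exp (1 / (2 * C0)) * (fact n * (2 * C0) ^ n * 2 ^ ?d * ?P x))"
      by (rule order_trans[OF e1 mult_left_mono[OF e2]]) simp
    then show ?thesis by (simp only: A_def mult.assoc)
  qed
  define D where "D = 8 * exp (1/2) * (1 + ?R\<^sup>2) ^ ?d"
  have D0: "D \<ge> 0" by (simp add: D_def)
  have inn: "exp (- V x) * (1 + V x)\<^sup>2 \<le> D * ?P x" if "norm x \<le> ?R" for x
  proof -
    have "exp (- V x) * (1 + V x)\<^sup>2 \<le> 8 * exp (1/2) * 1"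
      by (rule order_trans[OF e1]) (use V(2)[of x] in \<open>auto intro!: mult_left_mono\<close>)
    also have "\<dots> \<le> 8 * exp (1/2) * ((1 + ?R\<^sup>2) ^ ?d * ?P x)" using Plow[OF that] by (intro mult_left_mono) auto
    finally show ?thesis by (simp add: D_def mult.assoc)
  qed
  have "exp (- V x) * (1 + V x)\<^sup>2 \<le> (A + D) * ?P x" for x
    using inn[of x] out[of x] A0 D0 P0[of x] by (cases "norm x \<le> ?R") (auto simp: distrib_right not_le add_increasing add_increasing2)
  then show ?thesis
    by (intro Bochner_Integration.integrable_bound[OF integrable_mult_right[OF integrable_prod_inverse_1_plus_square, of "A + D"]])
       (auto intro!: AE_I2 order_trans[OF _ abs_ge_self])
qed

section \<open>Positivity of the interaction form\<close>

text \<open>The kernel k convolved with the signed measure h M. A general M treats the densities u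
  dx and the solution measures, where h = 1, by the same lemmas.\<close>

definition mconv :: "'a::euclidean_space measure \<Rightarrow> ('a \<Rightarrow> real) \<Rightarrow> ('a \<Rightarrow> real) \<Rightarrow> 'a \<Rightarrow> real" where
  "mconv M h k x = (\<integral>y. h y * k (x - y) \<partial>M)"

lemma mconv_integrable:
  fixes h k :: "'a::euclidean_space \<Rightarrow> real"
  assumes sM: "sets M = sets borel" and h: "integrable M h" and k: "continuous_on UNIV k" "\<And>x. \<bar>k x\<bar> \<le> L"
  shows "integrable M (\<lambda>y. h y * k (x - y))"
proof (rule Bochner_Integration.integrable_bound[of _ "\<lambda>y. h y * L"])
  show "integrable M (\<lambda>y. h y * L)" using h by simp
  have "(\<lambda>y. k (x - y)) \<in> borel_measurable borel"
    by (intro borel_measurable_continuous_onI continuous_on_compose2[OF k(1)] continuous_intros) auto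
  then have "(\<lambda>y. k (x - y)) \<in> borel_measurable M" using measurable_cong_sets[OF sM refl] by blast
  then show "(\<lambda>y. h y * k (x - y)) \<in> borel_measurable M" using h by simp
  have "0 \<le> L" using k(2)[of 0] by linarith
  then show "AE y in M. norm (h y * k (x - y)) \<le> norm (h y * L)"
    using k(2) by (intro AE_I2) (auto simp: abs_mult intro!: mult_left_mono)
qed

lemma mconv_bound:
  fixes h k :: "'a::euclidean_space \<Rightarrow> real"
  assumes sM: "sets M = sets borel" and h: "integrable M h" and k: "continuous_on UNIV k" "\<And>x. \<bar>k x\<bar> \<le> L"
  shows "\<bar>mconv M h k x\<bar> \<le> L * (\<integral>y. \<bar>h y\<bar> \<partial>M)"
proof -
  have "\<bar>mconv M h k x\<bar> \<le> (\<integral>y. L * \<bar>h y\<bar> \<partial>M)"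
    unfolding mconv_def
  proof (rule integral_abs_bound_integral[OF mconv_integrable[OF assms]])
    show "\<bar>h y * k (x - y)\<bar> \<le> L * \<bar>h y\<bar>" for y
      using mult_right_mono[OF k(2)[of "x - y"], of "\<bar>h y\<bar>"] by (simp add: abs_mult mult.commute)
  qed (use h in auto)
  then show ?thesis by simp
qed

lemma mconv_continuous:
  fixes h k :: "'a::euclidean_space \<Rightarrow> real"
  assumes sM: "sets M = sets borel" and h: "integrable M h" and k: "continuous_on UNIV k" "\<And>x. \<bar>k x\<bar> \<le> L"
  shows "continuous_on UNIV (mconv M h k)"
proof (rule continuous_on_sequentiallyI)
  fix X :: "nat \<Rightarrow> 'a" and a assume X: "X \<longlonglongrightarrow> a"
  show "(\<lambda>n. mconv M h k (X n)) \<longlonglongrightarrow> mconv M h k a"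
    unfolding mconv_def
  proof (rule integral_dominated_convergence[where w="\<lambda>y. L * \<bar>h y\<bar>"])
    show "integrable M (\<lambda>y. L * \<bar>h y\<bar>)" using h by simp
    show "AE y in M. (\<lambda>n. h y * k (X n - y)) \<longlonglongrightarrow> h y * k (a - y)"
    proof (intro AE_I2 tendsto_mult tendsto_const)
      fix y
      have "isCont k (a - y)" using k(1) by (simp add: continuous_on_eq_continuous_at)
      then show "(\<lambda>n. k (X n - y)) \<longlonglongrightarrow> k (a - y)"
        by (rule isCont_tendsto_compose) (intro tendsto_intros X)
    qed
    show "AE y in M. norm (h y * k (X n - y)) \<le> L * \<bar>h y\<bar>" for n
    proof (intro AE_I2)
      fix y
      show "norm (h y * k (X n - y)) \<le> L * \<bar>h y\<bar>"
        using mult_right_mono[OF k(2)[of "X n - y"], of "\<bar>h y\<bar>"] by (simp add: abs_mult mult.commute)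
    qed
  qed (use mconv_integrable[OF assms] in auto)
qed

lemma mconv_deriv:
  fixes h k :: "'a::euclidean_space \<Rightarrow> real"
  assumes sM: "sets M = sets borel" and h: "integrable M h" and k: "continuous_on UNIV k" "\<And>x. \<bar>k x\<bar> \<le> L"
    and kd: "k differentiable_on UNIV" and k': "continuous_on UNIV (pd b k)" "\<And>x. \<bar>pd b k x\<bar> \<le> L"
  shows "((\<lambda>s. mconv M h k (x + s *\<^sub>R b)) has_real_derivative mconv M h (pd b k) (x + s *\<^sub>R b)) (at s)"
  unfolding mconv_def
proof (rule has_real_derivative_integral[where g="\<lambda>y. L * \<bar>h y\<bar>" and S=UNIV])
  fix t y
  have "((\<lambda>t. k ((x - y) + t *\<^sub>R b)) has_real_derivative pd b k ((x - y) + t *\<^sub>R b)) (at t)"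
    by (rule has_real_derivative_pd_line[OF kd])
  then show "((\<lambda>t. h y * k (x + t *\<^sub>R b - y)) has_real_derivative h y * pd b k (x + t *\<^sub>R b - y)) (at t)"
    by (intro DERIV_cmult) (simp add: algebra_simps)
  show "\<bar>h y * pd b k (x + t *\<^sub>R b - y)\<bar> \<le> L * \<bar>h y\<bar>"
    using mult_right_mono[OF k'(2) abs_ge_zero, of "x + t *\<^sub>R b - y" "h y"] by (simp add: abs_mult mult.commute)
qed (use h mconv_integrable[OF sM h k] mconv_integrable[OF sM h k'] in auto)

lemma mconv_LIMSEQ:
  fixes h k :: "'a::euclidean_space \<Rightarrow> real"
  assumes sM: "sets M = sets borel" and h: "integrable M h" and k: "continuous_on UNIV k" "\<And>x. \<bar>k x\<bar> \<le> L"
    and hn: "\<And>n. h' n \<in> borel_measurable M" "\<And>n y. \<bar>h' n y\<bar> \<le> \<bar>h y\<bar>" "\<And>y. (\<lambda>n. h' n y) \<longlonglongrightarrow> h y"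
  shows "(\<lambda>n. mconv M (h' n) k x) \<longlonglongrightarrow> mconv M h k x"
  unfolding mconv_def
proof (rule integral_dominated_convergence[where w="\<lambda>y. L * \<bar>h y\<bar>"])
  show "AE y in M. (\<lambda>n. h' n y * k (x - y)) \<longlonglongrightarrow> h y * k (x - y)"
    by (intro AE_I2 tendsto_intros hn)
  have "0 \<le> L" using k(2)[of 0] by linarith
  show "AE y in M. norm (h' n y * k (x - y)) \<le> L * \<bar>h y\<bar>" for n
  proof (intro AE_I2)
    fix y
    have "\<bar>k (x - y)\<bar> * \<bar>h' n y\<bar> \<le> L * \<bar>h y\<bar>"
      by (intro mult_mono k hn \<open>0 \<le> L\<close>) auto
    then show "norm (h' n y * k (x - y)) \<le> L * \<bar>h y\<bar>" by (simp add: abs_mult mult.commute)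
  qed
  have "integrable M (h' n)" for n
    by (rule Bochner_Integration.integrable_bound[OF h hn(1)]) (use hn(2) in auto)
  from mconv_integrable[OF sM this k] show "(\<lambda>y. h' n y * k (x - y)) \<in> borel_measurable M" for n by auto
qed (use h mconv_integrable[OF sM h k] in auto)

lemma smooth_sum_Basis:
  fixes u :: "'a::euclidean_space \<Rightarrow> 'a \<Rightarrow> real"
  assumes "\<And>e. e \<in> Basis \<Longrightarrow> smooth (u e)"
  shows "smooth (\<lambda>x. \<Sum>e\<in>Basis. u e x *\<^sub>R e)"
proof (rule smooth_coinduct[of _ "{\<lambda>x. \<Sum>e\<in>Basis. u e x *\<^sub>R e |u. \<forall>e\<in>Basis. smooth (u e)}"])
  show "(\<lambda>x. \<Sum>e\<in>Basis. u e x *\<^sub>R e) \<in> {\<lambda>x. \<Sum>e\<in>Basis. u e x *\<^sub>R e |u. \<forall>e\<in>Basis. smooth (u e)}"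
    using assms by blast
  fix f :: "'a \<Rightarrow> 'a" assume "f \<in> {\<lambda>x. \<Sum>e\<in>Basis. u e x *\<^sub>R e |u. \<forall>e\<in>Basis. smooth (u e)}"
  then obtain u where u: "f = (\<lambda>x. \<Sum>e\<in>Basis. u e x *\<^sub>R e)" "\<And>e. e \<in> Basis \<Longrightarrow> smooth (u e)" by blast
  have d: "(f has_derivative (\<lambda>h. \<Sum>e\<in>Basis. frechet_derivative (u e) (at x) h *\<^sub>R e)) (at x)" for x
    unfolding u(1)
  proof (intro has_derivative_sum has_derivative_scaleR_left)
    show "(u e has_derivative frechet_derivative (u e) (at x)) (at x)" if "e \<in> Basis" for e
      using smooth_differentiable[OF u(2)[OF that]] frechet_derivative_works by (auto simp: differentiable_on_def)
  qed
  then show "f differentiable_on UNIV" by (auto simp: differentiable_on_def differentiable_def)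
  fix b :: 'a assume b: "b \<in> Basis"
  have "pd b f = (\<lambda>x. \<Sum>e\<in>Basis. pd b (u e) x *\<^sub>R e)"
    using pd_eqI[OF d] by (intro ext) (simp add: pd_def)
  then show "pd b f \<in> {\<lambda>x. \<Sum>e\<in>Basis. u e x *\<^sub>R e |u. \<forall>e\<in>Basis. smooth (u e)}"
    using smooth_pd[OF u(2) b] by (intro CollectI exI[of _ "\<lambda>e. pd b (u e)"]) simp
qed

lemma test_function_sum_Basis:
  fixes u :: "'a::euclidean_space \<Rightarrow> 'a \<Rightarrow> real"
  assumes "\<And>e. e \<in> Basis \<Longrightarrow> test_function (u e)" "\<And>e x. e \<in> Basis \<Longrightarrow> norm x > r \<Longrightarrow> u e x = 0"
  shows "test_function (\<lambda>x. \<Sum>e\<in>Basis. u e x *\<^sub>R e)"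
  by (rule test_functionI[OF smooth_sum_Basis, of _ r]) (use assms in \<open>auto simp: test_function_def intro!: sum.neutral\<close>)

locale positive_kernel =
  fixes K :: "'a::euclidean_space \<Rightarrow> real" and L :: real
  assumes K_cont: "continuous_on UNIV K" and K_bd: "\<And>x. \<bar>K x\<bar> \<le> L"
    and K_pos: "\<And>\<xi>::'a \<Rightarrow> 'a. test_function \<xi> \<Longrightarrow>
          (\<integral>x. conv (\<lambda>v c. c *\<^sub>R v) \<xi> K x \<bullet> \<xi> x \<partial>lborel) \<ge> 0"
begin

lemma K_pos_test_components:
  fixes u :: "'a \<Rightarrow> 'a \<Rightarrow> real"
  assumes u: "\<And>e. e \<in> Basis \<Longrightarrow> test_function (u e)" and supp: "\<And>e x. e \<in> Basis \<Longrightarrow> norm x > r \<Longrightarrow> u e x = 0"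
  shows "0 \<le> (\<Sum>e\<in>Basis. \<integral>x. u e x * mconv lborel (u e) K x \<partial>lborel)"
proof -
  let ?\<xi> = "\<lambda>x. \<Sum>e\<in>Basis. u e x *\<^sub>R e"
  have i: "integrable lborel (u e)" if "e \<in> Basis" for e using test_function_integrable[OF u[OF that]] .
  have c: "conv (\<lambda>v c. c *\<^sub>R v) ?\<xi> K x = (\<Sum>e\<in>Basis. mconv lborel (u e) K x *\<^sub>R e)" for x
  proof -
    have "conv (\<lambda>v c. c *\<^sub>R v) ?\<xi> K x = (\<integral>y. (\<Sum>e\<in>Basis. (u e y * K (x - y)) *\<^sub>R e) \<partial>lborel)"
      unfolding conv_def by (simp add: scaleR_sum_right mult.commute)
    also have "\<dots> = (\<Sum>e\<in>Basis. \<integral>y. (u e y * K (x - y)) *\<^sub>R e \<partial>lborel)"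
      using mconv_integrable[OF _ i K_cont K_bd] by (intro Bochner_Integration.integral_sum integrable_scaleR_left) auto
    also have "\<dots> = (\<Sum>e\<in>Basis. mconv lborel (u e) K x *\<^sub>R e)"
      unfolding mconv_def using mconv_integrable[OF _ i K_cont K_bd] by (intro sum.cong integral_scaleR_left) auto
    finally show ?thesis .
  qed
  have "0 \<le> (\<integral>x. conv (\<lambda>v c. c *\<^sub>R v) ?\<xi> K x \<bullet> ?\<xi> x \<partial>lborel)"
    by (rule K_pos[OF test_function_sum_Basis[OF u supp]])
  also have "\<dots> = (\<integral>x. (\<Sum>e\<in>Basis. u e x * mconv lborel (u e) K x) \<partial>lborel)"
    unfolding c by (simp add: inner_sum_left inner_sum_right inner_Basis if_distrib sum.delta mult.commute cong: if_cong)
  also have "\<dots> = (\<Sum>e\<in>Basis. \<integral>x. u e x * mconv lborel (u e) K x \<partial>lborel)"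
  proof (rule Bochner_Integration.integral_sum)
    fix e :: 'a assume e: "e \<in> Basis"
    have m: "mconv lborel (u e) K \<in> borel_measurable borel"
      by (intro borel_measurable_continuous_onI mconv_continuous[OF _ i[OF e] K_cont K_bd]) auto
    show "integrable lborel (\<lambda>x. u e x * mconv lborel (u e) K x)"
    proof (rule Bochner_Integration.integrable_bound[of _ "\<lambda>x. u e x * (L * (\<integral>y. \<bar>u e y\<bar> \<partial>lborel))"])
      show "integrable lborel (\<lambda>x. u e x * (L * (\<integral>y. \<bar>u e y\<bar> \<partial>lborel)))" using i[OF e] by simp
      have "\<bar>u e x\<bar> * \<bar>mconv lborel (u e) K x\<bar> \<le> \<bar>u e x\<bar> * \<bar>L * (\<integral>y. \<bar>u e y\<bar> \<partial>lborel)\<bar>" for x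
        by (intro mult_left_mono order_trans[OF mconv_bound[OF _ i[OF e] K_cont K_bd] abs_ge_self]) auto
      then show "AE x in lborel. norm (u e x * mconv lborel (u e) K x) \<le> norm (u e x * (L * (\<integral>y. \<bar>u e y\<bar> \<partial>lborel)))"
        by (simp add: abs_mult)
    qed (use m i[OF e] in auto)
  qed
  finally show ?thesis .
qed

text \<open>The hypothesis on \<open>K\<close> concerns smooth fields, while the field grad f + f
  grad V needed later is only continuous. Mollifying every component and dominated convergence in
  the double integral bridge the gap.\<close>

lemma K_pos_continuous_components:
  fixes u :: "'a \<Rightarrow> 'a \<Rightarrow> real"
  assumes u: "\<And>e. e \<in> Basis \<Longrightarrow> continuous_on UNIV (u e)" and supp: "\<And>e x. e \<in> Basis \<Longrightarrow> norm x > r \<Longrightarrow> u e x = 0"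
  shows "0 \<le> (\<Sum>e\<in>Basis. \<integral>x. u e x * mconv lborel (u e) K x \<partial>lborel)"
proof -
  define w where "w n e = conv (*) (u e) (bump n)" for n e
  have L: "0 \<le> L" using K_bd[of 0] by linarith
  have um: "u e \<in> borel_measurable borel" if "e \<in> Basis" for e
    by (intro borel_measurable_continuous_onI u that)
  have "(\<lambda>n. \<Sum>e\<in>Basis. \<integral>x. w n e x * mconv lborel (w n e) K x \<partial>lborel) \<longlonglongrightarrow>
    (\<Sum>e\<in>Basis. \<integral>x. u e x * mconv lborel (u e) K x \<partial>lborel)"
  proof (rule tendsto_sum)
    fix e :: 'a assume e: "e \<in> Basis"
    obtain B where B: "B > 0" "\<And>x. \<bar>u e x\<bar> \<le> B" using bounded_of_continuous_support[OF u[OF e] supp[OF e]] by blast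
    \<comment> \<open>One majorant for all mollifications: the bumps have radius at most 1, so all
      supports lie in the ball of radius r + 1.\<close>
    define h where "h x = B * indicator (cball 0 (r + 1)) x" for x :: 'a
    have hi: "integrable lborel h"
      unfolding h_def
      by (intro integrable_mult_right integrable_real_indicator) (use emeasure_bounded_finite[of "cball 0 (r+1)"] in auto)
    have h0: "h x \<ge> 0" for x using B by (simp add: h_def)
    have wB: "\<bar>w n e x\<bar> \<le> h x" for n x
    proof (cases "norm x > r + 1")
      case True
      have "conv (*) (u e) (bump n) x = 0"
        by (rule conv_test_function(2)[OF um[OF e] B(2) test_function_bump supp[OF e], of r "1 / Suc n"])
           (use True bump_support order_trans[of "r + 1 / Suc n" "r + 1"] in \<open>auto intro: le_less_trans[of _ "r + 1"]\<close>)
      then show ?thesis using h0 by (simp add: w_def)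
    next
      case False
      have "\<bar>conv (*) (u e) (bump n) x - 0\<bar> \<le> B"
        by (rule conv_close[OF um[OF e] B(2) test_function_integrable[OF test_function_bump] bump_nonneg integral_bump]) (use B in auto)
      then show ?thesis using False by (simp add: h_def w_def)
    qed
    have wc: "continuous_on UNIV (w n e)" for n
      unfolding w_def by (rule conv_continuous[OF um[OF e] B(2) test_function_bump])
    have wm: "w n e \<in> borel_measurable borel" for n by (intro borel_measurable_continuous_onI wc)
    have wi: "integrable lborel (w n e)" for n
      by (rule Bochner_Integration.integrable_bound[OF hi]) (use wm wB order_trans[OF wB abs_ge_self] in auto)
    have wl: "(\<lambda>n. w n e x) \<longlonglongrightarrow> u e x" for x
      unfolding w_def by (rule conv_bump_tendsto[OF u[OF e] B(2)])
    have uB: "\<bar>u e x\<bar> \<le> h x" for x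
      by (rule LIMSEQ_le_const2[OF tendsto_rabs[OF wl]]) (use wB in auto)
    have ui: "integrable lborel (u e)"
      by (rule Bochner_Integration.integrable_bound[OF hi]) (use um[OF e] order_trans[OF uB abs_ge_self] in auto)
    have ml: "(\<lambda>n. mconv lborel (w n e) K x) \<longlonglongrightarrow> mconv lborel (u e) K x" for x
      unfolding mconv_def
    proof (rule integral_dominated_convergence[where w="\<lambda>y. L * h y"])
      show "AE y in lborel. (\<lambda>n. w n e y * K (x - y)) \<longlonglongrightarrow> u e y * K (x - y)"
        by (intro AE_I2 tendsto_intros wl)
      show "AE y in lborel. norm (w n e y * K (x - y)) \<le> L * h y" for n
      proof (intro AE_I2)
        fix y
        have "\<bar>K (x - y)\<bar> * \<bar>w n e y\<bar> \<le> L * h y"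
          by (intro mult_mono K_bd wB L) auto
        then show "norm (w n e y * K (x - y)) \<le> L * h y" by (simp add: abs_mult mult.commute)
      qed
    qed (use hi mconv_integrable[OF _ wi K_cont K_bd] mconv_integrable[OF _ ui K_cont K_bd] in auto)
    define D where "D = L * (\<integral>y. h y \<partial>lborel)"
    have mb: "\<bar>mconv lborel (w n e) K x\<bar> \<le> D" for n x
    proof -
      have "\<bar>mconv lborel (w n e) K x\<bar> \<le> L * (\<integral>y. \<bar>w n e y\<bar> \<partial>lborel)"
        by (rule mconv_bound[OF _ wi K_cont K_bd]) auto
      also have "\<dots> \<le> D" unfolding D_def
        by (intro mult_left_mono integral_mono L) (use wi hi wB in auto)
      finally show ?thesis .
    qed
    have mm: "mconv lborel (w n e) K \<in> borel_measurable borel" for n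
      by (intro borel_measurable_continuous_onI mconv_continuous[OF _ wi K_cont K_bd]) auto
    have mu: "mconv lborel (u e) K \<in> borel_measurable borel"
      by (intro borel_measurable_continuous_onI mconv_continuous[OF _ ui K_cont K_bd]) auto
    show "(\<lambda>n. \<integral>x. w n e x * mconv lborel (w n e) K x \<partial>lborel) \<longlonglongrightarrow> (\<integral>x. u e x * mconv lborel (u e) K x \<partial>lborel)"
    proof (rule integral_dominated_convergence[where w="\<lambda>y. h y * D"])
      show "AE x in lborel. (\<lambda>n. w n e x * mconv lborel (w n e) K x) \<longlonglongrightarrow> u e x * mconv lborel (u e) K x"
        by (intro AE_I2 tendsto_intros wl ml)
      show "AE x in lborel. norm (w n e x * mconv lborel (w n e) K x) \<le> h x * D" for n
      proof (intro AE_I2)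
        fix x
        have "\<bar>w n e x\<bar> * \<bar>mconv lborel (w n e) K x\<bar> \<le> h x * D"
          by (intro mult_mono wB mb h0) auto
        then show "norm (w n e x * mconv lborel (w n e) K x) \<le> h x * D" by (simp add: abs_mult)
      qed
    qed (use hi wm mm mu um[OF e] in auto)
  qed
  moreover have "0 \<le> (\<Sum>e\<in>Basis. \<integral>x. w n e x * mconv lborel (w n e) K x \<partial>lborel)" for n
  proof (rule K_pos_test_components)
    fix e :: 'a assume e: "e \<in> Basis"
    obtain B where B: "B > 0" "\<And>x. \<bar>u e x\<bar> \<le> B" using bounded_of_continuous_support[OF u[OF e] supp[OF e]] by blast
    show "test_function (w n e)" unfolding w_def
      by (rule conv_test_function(1)[OF um[OF e] B(2) test_function_bump supp[OF e] bump_support])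
    show "w n e x = 0" if "norm x > r + 1 / Suc n" for x unfolding w_def
      by (rule conv_test_function(2)[OF um[OF e] B(2) test_function_bump supp[OF e] bump_support that])
  qed
  ultimately show ?thesis by (intro LIMSEQ_le_const[of _ _ 0]) auto
qed

end

section \<open>A continuously differentiable cutoff with a movable boundary\<close>

lemma max_0_power2_deriv: "((\<lambda>z. (max 0 z)\<^sup>2) has_real_derivative 2 * max 0 z) (at (z::real))"
proof -
  consider "z < 0" | "z = 0" | "z > 0" by linarith
  then show ?thesis
  proof cases
    case 1
    have "\<forall>\<^sub>F x in nhds z. (max 0 x)\<^sup>2 = 0"
      using eventually_nhds_in_open[of "{..<0}" z] 1 by (auto elim!: eventually_mono)
    then have "((\<lambda>z. (max 0 z)\<^sup>2) has_real_derivative 0) (at z) \<longleftrightarrow> ((\<lambda>_. 0) has_real_derivative 0) (at z)"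
      by (intro DERIV_cong_ev) auto
    then show ?thesis using 1 by simp
  next
    case 2
    have "((\<lambda>z. (max 0 z)\<^sup>2) has_derivative (\<lambda>h. 0)) (at (0::real))"
      unfolding has_derivative_at_alt
    proof (intro conjI allI impI)
      fix e :: real assume e: "e > 0"
      show "\<exists>d>0. \<forall>y::real. norm (y - 0) < d \<longrightarrow> norm ((max 0 y)\<^sup>2 - (max 0 0)\<^sup>2 - 0) \<le> e * norm (y - 0)"
      proof (intro exI[of _ e] conjI allI impI e)
        fix y :: real assume "norm (y - 0) < e"
        then have "\<bar>y\<bar> * \<bar>y\<bar> \<le> e * \<bar>y\<bar>" by (intro mult_right_mono) auto
        moreover have "0 \<le> e * \<bar>y\<bar>" using e by simp
        moreover have "(max 0 y)\<^sup>2 \<le> \<bar>y\<bar> * \<bar>y\<bar>" by (simp add: max_def power2_eq_square)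
        ultimately show "norm ((max 0 y)\<^sup>2 - (max 0 0)\<^sup>2 - 0) \<le> e * norm (y - 0)"
          by simp
      qed
    qed auto
    then show ?thesis using 2 by (simp add: has_field_derivative_def flip: lambda_zero)
  next
    case 3
    have "\<forall>\<^sub>F x in nhds z. (max 0 x)\<^sup>2 = x\<^sup>2"
      using eventually_nhds_in_open[of "{0<..}" z] 3 by (auto elim!: eventually_mono)
    then have "((\<lambda>z. (max 0 z)\<^sup>2) has_real_derivative 2 * max 0 z) (at z) \<longleftrightarrow> ((\<lambda>z. z\<^sup>2) has_real_derivative 2 * max 0 z) (at z)"
      by (intro DERIV_cong_ev) auto
    then show ?thesis using 3 by (auto intro!: derivative_eq_intros)
  qed
qed

text \<open>The Japanese bracket, a smooth substitute for |x|: it dominates |x|, and its gradient x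
  / \<open>jb\<close> has length below 1.\<close>

definition jb :: "'a::euclidean_space \<Rightarrow> real" where
  "jb x = sqrt (1 + x \<bullet> x)"

lemma jb_ge_1: "jb x \<ge> 1"
  by (simp add: jb_def)

lemma norm_le_jb: "norm x \<le> jb x"
  by (simp add: jb_def norm_eq_sqrt_inner)

lemma jb_deriv: "(jb has_derivative (\<lambda>h. (x \<bullet> h) / jb x)) (at x)"
proof -
  have "((\<lambda>x. sqrt (1 + x \<bullet> x)) has_derivative (\<lambda>h. (x \<bullet> h) / jb x)) (at x)"
    by (rule derivative_eq_intros refl | simp add: add_pos_nonneg)+
       (auto simp: jb_def inner_commute field_simps)
  then show ?thesis by (simp add: jb_def[abs_def])
qed

lemma jb_continuous: "continuous_on UNIV jb"
  unfolding jb_def by (intro continuous_intros)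

lemma abs_inner_div_jb_le: "\<bar>x \<bullet> h\<bar> / jb x \<le> norm h"
proof -
  have "\<bar>x \<bullet> h\<bar> \<le> norm x * norm h" by (rule Cauchy_Schwarz_ineq2)
  also have "\<dots> \<le> jb x * norm h" by (intro mult_right_mono norm_le_jb) auto
  finally show ?thesis using jb_ge_1[of x] by (simp add: divide_le_eq mult.commute)
qed

text \<open>Squaring the positive part makes the profile continuously differentiable, which the
  integrations by parts require. Increasing \<open>s\<close> moves the boundary inwards;
  \<open>s\<close> will carry the time dependence.\<close>

definition cutoff :: "real \<Rightarrow> real \<Rightarrow> 'a::euclidean_space \<Rightarrow> real" where
  "cutoff R s x = (max 0 (1 - (jb x + s) / R))\<^sup>2"

text \<open>The common factor of both derivatives of \<open>cutoff\<close>: the derivative in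
  \<open>s\<close> is minus this, the gradient is minus this times a vector of length below 1. A
  boundary that moves fast enough can therefore absorb the gradient term.\<close>

definition cutoff_slope :: "real \<Rightarrow> real \<Rightarrow> 'a::euclidean_space \<Rightarrow> real" where
  "cutoff_slope R s x = 2 * max 0 (1 - (jb x + s) / R) / R"

context
  fixes R :: real
  assumes R: "R > 0"
begin

lemma cutoff_nonneg: "0 \<le> cutoff R s x"
  by (simp add: cutoff_def)

lemma cutoff_le_1: "s \<ge> 0 \<Longrightarrow> cutoff R s x \<le> 1"
  using jb_ge_1[of x] R unfolding cutoff_def
  by (intro power_le_one) (auto simp: field_simps)

lemma cutoff_support:
  assumes "s \<ge> 0" "norm x > R"
  shows "cutoff R s x = 0"
proof -
  have "R \<le> jb x + s" using norm_le_jb[of x] assms by linarith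
  then have "1 - (jb x + s) / R \<le> 0" using R by (simp add: field_simps)
  then show ?thesis by (simp add: cutoff_def)
qed

lemma cutoff_slope_nonneg: "0 \<le> cutoff_slope R s x"
  using R by (simp add: cutoff_slope_def)

lemma cutoff_slope_le: "s \<ge> 0 \<Longrightarrow> cutoff_slope R s x \<le> 2 / R"
  using jb_ge_1[of x] R unfolding cutoff_slope_def by (auto simp: field_simps max_def)

lemma cutoff_slope_continuous: "continuous_on UNIV (cutoff_slope R s)"
  unfolding cutoff_slope_def by (intro continuous_intros jb_continuous) (use R in auto)

lemma cutoff_has_derivative: "(cutoff R s has_derivative (\<lambda>h. - cutoff_slope R s x * ((x \<bullet> h) / jb x))) (at x)"
proof -
  have "((\<lambda>x. 1 - (jb x + s) / R) has_derivative (\<lambda>h. - ((x \<bullet> h) / jb x) / R)) (at x)"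
    using R by (auto intro!: derivative_eq_intros jb_deriv)
  from has_derivative_compose[OF this max_0_power2_deriv[unfolded has_field_derivative_def]]
  show ?thesis by (simp add: cutoff_def[abs_def] cutoff_slope_def mult.commute)
qed

lemma cutoff_time_deriv: "((\<lambda>s. cutoff R s x) has_real_derivative - cutoff_slope R s x) (at s)"
proof -
  have "((\<lambda>s. 1 - (jb x + s) / R) has_real_derivative - 1 / R) (at s)"
    using R by (auto intro!: derivative_eq_intros)
  from DERIV_chain2[OF max_0_power2_deriv this]
  show ?thesis by (simp add: cutoff_def[abs_def] cutoff_slope_def)
qed

lemma cutoff_differentiable: "cutoff R s differentiable_on UNIV"
  unfolding differentiable_on_def using cutoff_has_derivative by (blast intro: differentiableI)

lemma cutoff_continuous: "continuous_on UNIV (cutoff R s)"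
  by (rule differentiable_imp_continuous_on[OF cutoff_differentiable])

lemma pd_cutoff: "pd e (cutoff R s) x = - cutoff_slope R s x * ((x \<bullet> e) / jb x)"
  using pd_eqI[OF cutoff_has_derivative] .

lemma pd_cutoff_continuous: "continuous_on UNIV (pd e (cutoff R s))"
proof -
  have "jb x \<noteq> 0" for x :: 'a using jb_ge_1[of x] by linarith
  then show ?thesis
    unfolding pd_cutoff[abs_def] by (intro continuous_intros jb_continuous cutoff_slope_continuous) auto
qed

end

lemma cutoff_tendsto: "(\<lambda>n. cutoff (real (Suc n)) s x) \<longlonglongrightarrow> 1"
proof -
  have "(\<lambda>n. (max 0 (1 - (jb x + s) / real (Suc n)))\<^sup>2) \<longlonglongrightarrow> (max 0 (1 - 0))\<^sup>2"
    by (intro tendsto_intros LIMSEQ_Suc[OF lim_const_over_n])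
  then show ?thesis by (simp add: cutoff_def)
qed

lemma continuous_imp_integrable_support:
  fixes f :: "'a::euclidean_space \<Rightarrow> real"
  assumes "continuous_on UNIV f" "\<And>x. norm x > r \<Longrightarrow> f x = 0"
  shows "integrable lborel f"
proof -
  obtain B where B: "B > 0" "\<And>x. \<bar>f x\<bar> \<le> B" using bounded_of_continuous_support[OF assms] by blast
  show ?thesis
    by (rule integrable_lborel_bounded_support[of f B r]) (use B assms borel_measurable_continuous_onI in auto)
qed

lemma integral_divergence_eq_0:
  fixes F D :: "'a::euclidean_space \<Rightarrow> real"
  assumes der: "\<And>x s. ((\<lambda>s. F (x + s *\<^sub>R e)) has_real_derivative D (x + s *\<^sub>R e)) (at s)"
    and F: "continuous_on UNIV F" and D: "continuous_on UNIV D" and supp: "\<And>x. norm x > r \<Longrightarrow> F x = 0"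
  shows "(\<integral>x. D x \<partial>lborel) = 0"
proof -
  have D0: "D x = 0" if "norm x > r" for x
    using has_real_derivative_locally_zero[of F x e D r] der supp that by blast
  obtain B where B: "B > 0" "\<And>x. \<bar>D x\<bar> \<le> B" using bounded_of_continuous_support[OF D D0] by blast
  show ?thesis
    by (rule integral_directional_derivative_eq_0[OF der _ _ continuous_imp_integrable_support[OF F supp] B(2) supp])
       (use F D borel_measurable_continuous_onI in auto)
qed

lemma pd_mult:
  fixes f g :: "'a::euclidean_space \<Rightarrow> real"
  assumes "f differentiable_on UNIV" "g differentiable_on UNIV"
  shows "pd e (\<lambda>x. f x * g x) = (\<lambda>x. f x * pd e g x + pd e f x * g x)"
proof
  fix x
  have "f differentiable at x" "g differentiable at x" using assms by (auto simp: differentiable_on_def)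
  then have "((\<lambda>x. f x * g x) has_derivative (\<lambda>h. f x * frechet_derivative g (at x) h + frechet_derivative f (at x) h * g x)) (at x)"
    by (intro has_derivative_mult) (auto simp: frechet_derivative_works[symmetric])
  from pd_eqI[OF this] show "pd e (\<lambda>x. f x * g x) x = f x * pd e g x + pd e f x * g x" by (simp add: pd_def)
qed

section \<open>The nonlocal field and the sign of its energy\<close>

locale stein_setting = positive_kernel K L for K :: "'a::euclidean_space \<Rightarrow> real" and L +
  fixes V :: "'a \<Rightarrow> real" and c :: real
  assumes K_diff: "K differentiable_on UNIV" and K1_diff: "\<And>e. e \<in> Basis \<Longrightarrow> pd e K differentiable_on UNIV"
    and K1_bd: "\<And>e x. e \<in> Basis \<Longrightarrow> \<bar>pd e K x\<bar> \<le> L"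
    and K2_bd: "\<And>e f x. e \<in> Basis \<Longrightarrow> f \<in> Basis \<Longrightarrow> \<bar>pd f (pd e K) x\<bar> \<le> L"
    and K2_lip: "\<And>e f x y. e \<in> Basis \<Longrightarrow> f \<in> Basis \<Longrightarrow> \<bar>pd f (pd e K) x - pd f (pd e K) y\<bar> \<le> L * norm (x - y)"
    and V_smooth: "smooth V" and V_nonneg: "\<And>x. V x \<ge> 0" and c_nonneg: "c \<ge> 0"
    and V1_bd: "\<And>e x. e \<in> Basis \<Longrightarrow> \<bar>pd e V x\<bar> \<le> c * (1 + V x)"
    and V2_bd: "\<And>e b x. e \<in> Basis \<Longrightarrow> b \<in> Basis \<Longrightarrow> \<bar>pd b (pd e V) x\<bar> \<le> c * (1 + V x)"
    and V_int: "integrable lborel (\<lambda>x. exp (- V x) * (1 + V x)\<^sup>2)"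
    and KV1: "\<And>x. BL_norm (\<lambda>y. ((1 / (1 + V y)) *\<^sub>R grad V x) \<bullet> grad K (x - y)) \<le> ereal c"
    and KV2: "\<And>x. BL_norm (\<lambda>y. (grad V x \<bullet> grad V y) / (1 + V y) * K (x - y)) \<le> ereal c"
begin

lemma L_nonneg: "0 \<le> L" using K_bd[of 0] by linarith

lemma K1_cont: "e \<in> Basis \<Longrightarrow> continuous_on UNIV (pd e K)"
  using K1_diff differentiable_imp_continuous_on by blast

lemma K2_cont: "e \<in> Basis \<Longrightarrow> f \<in> Basis \<Longrightarrow> continuous_on UNIV (pd f (pd e K))"
  by (rule lipschitz_imp_continuous[OF K2_lip])

lemma V_cont: "continuous_on UNIV V"
  using V_smooth smooth_continuous by blast

lemma V1_cont: "e \<in> Basis \<Longrightarrow> continuous_on UNIV (pd e V)"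
  using V_smooth smooth_continuous smooth_pd by blast

text \<open>
  \<open>fld f M e\<close> is the component in direction \<open>e\<close> of \<open>U = K * (\<nabla>(f M) + f M \<nabla>V)\<close>, with the derivative of \<open>f M\<close>
  moved to \<open>K\<close>; \<open>dfld f M e\<close> is its derivative in direction \<open>e\<close>, and \<open>dvg f M\<close> is \<open>div U - \<nabla>V \<bullet> U\<close>.
\<close>

definition fld :: "('a \<Rightarrow> real) \<Rightarrow> 'a measure \<Rightarrow> 'a \<Rightarrow> 'a \<Rightarrow> real" where
  "fld f M e x = mconv M f (pd e K) x + mconv M (\<lambda>y. f y * pd e V y) K x"

definition dfld :: "('a \<Rightarrow> real) \<Rightarrow> 'a measure \<Rightarrow> 'a \<Rightarrow> 'a \<Rightarrow> real" where
  "dfld f M e x = mconv M f (pd e (pd e K)) x + mconv M (\<lambda>y. f y * pd e V y) (pd e K) x"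

definition dvg :: "('a \<Rightarrow> real) \<Rightarrow> 'a measure \<Rightarrow> 'a \<Rightarrow> real" where
  "dvg f M x = (\<Sum>e\<in>Basis. dfld f M e x - pd e V x * fld f M e x)"

definition adm :: "('a \<Rightarrow> real) \<Rightarrow> 'a measure \<Rightarrow> bool" where
  "adm f M \<longleftrightarrow> sets M = sets borel \<and> integrable M f \<and> (\<forall>e\<in>Basis. integrable M (\<lambda>y. f y * pd e V y))"

text \<open>An L^1 size of the data that bounds \<open>fld\<close> and \<open>dfld\<close> uniformly
  in x. In \<open>dvg\<close> only the factor grad V(x) grows, which is what the weight
  \<open>V1_sum\<close> accounts for.\<close>

definition mass :: "('a \<Rightarrow> real) \<Rightarrow> 'a measure \<Rightarrow> real" where
  "mass f M = L * ((\<integral>y. \<bar>f y\<bar> \<partial>M) + (\<Sum>e\<in>Basis. \<integral>y. \<bar>f y * pd e V y\<bar> \<partial>M))"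

definition V1_sum :: "'a \<Rightarrow> real" where
  "V1_sum x = 1 + (\<Sum>e\<in>Basis. \<bar>pd e V x\<bar>)"

context
  fixes f :: "'a \<Rightarrow> real" and M :: "'a measure"
  assumes f: "adm f M"
begin

lemma adm_simps: "sets M = sets borel" "integrable M f" "e \<in> Basis \<Longrightarrow> integrable M (\<lambda>y. f y * pd e V y)"
  using f by (auto simp: adm_def)

lemma fld_deriv:
  assumes "e \<in> Basis"
  shows "((\<lambda>s. fld f M e (x + s *\<^sub>R e)) has_real_derivative dfld f M e (x + s *\<^sub>R e)) (at s)"
  unfolding fld_def dfld_def
  by (intro DERIV_add mconv_deriv[OF adm_simps(1,2) K1_cont K1_bd K1_diff K2_cont K2_bd]
      mconv_deriv[OF adm_simps(1,3) K_cont K_bd K_diff K1_cont K1_bd] assms)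

lemma fld_continuous: "e \<in> Basis \<Longrightarrow> continuous_on UNIV (fld f M e)"
  unfolding fld_def
  by (intro continuous_on_add mconv_continuous[OF adm_simps(1,2) K1_cont K1_bd]
      mconv_continuous[OF adm_simps(1,3) K_cont K_bd])

lemma dfld_continuous: "e \<in> Basis \<Longrightarrow> continuous_on UNIV (dfld f M e)"
  unfolding dfld_def
  by (intro continuous_on_add mconv_continuous[OF adm_simps(1,2) K2_cont K2_bd]
      mconv_continuous[OF adm_simps(1,3) K1_cont K1_bd])

lemma dvg_continuous: "continuous_on UNIV (dvg f M)"
  unfolding dvg_def by (intro continuous_intros fld_continuous dfld_continuous V1_cont)

lemma fld_bound:
  assumes e: "e \<in> Basis"
  shows "\<bar>fld f M e x\<bar> \<le> mass f M" "\<bar>dfld f M e x\<bar> \<le> mass f M"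
proof -
  have "(\<integral>y. \<bar>f y * pd e V y\<bar> \<partial>M) \<le> (\<Sum>e\<in>Basis. \<integral>y. \<bar>f y * pd e V y\<bar> \<partial>M)"
    using e by (intro member_le_sum) auto
  then have 1: "L * (\<integral>y. \<bar>f y\<bar> \<partial>M) + L * (\<integral>y. \<bar>f y * pd e V y\<bar> \<partial>M) \<le> mass f M"
    unfolding mass_def distrib_left[symmetric] by (intro mult_left_mono L_nonneg) auto
  show "\<bar>fld f M e x\<bar> \<le> mass f M"
    using mconv_bound[OF adm_simps(1,2) K1_cont[OF e] K1_bd[OF e], of x]
      mconv_bound[OF adm_simps(1) adm_simps(3)[OF e] K_cont K_bd, of x] 1 unfolding fld_def by linarith
  show "\<bar>dfld f M e x\<bar> \<le> mass f M"
    using mconv_bound[OF adm_simps(1,2) K2_cont[OF e e] K2_bd[OF e e], of x]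
      mconv_bound[OF adm_simps(1) adm_simps(3)[OF e] K1_cont[OF e] K1_bd[OF e], of x] 1 unfolding dfld_def by linarith
qed

lemma mass_nonneg: "0 \<le> mass f M"
  unfolding mass_def using L_nonneg by (intro mult_nonneg_nonneg add_nonneg_nonneg sum_nonneg) auto

lemma dvg_bound: "\<bar>dvg f M x\<bar> \<le> real DIM('a) * mass f M * V1_sum x"
proof -
  have "\<bar>dvg f M x\<bar> \<le> (\<Sum>e\<in>Basis. \<bar>dfld f M e x - pd e V x * fld f M e x\<bar>)"
    unfolding dvg_def by (rule sum_abs)
  also have "\<dots> \<le> (\<Sum>e\<in>(Basis::'a set). mass f M * V1_sum x)"
  proof (rule sum_mono)
    fix e :: 'a assume e: "e \<in> Basis"
    have "\<bar>dfld f M e x - pd e V x * fld f M e x\<bar> \<le> \<bar>dfld f M e x\<bar> + \<bar>pd e V x\<bar> * \<bar>fld f M e x\<bar>"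
      by (metis abs_mult abs_triangle_ineq4)
    also have "\<dots> \<le> mass f M + \<bar>pd e V x\<bar> * mass f M"
      by (intro add_mono mult_left_mono fld_bound e) auto
    also have "\<dots> = mass f M * (1 + \<bar>pd e V x\<bar>)" by (simp add: algebra_simps)
    also have "\<dots> \<le> mass f M * V1_sum x"
      unfolding V1_sum_def using e by (intro mult_left_mono add_left_mono member_le_sum mass_nonneg) auto
    finally show "\<bar>dfld f M e x - pd e V x * fld f M e x\<bar> \<le> mass f M * V1_sum x" .
  qed
  finally show ?thesis by simp
qed

lemma integrable_mult_V1_sum: "integrable M (\<lambda>y. \<bar>f y\<bar> * V1_sum y)"
  unfolding V1_sum_def distrib_left sum_distrib_left
  using adm_simps by (intro Bochner_Integration.integrable_add Bochner_Integration.integrable_sum)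
    (auto simp: abs_mult[symmetric])

end

text \<open>Two integrations by parts. In y: \<open>fld\<close> is \<open>K\<close> convolved with u
  = grad f + f grad V. In x: pairing this field with u gives minus the integral of f times
  \<open>dvg f\<close>. The pairing is the quadratic form of \<open>K\<close> at the continuous
  field u, hence nonnegative.\<close>

lemma integral_dvg_nonpos_compact:
  assumes fd: "f differentiable_on UNIV" and fc: "\<And>e. e \<in> Basis \<Longrightarrow> continuous_on UNIV (pd e f)"
    and supp: "\<And>x. norm x > r \<Longrightarrow> f x = 0"
  shows "(\<integral>x. f x * dvg f lborel x \<partial>lborel) \<le> 0"
proof -
  have fcont: "continuous_on UNIV f" by (rule differentiable_imp_continuous_on[OF fd])
  have adm: "adm f lborel"
    unfolding adm_def
    by (auto intro!: continuous_imp_integrable_support[of _ r] continuous_intros fcont V1_cont simp: supp)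
  define u where "u e x = pd e f x + f x * pd e V x" for e x
  have lf: "((\<lambda>s. f (x + s *\<^sub>R e)) has_real_derivative pd e f (x + s *\<^sub>R e)) (at s)" for x e s
    by (rule has_real_derivative_pd_line[OF fd])
  have f1: "pd e f x = 0" if "norm x > r" for e x
    using has_real_derivative_locally_zero[of f x e "pd e f" r] lf supp that by blast
  have c1: "mconv lborel (u e) K x = fld f lborel e x" if e: "e \<in> Basis" for e x
  proof -
    have cK: "continuous_on UNIV (\<lambda>y. K (x - y))" "continuous_on UNIV (\<lambda>y. pd e K (x - y))"
      by (rule continuous_on_compose2[OF K_cont] continuous_on_compose2[OF K1_cont[OF e]]; auto intro!: continuous_intros)+
    \<comment> \<open>The derivative moves from the kernel to f; the minus sign comes from
      differentiating K(x - y) in y.\<close>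
    have 0: "(\<integral>y. f y * - pd e K (x - y) + pd e f y * K (x - y) \<partial>lborel) = 0"
    proof (rule integral_divergence_eq_0[where F="\<lambda>y. f y * K (x - y)" and e=e and r=r])
      fix y s
      have "((\<lambda>s. 1 * K (x - (y + s *\<^sub>R e))) has_real_derivative - 1 * (grad K (x - (y + s *\<^sub>R e)) \<bullet> e)) (at s)"
        by (rule has_derivative_along_line[OF has_derivative_reflect[OF K_diff]])
      then have "((\<lambda>s. K (x - (y + s *\<^sub>R e))) has_real_derivative - pd e K (x - (y + s *\<^sub>R e))) (at s)"
        using e by (simp add: grad_inner_Basis)
      from DERIV_mult'[OF lf this]
      show "((\<lambda>s. f (y + s *\<^sub>R e) * K (x - (y + s *\<^sub>R e))) has_real_derivative
        f (y + s *\<^sub>R e) * - pd e K (x - (y + s *\<^sub>R e)) + pd e f (y + s *\<^sub>R e) * K (x - (y + s *\<^sub>R e))) (at s)" .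
    qed (auto intro!: continuous_intros fcont fc e cK simp: supp)
    have i1: "integrable lborel (\<lambda>y. f y * pd e K (x - y))"
      by (rule mconv_integrable[OF _ adm_simps(2)[OF adm] K1_cont[OF e] K1_bd[OF e]]) auto
    have i2: "integrable lborel (\<lambda>y. pd e f y * K (x - y))"
      by (rule continuous_imp_integrable_support[of _ r]) (auto intro!: continuous_intros fc e cK simp: f1)
    have i3: "integrable lborel (\<lambda>y. f y * pd e V y * K (x - y))"
      by (rule mconv_integrable[OF _ adm_simps(3)[OF adm e] K_cont K_bd]) auto
    have "mconv lborel (u e) K x = (\<integral>y. pd e f y * K (x - y) + f y * pd e V y * K (x - y) \<partial>lborel)"
      unfolding mconv_def u_def by (simp add: distrib_right)
    also have "\<dots> = (\<integral>y. pd e f y * K (x - y) \<partial>lborel) + mconv lborel (\<lambda>y. f y * pd e V y) K x"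
      unfolding mconv_def using i2 i3 by simp
    also have "(\<integral>y. pd e f y * K (x - y) \<partial>lborel) = mconv lborel f (pd e K) x"
      using 0 i1 i2 unfolding mconv_def by simp
    finally show ?thesis by (simp add: fld_def)
  qed
  have c2: "(\<integral>x. u e x * fld f lborel e x \<partial>lborel) = - (\<integral>x. f x * (dfld f lborel e x - pd e V x * fld f lborel e x) \<partial>lborel)"
    and i5: "integrable lborel (\<lambda>x. f x * (dfld f lborel e x - pd e V x * fld f lborel e x))"
    if e: "e \<in> Basis" for e
  proof -
    \<comment> \<open>The term f grad V in u is not touched by this integration by parts; it
      supplies the part - grad V . U of \<open>dvg\<close>.\<close>
    have 0: "(\<integral>x. f x * dfld f lborel e x + pd e f x * fld f lborel e x \<partial>lborel) = 0"
    proof (rule integral_divergence_eq_0[where F="\<lambda>y. f y * fld f lborel e y" and e=e and r=r])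
      fix y s
      show "((\<lambda>s. f (y + s *\<^sub>R e) * fld f lborel e (y + s *\<^sub>R e)) has_real_derivative
        f (y + s *\<^sub>R e) * dfld f lborel e (y + s *\<^sub>R e) + pd e f (y + s *\<^sub>R e) * fld f lborel e (y + s *\<^sub>R e)) (at s)"
        by (rule DERIV_mult'[OF lf fld_deriv[OF adm e]])
    qed (auto intro!: continuous_intros fcont fc e fld_continuous[OF adm] dfld_continuous[OF adm] simp: supp)
    have i4: "integrable lborel (\<lambda>x. u e x * fld f lborel e x)"
      unfolding u_def by (rule continuous_imp_integrable_support[of _ r])
        (auto intro!: continuous_intros fc fcont V1_cont e fld_continuous[OF adm] simp: f1 supp)
    show i5: "integrable lborel (\<lambda>x. f x * (dfld f lborel e x - pd e V x * fld f lborel e x))"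
      by (rule continuous_imp_integrable_support[of _ r])
        (auto intro!: continuous_intros fc fcont V1_cont e fld_continuous[OF adm] dfld_continuous[OF adm] simp: f1 supp)
    have "(\<integral>x. u e x * fld f lborel e x \<partial>lborel) + (\<integral>x. f x * (dfld f lborel e x - pd e V x * fld f lborel e x) \<partial>lborel)
      = (\<integral>x. u e x * fld f lborel e x + f x * (dfld f lborel e x - pd e V x * fld f lborel e x) \<partial>lborel)"
      using i4 i5 by simp
    also have "\<dots> = (\<integral>x. f x * dfld f lborel e x + pd e f x * fld f lborel e x \<partial>lborel)"
      by (intro Bochner_Integration.integral_cong) (auto simp: u_def algebra_simps)
    finally show "(\<integral>x. u e x * fld f lborel e x \<partial>lborel) = - (\<integral>x. f x * (dfld f lborel e x - pd e V x * fld f lborel e x) \<partial>lborel)"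
      using 0 by simp
  qed
  have "0 \<le> (\<Sum>e\<in>Basis. \<integral>x. u e x * mconv lborel (u e) K x \<partial>lborel)"
    by (rule K_pos_continuous_components[of _ r])
       (auto intro!: continuous_intros fc fcont V1_cont simp: u_def f1 supp)
  also have "\<dots> = (\<Sum>e\<in>Basis. - (\<integral>x. f x * (dfld f lborel e x - pd e V x * fld f lborel e x) \<partial>lborel))"
    by (intro sum.cong refl) (simp add: c1 c2)
  also have "\<dots> = - (\<integral>x. (\<Sum>e\<in>Basis. f x * (dfld f lborel e x - pd e V x * fld f lborel e x)) \<partial>lborel)"
    using i5 by (simp add: Bochner_Integration.integral_sum sum_negf)
  also have "\<dots> = - (\<integral>x. f x * dvg f lborel x \<partial>lborel)"
    by (simp add: dvg_def sum_distrib_left)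
  finally show ?thesis by simp
qed

text \<open>Cutting off f itself puts the cutoff on both sides of the form, so each truncation falls
  under the compact case. Integrability of f and f grad V is enough for the limit.\<close>

lemma integral_dvg_nonpos:
  assumes fd: "f differentiable_on UNIV" and fc: "\<And>e. e \<in> Basis \<Longrightarrow> continuous_on UNIV (pd e f)"
    and adm: "adm f lborel"
  shows "(\<integral>x. f x * dvg f lborel x \<partial>lborel) \<le> 0"
proof -
  have fcont: "continuous_on UNIV f" by (rule differentiable_imp_continuous_on[OF fd])
  define g where "g n x = cutoff (real (Suc n)) 0 x * f x" for n x
  have gle: "\<bar>g n x\<bar> \<le> \<bar>f x\<bar>" for n x
    using cutoff_nonneg[of "real (Suc n)" 0 x] cutoff_le_1[of "real (Suc n)" 0 x]
    by (auto simp: g_def abs_mult mult_left_le_one_le)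
  have gl: "(\<lambda>n. g n x) \<longlonglongrightarrow> f x" for x
    using tendsto_mult[OF cutoff_tendsto tendsto_const, of 0 x "f x"] by (simp add: g_def)
  have gd: "g n differentiable_on UNIV" for n
    unfolding g_def[abs_def] by (intro derivative_intros differentiable_on_mult cutoff_differentiable fd) auto
  have g1: "continuous_on UNIV (pd e (g n))" if "e \<in> Basis" for e n
    unfolding g_def[abs_def] using cutoff_differentiable[of "real (Suc n)" 0] fd
    by (subst pd_mult) (auto intro!: continuous_intros pd_cutoff_continuous fc that fcont cutoff_continuous)
  have gc: "continuous_on UNIV (g n)" for n by (rule differentiable_imp_continuous_on[OF gd])
  have gm: "g n \<in> borel_measurable borel" for n by (intro borel_measurable_continuous_onI gc)
  have V1m: "pd e V \<in> borel_measurable borel" if "e \<in> Basis" for e by (intro borel_measurable_continuous_onI V1_cont that)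
  have gVle: "\<bar>g n y * pd e V y\<bar> \<le> \<bar>f y * pd e V y\<bar>" for n y e
    using gle by (simp add: abs_mult mult_right_mono)
  have gVl: "(\<lambda>n. g n y * pd e V y) \<longlonglongrightarrow> f y * pd e V y" for y e by (intro tendsto_intros gl)
  have admg: "adm (g n) lborel" for n
    unfolding adm_def
  proof (intro conjI ballI)
    show "integrable lborel (g n)"
      by (rule Bochner_Integration.integrable_bound[OF adm_simps(2)[OF adm]]) (use gm gle in auto)
    show "integrable lborel (\<lambda>y. g n y * pd e V y)" if e: "e \<in> Basis" for e
      by (rule Bochner_Integration.integrable_bound[OF adm_simps(3)[OF adm e]]) (use gm gVle V1m[OF e] in auto)
  qed auto
  \<comment> \<open>Truncation only lowers the masses, so \<open>dvg_bound\<close> yields one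
    majorant for all n.\<close>
  have mass: "mass (g n) lborel \<le> mass f lborel" for n
    unfolding mass_def
    by (intro mult_left_mono add_mono sum_mono integral_mono L_nonneg)
       (use adm_simps[OF adm] adm_simps[OF admg] gle gVle in auto)
  have lim: "(\<lambda>n. dvg (g n) lborel x) \<longlonglongrightarrow> dvg f lborel x" for x
    unfolding dvg_def fld_def dfld_def
    by (intro tendsto_intros mconv_LIMSEQ[where h=f and L=L] mconv_LIMSEQ[where h="\<lambda>y. f y * pd _ V y" and L=L]
        adm_simps[OF adm] K_cont K_bd K1_cont K1_bd K2_cont K2_bd gl gle gVle gVl)
       (use gm V1m in auto)
  have "(\<lambda>n. \<integral>x. g n x * dvg (g n) lborel x \<partial>lborel) \<longlonglongrightarrow> (\<integral>x. f x * dvg f lborel x \<partial>lborel)"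
  proof (rule integral_dominated_convergence[where w="\<lambda>x. real DIM('a) * mass f lborel * (\<bar>f x\<bar> * V1_sum x)"])
    show "integrable lborel (\<lambda>x. real DIM('a) * mass f lborel * (\<bar>f x\<bar> * V1_sum x))"
      using integrable_mult_V1_sum[OF adm] by simp
    show "AE x in lborel. (\<lambda>n. g n x * dvg (g n) lborel x) \<longlonglongrightarrow> f x * dvg f lborel x"
      by (intro AE_I2 tendsto_intros gl lim)
    show "AE x in lborel. norm (g n x * dvg (g n) lborel x) \<le> real DIM('a) * mass f lborel * (\<bar>f x\<bar> * V1_sum x)" for n
    proof (intro AE_I2)
      fix x
      have V: "V1_sum x \<ge> 0" by (simp add: V1_sum_def sum_nonneg add_nonneg_nonneg)
      have "\<bar>dvg (g n) lborel x\<bar> \<le> real DIM('a) * mass f lborel * V1_sum x"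
        by (rule order_trans[OF dvg_bound[OF admg]]) (intro mult_right_mono mult_left_mono mass V, auto)
      then have "\<bar>g n x\<bar> * \<bar>dvg (g n) lborel x\<bar> \<le> \<bar>f x\<bar> * (real DIM('a) * mass f lborel * V1_sum x)"
        by (intro mult_mono gle) auto
      then show "norm (g n x * dvg (g n) lborel x) \<le> real DIM('a) * mass f lborel * (\<bar>f x\<bar> * V1_sum x)"
        by (simp add: abs_mult ac_simps)
    qed
    show "(\<lambda>x. f x * dvg f lborel x) \<in> borel_measurable lborel" "(\<lambda>x. g n x * dvg (g n) lborel x) \<in> borel_measurable lborel" for n
      using borel_measurable_continuous_onI[OF continuous_on_mult[OF fcont dvg_continuous[OF adm]]]
        borel_measurable_continuous_onI[OF continuous_on_mult[OF gc dvg_continuous[OF admg]]] by auto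
  qed
  moreover have "(\<integral>x. g n x * dvg (g n) lborel x \<partial>lborel) \<le> 0" for n
    by (rule integral_dvg_nonpos_compact[where r="real (Suc n)", OF gd g1]) (auto simp: g_def cutoff_support)
  ultimately show ?thesis by (intro LIMSEQ_le_const2[of _ _ 0]) auto
qed

end

section \<open>The dual norm and the divergence of the drift\<close>

text \<open>A pointwise, real-valued form of a bound on \<open>BL_norm\<close>, convenient for
  computing constants of sums and products.\<close>

definition bounded_lip :: "real \<Rightarrow> ('a::euclidean_space \<Rightarrow> real) \<Rightarrow> bool" where
  "bounded_lip C f \<longleftrightarrow> (\<forall>x. \<bar>f x\<bar> \<le> C) \<and> (\<forall>x y. \<bar>f x - f y\<bar> \<le> C * norm (x - y))"

lemma bounded_lip_nonneg: "bounded_lip C f \<Longrightarrow> 0 \<le> C"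
  unfolding bounded_lip_def by (meson abs_ge_zero order_trans)

lemma bounded_lip_add:
  assumes "bounded_lip A f" "bounded_lip B g"
  shows "bounded_lip (A + B) (\<lambda>x. f x + g x)"
  unfolding bounded_lip_def
proof (intro conjI allI)
  fix x y
  show "\<bar>f x + g x\<bar> \<le> A + B"
    using assms unfolding bounded_lip_def by (intro order_trans[OF abs_triangle_ineq] add_mono) auto
  have "\<bar>(f x - f y) + (g x - g y)\<bar> \<le> A * norm (x - y) + B * norm (x - y)"
    using assms unfolding bounded_lip_def by (intro order_trans[OF abs_triangle_ineq] add_mono) auto
  then show "\<bar>f x + g x - (f y + g y)\<bar> \<le> (A + B) * norm (x - y)" by (simp add: algebra_simps)
qed

lemma bounded_lip_minus: "bounded_lip A f \<Longrightarrow> bounded_lip A (\<lambda>x. - f x)"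
  unfolding bounded_lip_def by (auto simp: abs_minus_commute)

lemma bounded_lip_diff:
  assumes "bounded_lip A f" "bounded_lip B g"
  shows "bounded_lip (A + B) (\<lambda>x. f x - g x)"
  using bounded_lip_add[OF assms(1) bounded_lip_minus[OF assms(2)]] by simp

lemma bounded_lip_mult:
  assumes f: "bounded_lip A f" and g: "bounded_lip B g"
  shows "bounded_lip (2 * A * B) (\<lambda>x. f x * g x)"
  unfolding bounded_lip_def
proof (intro conjI allI)
  fix x y
  have A: "0 \<le> A" and B: "0 \<le> B" using assms bounded_lip_nonneg by auto
  have "\<bar>f x\<bar> * \<bar>g x\<bar> \<le> A * B" using f g A unfolding bounded_lip_def by (intro mult_mono) auto
  moreover have "0 \<le> A * B" using A B by simp
  ultimately show "\<bar>f x * g x\<bar> \<le> 2 * A * B" unfolding abs_mult by linarith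
  have "\<bar>f x * g x - f y * g y\<bar> = \<bar>f x * (g x - g y) + (f x - f y) * g y\<bar>" by (simp add: algebra_simps)
  also have "\<dots> \<le> \<bar>f x\<bar> * \<bar>g x - g y\<bar> + \<bar>f x - f y\<bar> * \<bar>g y\<bar>"
    by (metis abs_mult abs_triangle_ineq)
  also have "\<dots> \<le> A * (B * norm (x - y)) + (A * norm (x - y)) * B"
    using f g A unfolding bounded_lip_def by (intro add_mono mult_mono) auto
  finally show "\<bar>f x * g x - f y * g y\<bar> \<le> 2 * A * B * norm (x - y)" by (simp add: algebra_simps)
qed

lemma bounded_lip_reflect:
  assumes "bounded_lip A f"
  shows "bounded_lip A (\<lambda>y. f (x - y))"
proof -
  have "norm ((x - a) - (x - b)) = norm (a - b)" for a b by (simp add: norm_minus_commute)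
  then have "\<bar>f (x - a) - f (x - b)\<bar> \<le> A * norm (a - b)" for a b
    using assms unfolding bounded_lip_def by metis
  then show ?thesis using assms by (simp add: bounded_lip_def)
qed

lemma bounded_lip_sum:
  assumes "finite S" "\<And>e. e \<in> S \<Longrightarrow> bounded_lip A (f e)"
  shows "bounded_lip (real (card S) * A) (\<lambda>x. \<Sum>e\<in>S. f e x)"
  using assms
proof (induction S)
  case empty
  then show ?case by (simp add: bounded_lip_def)
next
  case (insert e S)
  have "bounded_lip (A + real (card S) * A) (\<lambda>x. f e x + (\<Sum>e\<in>S. f e x))"
    by (intro bounded_lip_add insert.IH) (use insert.prems in auto)
  then show ?case using insert.hyps by (simp add: algebra_simps)
qed

lemma bounded_lip_mono: "bounded_lip A f \<Longrightarrow> A \<le> B \<Longrightarrow> bounded_lip B f"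
  unfolding bounded_lip_def using lipschitz_mono[of f A B] by (auto intro: order_trans)

text \<open>Adding the sup bound and the gradient bound is crude, but gives one constant for both
  requirements.\<close>

lemma bounded_lip_partials:
  fixes f :: "'a::euclidean_space \<Rightarrow> real"
  assumes "f differentiable_on UNIV" "\<And>x. \<bar>f x\<bar> \<le> A" "\<And>e x. e \<in> Basis \<Longrightarrow> \<bar>pd e f x\<bar> \<le> B" "0 \<le> B" 
  shows "bounded_lip (A + real DIM('a) * B) f"
proof -
  have A: "0 \<le> A" using assms(2)[of 0] by linarith
  have "\<bar>f x - f y\<bar> \<le> real DIM('a) * B * norm (x - y)" for x y
  proof (rule lipschitz_of_partials[of _ "\<lambda>e. pd e f"])
    show "(f has_derivative (\<lambda>h. \<Sum>e\<in>Basis. (h \<bullet> e) * pd e f x)) (at x)" for x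
      using has_derivative_pd[of f x] assms(1) by (simp add: differentiable_on_def)
  qed (use assms in auto)
  then have "\<forall>x y. \<bar>f x - f y\<bar> \<le> (A + real DIM('a) * B) * norm (x - y)"
    using A lipschitz_mono[of f "real DIM('a) * B" "A + real DIM('a) * B"] by simp
  moreover have "\<bar>f x\<bar> \<le> A + real DIM('a) * B" for x
    using assms(2)[of x] assms(4) by (simp add: add_increasing2)
  ultimately show ?thesis by (simp add: bounded_lip_def)
qed

section \<open>The kernel of div b - grad V . b and the dual norm\<close>

context stein_setting
begin

lemma V_diff: "V differentiable_on UNIV" "e \<in> Basis \<Longrightarrow> pd e V differentiable_on UNIV"
  using V_smooth smooth_differentiable smooth_pd by blast+

lemma V_pos: "0 < 1 + V x" "1 + V x \<noteq> 0"
  using V_nonneg[of x] by linarith+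

lemma pd_inverse_weight: "pd b (\<lambda>x. 1 / (1 + V x)) x = - pd b V x / (1 + V x)\<^sup>2"
    and inverse_weight_differentiable: "(\<lambda>x. 1 / (1 + V x)) differentiable_on UNIV"
proof -
  have d: "(V has_derivative frechet_derivative V (at x)) (at x)" for x
    using V_diff(1) by (simp add: differentiable_on_def frechet_derivative_works[symmetric])
  have "((\<lambda>x. 1 / (1 + V x)) has_derivative (\<lambda>h. - frechet_derivative V (at x) h / (1 + V x)\<^sup>2)) (at x)" for x
    using V_pos(2)[of x] by (auto intro!: derivative_eq_intros d simp: power2_eq_square divide_simps)
  from this pd_eqI[OF this]
  show "pd b (\<lambda>x. 1 / (1 + V x)) x = - pd b V x / (1 + V x)\<^sup>2" "(\<lambda>x. 1 / (1 + V x)) differentiable_on UNIV"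
    by (auto simp: pd_def differentiable_on_def differentiable_def)
qed

text \<open>The gradient is - grad V / (1 + V)^2, and each component of grad V is at most c (1 + V)
  \<le> c (1 + V)^2.\<close>

lemma bounded_lip_inverse_weight: "bounded_lip (1 + real DIM('a) * c) (\<lambda>x. 1 / (1 + V x))"
proof (rule bounded_lip_partials[OF inverse_weight_differentiable])
  fix x e :: 'a
  show "\<bar>1 / (1 + V x)\<bar> \<le> 1" using V_nonneg[of x] by simp
  assume e: "e \<in> Basis"
  have "\<bar>pd e V x\<bar> \<le> c * (1 + V x)" by (rule V1_bd[OF e])
  also have "\<dots> \<le> c * (1 + V x)\<^sup>2"
    using V_nonneg[of x] by (intro mult_left_mono c_nonneg) (simp add: power2_eq_square)
  finally show "\<bar>pd e (\<lambda>x. 1 / (1 + V x)) x\<bar> \<le> c"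
    using V_pos[of x] by (simp add: pd_inverse_weight divide_le_eq)
qed (rule c_nonneg)

text \<open>The product rule produces second derivatives of V over 1 + V and products of first
  derivatives over (1 + V)^2; the growth bounds make the former at most c and the latter at most
  c^2.\<close>

lemma bounded_lip_V1_weight:
  assumes e: "e \<in> Basis"
  shows "bounded_lip (c + real DIM('a) * (c + c\<^sup>2)) (\<lambda>x. pd e V x * (1 / (1 + V x)))"
proof (rule bounded_lip_partials)
  show "(\<lambda>x. pd e V x * (1 / (1 + V x))) differentiable_on UNIV"
    by (intro differentiable_on_mult V_diff e inverse_weight_differentiable)
  fix x b :: 'a
  show "\<bar>pd e V x * (1 / (1 + V x))\<bar> \<le> c" using V1_bd[OF e, of x] V_pos(1)[of x] by (simp add: divide_le_eq)
  assume b: "b \<in> Basis"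
  have 1: "\<bar>pd b (pd e V) x / (1 + V x)\<bar> \<le> c" using V2_bd[OF e b, of x] V_pos(1)[of x] by (simp add: divide_le_eq)
  have "\<bar>pd e V x\<bar> * \<bar>pd b V x\<bar> \<le> (c * (1 + V x)) * (c * (1 + V x))"
    using V1_bd e b V_pos(1)[of x] c_nonneg by (intro mult_mono) auto
  then have 2: "\<bar>pd e V x * pd b V x / (1 + V x)\<^sup>2\<bar> \<le> c\<^sup>2"
    using V_pos[of x] by (simp add: divide_le_eq abs_mult power2_eq_square ac_simps)
  have "pd b (\<lambda>x. pd e V x * (1 / (1 + V x))) x = pd b (pd e V) x / (1 + V x) - pd e V x * pd b V x / (1 + V x)\<^sup>2"
    by (simp only: pd_mult[OF V_diff(2)[OF e] inverse_weight_differentiable] pd_inverse_weight) simp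
  then show "\<bar>pd b (\<lambda>x. pd e V x * (1 / (1 + V x))) x\<bar> \<le> c + c\<^sup>2" using 1 2 by linarith
qed (use c_nonneg in simp)

lemma bounded_lip_K1: "e \<in> Basis \<Longrightarrow> bounded_lip (L + real DIM('a) * L) (pd e K)"
  by (rule bounded_lip_partials[OF K1_diff K1_bd K2_bd L_nonneg])

lemma bounded_lip_K2: "e \<in> Basis \<Longrightarrow> f \<in> Basis \<Longrightarrow> bounded_lip L (pd f (pd e K))"
  using K2_bd K2_lip by (simp add: bounded_lip_def)

text \<open>The function of y whose integral against (1 + V) M is div b - grad V . b at x, for the
  field b generated by M. The last two summands contain the unbounded grad V(x) and are the
  functions of the mixed hypotheses.\<close>

definition dvg_kernel :: "'a \<Rightarrow> 'a \<Rightarrow> real" where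
  "dvg_kernel x y = (\<Sum>e\<in>Basis. pd e (pd e K) (x - y) * (1 / (1 + V y))) +
     (\<Sum>e\<in>Basis. pd e K (x - y) * (pd e V y * (1 / (1 + V y)))) -
     ((1 / (1 + V y)) *\<^sub>R grad V x) \<bullet> grad K (x - y) -
     (grad V x \<bullet> grad V y) / (1 + V y) * K (x - y)"

text \<open>The sum of the bounds of the four summands of \<open>dvg_kernel\<close>: each product of
  functions with constants A and B costs 2 A B, each sum over directions a factor d. The final 1
  makes the constant positive, so that one may divide by it.\<close>

definition dvg_const :: real where
  "dvg_const = real DIM('a) * (2 * L * (1 + real DIM('a) * c)) +
    real DIM('a) * (2 * (L + real DIM('a) * L) * (c + real DIM('a) * (c + c\<^sup>2))) + c + c + 1"

lemma dvg_const_pos: "dvg_const > 0"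
  unfolding dvg_const_def using L_nonneg c_nonneg by (intro add_nonneg_pos add_nonneg_nonneg mult_nonneg_nonneg) auto

lemma bounded_lip_dvg_kernel: "bounded_lip dvg_const (dvg_kernel x)"
proof -
  have 1: "bounded_lip c (\<lambda>y. ((1 / (1 + V y)) *\<^sub>R grad V x) \<bullet> grad K (x - y))"
    "bounded_lip c (\<lambda>y. (grad V x \<bullet> grad V y) / (1 + V y) * K (x - y))"
    using BL_norm_leD[OF KV1] BL_norm_leD[OF KV2] by (simp_all add: bounded_lip_def)
  have 2: "bounded_lip (2 * L * (1 + real DIM('a) * c)) (\<lambda>y. pd e (pd e K) (x - y) * (1 / (1 + V y)))"
    "bounded_lip (2 * (L + real DIM('a) * L) * (c + real DIM('a) * (c + c\<^sup>2))) (\<lambda>y. pd e K (x - y) * (pd e V y * (1 / (1 + V y))))"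
    if "e \<in> Basis" for e
    by (intro bounded_lip_mult bounded_lip_reflect bounded_lip_inverse_weight bounded_lip_V1_weight bounded_lip_K1 bounded_lip_K2 that)+
  have "bounded_lip (real DIM('a) * (2 * L * (1 + real DIM('a) * c)) +
    real DIM('a) * (2 * (L + real DIM('a) * L) * (c + real DIM('a) * (c + c\<^sup>2))) + c + c) (dvg_kernel x)"
    unfolding dvg_kernel_def by (intro bounded_lip_diff bounded_lip_add bounded_lip_sum 1 2 finite_Basis)
  then show ?thesis by (rule bounded_lip_mono) (simp add: dvg_const_def)
qed

lemma grad_inner_grad: "grad f x \<bullet> grad g y = (\<Sum>e\<in>Basis. pd e f x * pd e g y)"
  unfolding grad_def[of f] inner_sum_left
  by (intro sum.cong refl) (simp add: grad_inner_Basis inner_commute[of _ "grad g y"])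

lemma sum_Basis_inner_grad: "(\<Sum>e\<in>Basis. a e *\<^sub>R e) \<bullet> grad f x = (\<Sum>e\<in>Basis. pd e f x * a e)"
  unfolding inner_sum_left
  by (intro sum.cong refl) (simp add: grad_inner_Basis inner_commute[of _ "grad f x"])

text \<open>What the dual norm needs to be a bounded supremum and the fields generated by M need to
  be well defined.\<close>

definition weighted :: "'a measure \<Rightarrow> bool" where
  "weighted M \<longleftrightarrow> finite_measure M \<and> sets M = sets borel \<and> integrable M (\<lambda>x. 1 + V x)"

context
  fixes M assumes M: "weighted M"
begin

lemma weighted_simps: "sets M = sets borel" "integrable M (\<lambda>x. 1 + V x)" "finite_measure M"
  using M by (auto simp: weighted_def)

lemma weighted_measurable: "f \<in> borel_measurable borel \<Longrightarrow> f \<in> borel_measurable M"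
  using measurable_cong_sets[OF weighted_simps(1) refl] by blast

lemma weighted_integrable_const: "integrable M (\<lambda>_. a :: real)"
  by (rule finite_measure.integrable_const[OF weighted_simps(3)])

lemma weighted_adm: "adm (\<lambda>_. 1) M"
  unfolding adm_def
proof (intro conjI ballI weighted_simps)
  show "integrable M (\<lambda>_. 1 :: real)" by (rule weighted_integrable_const)
  fix e :: 'a assume e: "e \<in> Basis"
  show "integrable M (\<lambda>y. 1 * pd e V y)"
  proof (rule Bochner_Integration.integrable_bound[of _ "\<lambda>x. c * (1 + V x)"])
    show "integrable M (\<lambda>x. c * (1 + V x))" using weighted_simps by simp
    show "(\<lambda>y. 1 * pd e V y) \<in> borel_measurable M"
      using weighted_measurable[OF borel_measurable_continuous_onI[OF V1_cont[OF e]]] by simp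
    show "AE x in M. norm (1 * pd e V x) \<le> norm (c * (1 + V x))"
      using V1_bd[OF e] by (auto intro!: AE_I2 order_trans[OF _ abs_ge_self])
  qed
qed

lemma dvg_eq_kernel: "dvg (\<lambda>_. 1) M x = (\<integral>y. dvg_kernel x y * (1 + V y) \<partial>M)"
proof -
  note a = adm_simps[OF weighted_adm]
  \<comment> \<open>The factors 1 keep the integrands in the shape of \<open>mconv\<close> with
    density 1, to which the earlier lemmas apply.\<close>
  have i: "integrable M (\<lambda>y. 1 * pd e (pd e K) (x - y))" "integrable M (\<lambda>y. 1 * pd e V y * pd e K (x - y))"
     "integrable M (\<lambda>y. 1 * pd e K (x - y))" "integrable M (\<lambda>y. 1 * pd e V y * K (x - y))" if e: "e \<in> Basis" for e
    by (rule mconv_integrable[OF a(1,2) K2_cont[OF e e] K2_bd[OF e e]]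
         mconv_integrable[OF a(1) a(3)[OF e] K1_cont[OF e] K1_bd[OF e]]
         mconv_integrable[OF a(1,2) K1_cont[OF e] K1_bd[OF e]]
         mconv_integrable[OF a(1) a(3)[OF e] K_cont K_bd])+
  have k: "dvg_kernel x y * (1 + V y) = (\<Sum>e\<in>Basis. (1 * pd e (pd e K) (x - y) + 1 * pd e V y * pd e K (x - y)) -
      pd e V x * (1 * pd e K (x - y) + 1 * pd e V y * K (x - y)))" for y
  proof -
    have d: "a / (1 + V y) * (1 + V y) = a" for a using V_pos(2)[of y] by simp
    have "dvg_kernel x y * (1 + V y) = ((\<Sum>e\<in>Basis. pd e (pd e K) (x - y)) + (\<Sum>e\<in>Basis. pd e K (x - y) * pd e V y) -
      grad V x \<bullet> grad K (x - y) - (grad V x \<bullet> grad V y) * K (x - y)) / (1 + V y) * (1 + V y)"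
      unfolding dvg_kernel_def by (simp add: diff_divide_distrib add_divide_distrib sum_divide_distrib)
    also have "\<dots> = (\<Sum>e\<in>Basis. pd e (pd e K) (x - y)) + (\<Sum>e\<in>Basis. pd e K (x - y) * pd e V y) -
      grad V x \<bullet> grad K (x - y) - (grad V x \<bullet> grad V y) * K (x - y)" by (rule d)
    also have "\<dots> = (\<Sum>e\<in>Basis. (1 * pd e (pd e K) (x - y) + 1 * pd e V y * pd e K (x - y)) -
      pd e V x * (1 * pd e K (x - y) + 1 * pd e V y * K (x - y)))"
      unfolding grad_inner_grad by (simp add: sum.distrib sum_subtractf sum_distrib_left sum_distrib_right algebra_simps)
    finally show ?thesis .
  qed
  have "(\<integral>y. dvg_kernel x y * (1 + V y) \<partial>M) = (\<Sum>e\<in>Basis. \<integral>y. (1 * pd e (pd e K) (x - y) + 1 * pd e V y * pd e K (x - y)) -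
      pd e V x * (1 * pd e K (x - y) + 1 * pd e V y * K (x - y)) \<partial>M)"
    unfolding k using i by (intro Bochner_Integration.integral_sum) auto
  also have "\<dots> = dvg (\<lambda>_. 1) M x"
    unfolding dvg_def fld_def dfld_def mconv_def using i by (intro sum.cong refl) simp
  finally show ?thesis by simp
qed

lemma integrable_bounded_lip:
  assumes "bounded_lip C \<psi>"
  shows "integrable M (\<lambda>x. \<psi> x * (1 + V x))" "\<bar>\<integral>x. \<psi> x * (1 + V x) \<partial>M\<bar> \<le> C * (\<integral>x. 1 + V x \<partial>M)"
proof -
  have "continuous_on UNIV \<psi>" using assms lipschitz_imp_continuous[of \<psi> C] by (simp add: bounded_lip_def)
  then have m: "(\<lambda>x. \<psi> x * (1 + V x)) \<in> borel_measurable borel"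
    by (intro borel_measurable_continuous_onI continuous_intros V_cont)
  have b: "\<bar>\<psi> x * (1 + V x)\<bar> \<le> C * (1 + V x)" for x
    using assms V_pos(1)[of x] by (simp add: bounded_lip_def abs_mult mult_right_mono)
  show "integrable M (\<lambda>x. \<psi> x * (1 + V x))"
  proof (rule Bochner_Integration.integrable_bound[of _ "\<lambda>x. C * (1 + V x)"])
    show "integrable M (\<lambda>x. C * (1 + V x))" using weighted_simps by simp
    show "AE x in M. norm (\<psi> x * (1 + V x)) \<le> norm (C * (1 + V x))"
      using b by (auto intro!: AE_I2 order_trans[OF _ abs_ge_self])
  qed (rule weighted_measurable[OF m])
  then have "\<bar>\<integral>x. \<psi> x * (1 + V x) \<partial>M\<bar> \<le> (\<integral>x. C * (1 + V x) \<partial>M)"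
    using weighted_simps b by (intro integral_abs_bound_integral) auto
  then show "\<bar>\<integral>x. \<psi> x * (1 + V x) \<partial>M\<bar> \<le> C * (\<integral>x. 1 + V x \<partial>M)" by simp
qed

end

lemma bounded_lip_iff_BL_norm: "BL_norm \<psi> \<le> 1 \<longleftrightarrow> bounded_lip 1 \<psi>"
  using BL_norm_leD[of \<psi> 1] BL_norm_leI[of \<psi> 1] by (auto simp: bounded_lip_def one_ereal_def)

lemma BLV_dual_norm_alt:
  "BLV_dual_norm V M N = (SUP \<psi>\<in>{\<psi>. bounded_lip 1 \<psi>}. (\<integral>x. \<psi> x * (1 + V x) \<partial>M) - (\<integral>x. \<psi> x * (1 + V x) \<partial>N))"
  unfolding BLV_dual_norm_def bounded_lip_iff_BL_norm ..

context
  fixes M N assumes M: "weighted M" and N: "weighted N"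
begin

text \<open>The dual norm is a supremum of reals, so an upper bound must be known before any of its
  elements can be compared with it.\<close>

lemma BLV_bdd: "bdd_above ((\<lambda>\<psi>. (\<integral>x. \<psi> x * (1 + V x) \<partial>M) - (\<integral>x. \<psi> x * (1 + V x) \<partial>N)) ` {\<psi>. bounded_lip 1 \<psi>})"
proof (rule bdd_aboveI2)
  fix \<psi> :: "'a \<Rightarrow> real" assume "\<psi> \<in> {\<psi>. bounded_lip 1 \<psi>}"
  then show "(\<integral>x. \<psi> x * (1 + V x) \<partial>M) - (\<integral>x. \<psi> x * (1 + V x) \<partial>N) \<le> (\<integral>x. 1 + V x \<partial>M) + (\<integral>x. 1 + V x \<partial>N)"
    using integrable_bounded_lip(2)[OF M, of 1 \<psi>] integrable_bounded_lip(2)[OF N, of 1 \<psi>] by auto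
qed

lemma BLV_upper:
  "bounded_lip 1 \<psi> \<Longrightarrow> (\<integral>x. \<psi> x * (1 + V x) \<partial>M) - (\<integral>x. \<psi> x * (1 + V x) \<partial>N) \<le> BLV_dual_norm V M N"
  unfolding BLV_dual_norm_alt by (rule cSUP_upper[OF _ BLV_bdd]) simp

lemma BLV_nonneg: "0 \<le> BLV_dual_norm V M N"
  using BLV_upper[of "\<lambda>x. 0"] by (simp add: bounded_lip_def)

lemma BLV_le: "BLV_dual_norm V M N \<le> (\<integral>x. 1 + V x \<partial>M) + (\<integral>x. 1 + V x \<partial>N)"
  unfolding BLV_dual_norm_alt
proof (rule cSUP_least)
  show "{\<psi>. bounded_lip 1 \<psi>} \<noteq> {}" by (auto intro!: exI[of _ "\<lambda>x. 0"] simp: bounded_lip_def)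
  fix \<psi> :: "'a \<Rightarrow> real" assume "\<psi> \<in> {\<psi>. bounded_lip 1 \<psi>}"
  then show "(\<integral>x. \<psi> x * (1 + V x) \<partial>M) - (\<integral>x. \<psi> x * (1 + V x) \<partial>N) \<le> (\<integral>x. 1 + V x \<partial>M) + (\<integral>x. 1 + V x \<partial>N)"
    using integrable_bounded_lip(2)[OF M, of 1 \<psi>] integrable_bounded_lip(2)[OF N, of 1 \<psi>] by auto
qed

lemma BLV_bound:
  assumes "bounded_lip C \<psi>" "C > 0"
  shows "(\<integral>x. \<psi> x * (1 + V x) \<partial>M) - (\<integral>x. \<psi> x * (1 + V x) \<partial>N) \<le> C * BLV_dual_norm V M N"
proof -
  have "bounded_lip 1 (\<lambda>x. \<psi> x / C)"
    using assms unfolding bounded_lip_def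
    by (auto simp: diff_divide_distrib[symmetric] divide_le_eq mult.commute)
  from BLV_upper[OF this] have "((\<integral>x. \<psi> x * (1 + V x) \<partial>M) - (\<integral>x. \<psi> x * (1 + V x) \<partial>N)) / C \<le> BLV_dual_norm V M N"
    by (simp add: diff_divide_distrib)
  then show ?thesis using assms(2) by (simp add: divide_le_eq mult.commute)
qed

text \<open>Both sides of the difference use the same kernel, so it is one pairing with (1 + V)(M -
  N). An upper bound is enough, as it will multiply the nonnegative energy density.\<close>

lemma dvg_diff_le: "dvg (\<lambda>_. 1) M x - dvg (\<lambda>_. 1) N x \<le> dvg_const * BLV_dual_norm V M N"
  unfolding dvg_eq_kernel[OF M] dvg_eq_kernel[OF N] by (rule BLV_bound[OF bounded_lip_dvg_kernel dvg_const_pos])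

lemma stein_field_diff_inner: 
  assumes e: "e \<in> Basis"
  shows "(stein_field K V M x - stein_field K V N x) \<bullet> e = fld (\<lambda>_. 1) M e x - fld (\<lambda>_. 1) N e x"
proof -
  have "stein_field K V M x \<bullet> e = fld (\<lambda>_. 1) M e x" if M: "weighted M" for M
  proof -
    note a = adm_simps[OF weighted_adm[OF M]]
    have "integrable M (\<lambda>y. \<Sum>e\<in>Basis. (1 * pd e K (x - y)) *\<^sub>R e)"
      by (intro Bochner_Integration.integrable_sum integrable_scaleR_left mconv_integrable[OF a(1,2) K1_cont K1_bd])
    then have 1: "integrable M (\<lambda>y. grad K (x - y))" by (simp add: grad_def)
    have "integrable M (\<lambda>y. \<Sum>e\<in>Basis. (1 * pd e V y * K (x - y)) *\<^sub>R e)"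
      by (intro Bochner_Integration.integrable_sum integrable_scaleR_left mconv_integrable[OF a(1) a(3) K_cont K_bd])
    then have 2: "integrable M (\<lambda>y. K (x - y) *\<^sub>R grad V y)" by (simp add: grad_def scaleR_sum_right mult.commute)
    show ?thesis
      unfolding stein_field_def fld_def mconv_def inner_add_left
      using integral_inner_left[OF 1, of e] integral_inner_left[OF 2, of e] e
      by (simp add: grad_inner_Basis mult.commute)
  qed
  then show ?thesis using M N by (simp add: inner_diff_left)
qed

end

section \<open>The density w and the dual equation in terms of fld and dvg\<close>

definition Z :: real where "Z = partition_const V"

lemma exp_V_integrable: "integrable lborel (\<lambda>x. exp (- V x))"
proof (rule Bochner_Integration.integrable_bound[OF V_int])
  show "(\<lambda>x. exp (- V x)) \<in> borel_measurable lborel"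
    using borel_measurable_continuous_onI[OF V_cont] by simp
  show "AE x in lborel. norm (exp (- V x)) \<le> norm (exp (- V x) * (1 + V x)\<^sup>2)"
  proof (intro AE_I2)
    fix x
    have "1 \<le> (1 + V x)\<^sup>2" using V_nonneg[of x] by (intro one_le_power) simp
    then show "norm (exp (- V x)) \<le> norm (exp (- V x) * (1 + V x)\<^sup>2)"
      by (simp add: abs_mult)
  qed
qed

lemma Z_pos: "Z > 0"
proof -
  have "Z \<noteq> 0"
  proof
    assume "Z = 0"
    then have "AE x in lborel. exp (- V x) = 0"
      using integral_nonneg_eq_0_iff_AE[OF exp_V_integrable] by (simp add: Z_def partition_const_def)
    then have "AE x in lborel. exp (- V x) \<le> 0" by auto
    from AE_lborel_le_continuous[OF this, of 0] show False
      using continuous_on_exp[OF continuous_on_minus[OF V_cont]] by (simp add: not_le)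
  qed
  moreover have "Z \<ge> 0" by (simp add: Z_def partition_const_def)
  ultimately show ?thesis by simp
qed

abbreviation w :: "'a \<Rightarrow> real" where "w \<equiv> rho_inf V"

lemma w_eq: "w x = exp (- V x) / Z"
  by (simp add: rho_inf_def Z_def)

lemma w_pos: "w x > 0"
  using Z_pos by (simp add: w_eq)

lemma w_diff: "w differentiable_on UNIV" and pd_w: "pd e w x = - w x * pd e V x"
proof -
  have d: "(V has_derivative frechet_derivative V (at x)) (at x)" for x
    using V_diff(1) by (simp add: differentiable_on_def frechet_derivative_works[symmetric])
  have "((\<lambda>x. exp (- V x) / Z) has_derivative (\<lambda>h. - (exp (- V x) / Z) * frechet_derivative V (at x) h)) (at x)" for x
    using Z_pos by (auto intro!: derivative_eq_intros d)
  then have "(w has_derivative (\<lambda>h. - w x * frechet_derivative V (at x) h)) (at x)" for x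
    by (simp add: w_eq[abs_def])
  from this pd_eqI[OF this] show "w differentiable_on UNIV" "pd e w x = - w x * pd e V x"
    by (auto simp: pd_def differentiable_on_def differentiable_def)
qed

lemma w_cont: "continuous_on UNIV w"
  by (rule differentiable_imp_continuous_on[OF w_diff])

lemma grad_w: "grad w x = - (w x *\<^sub>R grad V x)"
  by (simp add: grad_def pd_w scaleR_sum_right sum_negf)

lemma w_weight2_integrable: "integrable lborel (\<lambda>x. w x * (1 + V x)\<^sup>2)"
  using integrable_divide[OF V_int, of Z] by (simp add: w_eq)

lemma w_weight_integrable: "integrable lborel (\<lambda>x. w x * (1 + V x))"
proof (rule Bochner_Integration.integrable_bound[OF w_weight2_integrable])
  show "(\<lambda>x. w x * (1 + V x)) \<in> borel_measurable lborel"
    using borel_measurable_continuous_onI[OF V_cont] borel_measurable_continuous_onI[OF w_cont] by simp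
  show "AE x in lborel. norm (w x * (1 + V x)) \<le> norm (w x * (1 + V x)\<^sup>2)"
  proof (intro AE_I2)
    fix x
    have "1 + V x \<le> (1 + V x)\<^sup>2" using V_nonneg[of x] by (simp add: power2_eq_square)
    then show "norm (w x * (1 + V x)) \<le> norm (w x * (1 + V x)\<^sup>2)"
      using w_pos[of x] V_pos(1)[of x] by (simp add: abs_mult)
  qed
qed

lemma rho_inf_weighted: "weighted (rho_inf_measure V)"
proof -
  have [measurable]: "w \<in> borel_measurable borel" by (intro borel_measurable_continuous_onI w_cont)
  have [measurable]: "V \<in> borel_measurable borel" by (intro borel_measurable_continuous_onI V_cont)
  have wi: "integrable lborel w"
    using integrable_divide[OF exp_V_integrable, of Z] by (simp add: w_eq[abs_def])
  have "emeasure (rho_inf_measure V) UNIV < \<infinity>"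
    unfolding rho_inf_measure_def using wi w_pos
    by (simp add: emeasure_density nn_integral_eq_integral less_imp_le)
  then have "finite_measure (rho_inf_measure V)"
    by (intro finite_measureI) (auto simp: rho_inf_measure_def)
  moreover have "integrable (rho_inf_measure V) (\<lambda>x. 1 + V x)"
    unfolding rho_inf_measure_def using w_weight_integrable w_pos
    by (subst integrable_density) (auto simp: less_imp_le)
  ultimately show ?thesis by (simp add: weighted_def rho_inf_measure_def)
qed

text \<open>Since grad w = - w grad V, the four convolution terms are exactly the four parts of -
  \<open>dvg\<close> of w f: the two with grad w give the contributions of f w grad V, the two with
  w f the contributions of grad(w f).\<close>

lemma dual_rhs_eq:
  assumes M: "weighted M" and N: "weighted N" and f: "adm (\<lambda>y. w y * f y) lborel"
  shows "dual_rhs K V M N h f x =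
    (\<Sum>e\<in>Basis. pd e f x * (fld (\<lambda>_. 1) M e x - fld (\<lambda>_. 1) N e x)) - dvg (\<lambda>y. w y * f y) lborel x + h x * (1 + V x)"
proof -
  let ?F = "\<lambda>y. w y * f y"
  note a = adm_simps[OF f]
  have i1: "integrable lborel (\<lambda>y. ?F y * pd e (pd e K) (x - y))" if e: "e \<in> Basis" for e
    by (rule mconv_integrable[OF a(1,2) K2_cont[OF e e] K2_bd[OF e e]])
  have i2: "integrable lborel (\<lambda>y. ?F y * pd e V y * pd e K (x - y))" if e: "e \<in> Basis" for e
    by (rule mconv_integrable[OF a(1) a(3)[OF e] K1_cont[OF e] K1_bd[OF e]])
  have i3: "integrable lborel (\<lambda>y. ?F y * pd e K (x - y))" if e: "e \<in> Basis" for e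
    by (rule mconv_integrable[OF a(1,2) K1_cont[OF e] K1_bd[OF e]])
  have i4: "integrable lborel (\<lambda>y. ?F y * pd e V y * K (x - y))" if e: "e \<in> Basis" for e
    by (rule mconv_integrable[OF a(1) a(3)[OF e] K_cont K_bd])
  have 1: "conv (\<bullet>) (\<lambda>y. f y *\<^sub>R grad w y) (grad K) x = - (\<Sum>e\<in>Basis. mconv lborel (\<lambda>y. ?F y * pd e V y) (pd e K) x)"
  proof -
    have "(\<integral>y. (\<Sum>e\<in>Basis. ?F y * pd e V y * pd e K (x - y)) \<partial>lborel) = (\<Sum>e\<in>Basis. mconv lborel (\<lambda>y. ?F y * pd e V y) (pd e K) x)"
      unfolding mconv_def by (rule Bochner_Integration.integral_sum[OF i2])
    moreover have "(f y *\<^sub>R grad w y) \<bullet> grad K (x - y) = - (\<Sum>e\<in>Basis. ?F y * pd e V y * pd e K (x - y))" for y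
      unfolding grad_w by (simp add: grad_inner_grad sum_distrib_left ac_simps)
    ultimately show ?thesis unfolding conv_def by simp
  qed
  have 2: "conv (\<lambda>v c. c *\<^sub>R v) (\<lambda>y. f y *\<^sub>R grad w y) K x \<bullet> grad V x = - (\<Sum>e\<in>Basis. pd e V x * mconv lborel (\<lambda>y. ?F y * pd e V y) K x)"
  proof -
    have "(\<integral>y. (\<Sum>e\<in>Basis. (?F y * pd e V y * K (x - y)) *\<^sub>R e) \<partial>lborel) = (\<Sum>e\<in>Basis. \<integral>y. (?F y * pd e V y * K (x - y)) *\<^sub>R e \<partial>lborel)"
      by (intro Bochner_Integration.integral_sum integrable_scaleR_left i4)
    also have "\<dots> = (\<Sum>e\<in>Basis. mconv lborel (\<lambda>y. ?F y * pd e V y) K x *\<^sub>R e)"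
      unfolding mconv_def by (intro sum.cong refl integral_scaleR_left i4)
    finally have A: "(\<integral>y. (\<Sum>e\<in>Basis. (?F y * pd e V y * K (x - y)) *\<^sub>R e) \<partial>lborel) = (\<Sum>e\<in>Basis. mconv lborel (\<lambda>y. ?F y * pd e V y) K x *\<^sub>R e)" .
    have "K (x - y) *\<^sub>R f y *\<^sub>R grad w y = - (\<Sum>e\<in>Basis. (?F y * pd e V y * K (x - y)) *\<^sub>R e)" for y
      unfolding grad_def by (simp add: pd_w scaleR_sum_right sum_negf[symmetric] ac_simps)
    then have "conv (\<lambda>v c. c *\<^sub>R v) (\<lambda>y. f y *\<^sub>R grad w y) K x = - (\<Sum>e\<in>Basis. mconv lborel (\<lambda>y. ?F y * pd e V y) K x *\<^sub>R e)"
      unfolding conv_def using A by simp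
    then show ?thesis by (simp add: sum_Basis_inner_grad)
  qed
  have 3: "conv (*) ?F (laplacian K) x = (\<Sum>e\<in>Basis. mconv lborel ?F (pd e (pd e K)) x)"
    unfolding conv_def laplacian_def sum_distrib_left mconv_def by (rule Bochner_Integration.integral_sum[OF i1])
  have 4: "conv (*\<^sub>R) ?F (grad K) x \<bullet> grad V x = (\<Sum>e\<in>Basis. pd e V x * mconv lborel ?F (pd e K) x)"
  proof -
    have "conv (*\<^sub>R) ?F (grad K) x = (\<Sum>e\<in>Basis. \<integral>y. (?F y * pd e K (x - y)) *\<^sub>R e \<partial>lborel)"
      unfolding conv_def grad_def scaleR_sum_right scaleR_scaleR
      by (intro Bochner_Integration.integral_sum integrable_scaleR_left i3)
    also have "\<dots> = (\<Sum>e\<in>Basis. mconv lborel ?F (pd e K) x *\<^sub>R e)"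
      unfolding mconv_def by (intro sum.cong refl integral_scaleR_left i3)
    finally show ?thesis by (simp add: sum_Basis_inner_grad)
  qed
  have 5: "grad f x \<bullet> (stein_field K V M x - stein_field K V N x) = (\<Sum>e\<in>Basis. pd e f x * (fld (\<lambda>_. 1) M e x - fld (\<lambda>_. 1) N e x))"
    unfolding grad_def inner_sum_left by (intro sum.cong refl) (simp add: stein_field_diff_inner[OF M N, symmetric] inner_commute)
  show ?thesis
    unfolding dual_rhs_def 1 2 3 4 5 dvg_def fld_def[of ?F] dfld_def[of ?F]
    by (simp add: sum.distrib sum_subtractf distrib_left)
qed

end

section \<open>The energy estimate\<close>

lemma nn_integral_bound_imp_integral:
  fixes f :: "'a \<Rightarrow> real"
  assumes "f \<in> borel_measurable M" "\<And>x. 0 \<le> f x" "(\<integral>\<^sup>+x. ennreal (f x) \<partial>M) \<le> ennreal W" "0 \<le> W"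
  shows "integrable M f" "(\<integral>x. f x \<partial>M) \<le> W"
proof -
  have "(\<integral>\<^sup>+x. ennreal (f x) \<partial>M) < \<infinity>" using assms(3) by (rule order.strict_trans1) simp
  then show i: "integrable M f" using assms by (intro integrableI_nonneg) auto
  have "ennreal (\<integral>x. f x \<partial>M) \<le> ennreal W"
    using assms nn_integral_eq_integral[OF i] by simp
  then show "(\<integral>x. f x \<partial>M) \<le> W" using assms(4) by simp
qed

lemma SUP_lt_top_bound:
  fixes F :: "'b \<Rightarrow> ennreal"
  assumes "(SUP t\<in>S. F t) < \<infinity>"
  shows "\<exists>W\<ge>0. \<forall>t\<in>S. F t \<le> ennreal W"
proof (intro exI conjI ballI)
  fix t assume "t \<in> S"
  then have "F t \<le> (SUP t\<in>S. F t)" by (rule SUP_upper)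
  then show "F t \<le> ennreal (enn2real (SUP t\<in>S. F t))" using assms by simp
qed simp

lemma cutoff_lipschitz:
  assumes R: "R > 0" and s: "s \<ge> 0"
  shows "\<bar>cutoff R s x - cutoff R s y\<bar> \<le> 2 / R * norm (x - y)"
proof -
  have "norm (cutoff R s x - cutoff R s y) \<le> 2 / R * norm (x - y)"
  proof (rule differentiable_bound[OF convex_UNIV])
    fix x :: 'a
    show "(cutoff R s has_derivative (\<lambda>h. - cutoff_slope R s x * ((x \<bullet> h) / jb x))) (at x)"
      by (rule cutoff_has_derivative[OF R])
    show "onorm (\<lambda>h. - cutoff_slope R s x * ((x \<bullet> h) / jb x)) \<le> 2 / R"
    proof (rule onorm_le)
      fix h :: 'a
      have "\<bar>cutoff_slope R s x\<bar> * (\<bar>x \<bullet> h\<bar> / jb x) \<le> 2 / R * norm h"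
        using cutoff_slope_nonneg[OF R, of s x] jb_ge_1[of x] R
        by (intro mult_mono abs_inner_div_jb_le) (auto intro: cutoff_slope_le[OF R s])
      then show "norm (- cutoff_slope R s x * ((x \<bullet> h) / jb x)) \<le> 2 / R * norm h"
        using jb_ge_1[of x] by (simp add: abs_mult)
    qed
  qed auto
  then show ?thesis by simp
qed

lemma cutoff_Suc: "real (Suc n) > 0" by simp

lemma Linf_norm_continuous:
  fixes f :: "'a::euclidean_space \<Rightarrow> real"
  assumes f: "continuous_on UNIV f" and G: "\<And>x. \<bar>f x\<bar> \<le> G"
  shows "\<bar>f x\<bar> \<le> real_of_ereal (Linf_norm f)"
    and "(\<And>x. \<bar>f x\<bar> \<le> c) \<Longrightarrow> real_of_ereal (Linf_norm f) \<le> c"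
proof -
  have fm: "(\<lambda>x. ereal \<bar>f x\<bar>) \<in> borel_measurable lborel"
    using borel_measurable_continuous_onI[OF f] by simp
  have le: "Linf_norm f \<le> ereal c" if "\<And>x. \<bar>f x\<bar> \<le> c" for c
    unfolding Linf_norm_def by (rule esssup_I[OF fm]) (use that in auto)
  have ae: "AE x in lborel. ereal \<bar>f x\<bar> \<le> Linf_norm f"
    unfolding Linf_norm_def by (rule esssup_AE)
  \<comment> \<open>\<open>real_of_ereal\<close> sends both infinities to 0, so they must be
    excluded first; minus infinity would force |f| \<le> -1 almost everywhere, hence at 0.\<close>
  have fin: "\<bar>Linf_norm f\<bar> \<noteq> \<infinity>"
  proof -
    have "Linf_norm f \<noteq> \<infinity>" using le[OF G] by auto
    moreover have "Linf_norm f \<noteq> - \<infinity>"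
    proof
      assume "Linf_norm f = - \<infinity>"
      with ae have "AE x in lborel. \<bar>f x\<bar> \<le> -1" by auto
      from AE_lborel_le_continuous[OF this] continuous_on_rabs[OF f] have "\<bar>f 0\<bar> \<le> -1" by simp
      then show False by simp
    qed
    ultimately show ?thesis by auto
  qed
  then obtain l where l: "Linf_norm f = ereal l" by auto
  from ae have "AE x in lborel. \<bar>f x\<bar> \<le> l" unfolding l by simp
  from AE_lborel_le_continuous[OF this] continuous_on_rabs[OF f]
  show "\<bar>f x\<bar> \<le> real_of_ereal (Linf_norm f)" by (simp add: l)
  show "real_of_ereal (Linf_norm f) \<le> c" if "\<And>x. \<bar>f x\<bar> \<le> c"
    using le[OF that] by (simp add: l)
qed

lemma set_integrable_bounded_interval:
  fixes f :: "real \<Rightarrow> real"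
  assumes "(\<lambda>r. indicator {a..b} r * f r) \<in> borel_measurable borel" "\<And>r. r \<in> {a..b} \<Longrightarrow> \<bar>f r\<bar> \<le> B"
  shows "set_integrable lborel {a..b} f"
  unfolding set_integrable_def
proof (rule integrableI_bounded_set[where A="{a..b}" and B=B])
  show "AE x in lborel. x \<in> {a..b} \<longrightarrow> norm (indicat_real {a..b} x *\<^sub>R f x) \<le> B"
    using assms(2) by auto
qed (use assms(1) in \<open>auto simp: emeasure_lborel_Icc_eq\<close>)

locale stein_dual = stein_setting K L V c for K :: "'a::euclidean_space \<Rightarrow> real" and L V c +
  fixes \<rho> :: "real \<Rightarrow> 'a measure" and T :: real and g \<phi> :: "real \<Rightarrow> 'a \<Rightarrow> real"
  assumes meas_sol: "measure_solution K V \<rho>" and T: "T > 0"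
    and g_test: "test_function (\<lambda>(t, x). g t x)"
    and dual_sol: "dual_solution K V \<rho> T g \<phi>" and terminal: "\<And>x. \<phi> T x = 0"
begin

abbreviation N :: "'a measure" where "N \<equiv> rho_inf_measure V"

lemma rho_weighted_bound: "\<exists>W\<ge>0. \<forall>t\<in>{0..T}. weighted (\<rho> t) \<and> (\<integral>x. 1 + V x \<partial>\<rho> t) \<le> W"
proof -
  have "(SUP t\<in>{0..T}. \<integral>\<^sup>+x. ennreal (1 + V x) \<partial>\<rho> t) < \<infinity>"
    using meas_sol T unfolding measure_solution_def by blast
  from SUP_lt_top_bound[OF this] obtain W where W: "W \<ge> 0"
    "\<And>t. t \<in> {0..T} \<Longrightarrow> (\<integral>\<^sup>+x. ennreal (1 + V x) \<partial>\<rho> t) \<le> ennreal W" by blast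
  have "weighted (\<rho> t) \<and> (\<integral>x. 1 + V x \<partial>\<rho> t) \<le> W" if t: "t \<in> {0..T}" for t
  proof -
    have p: "prob_space (\<rho> t)" and s: "sets (\<rho> t) = sets borel"
      using meas_sol t unfolding measure_solution_def by auto
    have m: "(\<lambda>x. 1 + V x) \<in> borel_measurable (\<rho> t)"
      unfolding measurable_cong_sets[OF s refl] using borel_measurable_continuous_onI[OF V_cont] by simp
    show ?thesis
      using nn_integral_bound_imp_integral[OF m _ W(2)[OF t] W(1)] V_nonneg p s
      by (auto simp: weighted_def prob_space_def)
  qed
  with W(1) show ?thesis by blast
qed

lemma rho_weighted: "t \<in> {0..T} \<Longrightarrow> weighted (\<rho> t)"
  using rho_weighted_bound by blast

lemma phi_diff: "t \<in> {0..T} \<Longrightarrow> \<phi> t differentiable_on UNIV"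
  using dual_sol unfolding dual_solution_def by blast

lemma phi_cont: "t \<in> {0..T} \<Longrightarrow> continuous_on UNIV (\<phi> t)"
  by (rule differentiable_imp_continuous_on[OF phi_diff])

lemma phi1_cont: 
  assumes t: "t \<in> {0..T}" and e: "e \<in> Basis"
  shows "continuous_on UNIV (pd e (\<phi> t))"
proof -
  have "continuous_on ({0..T} \<times> UNIV) (\<lambda>(t, x). grad (\<phi> t) x)"
    using dual_sol unfolding dual_solution_def by blast
  then have "continuous_on UNIV (\<lambda>x. case (t, x) of (t, x) \<Rightarrow> grad (\<phi> t) x)"
    by (rule continuous_on_compose2) (use t in \<open>auto intro!: continuous_intros\<close>)
  then have "continuous_on UNIV (\<lambda>x. grad (\<phi> t) x \<bullet> e)" by (auto intro!: continuous_intros)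
  then show ?thesis using e by (simp add: grad_inner_Basis)
qed

lemma phi_bounded_on_cball:
  "\<exists>P\<ge>0. \<forall>t\<in>{0..T}. \<forall>x. norm x \<le> R \<longrightarrow> \<bar>\<phi> t x\<bar> \<le> P \<and> (\<forall>e\<in>Basis. \<bar>pd e (\<phi> t) x\<bar> \<le> P)"
proof -
  have c: "continuous_on ({0..T} \<times> UNIV) (\<lambda>(t, x). \<phi> t x)" "continuous_on ({0..T} \<times> UNIV) (\<lambda>(t, x). grad (\<phi> t) x)"
    using dual_sol unfolding dual_solution_def by blast+
  have "compact ({0..T} \<times> cball (0::'a) R)" by (intro compact_Times) auto
  then have "bounded ((\<lambda>(t, x). \<phi> t x) ` ({0..T} \<times> cball 0 R))" "bounded ((\<lambda>(t, x). grad (\<phi> t) x) ` ({0..T} \<times> cball 0 R))"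
    by (intro compact_imp_bounded compact_continuous_image continuous_on_subset[OF c(1)] continuous_on_subset[OF c(2)]; auto)+
  then obtain P1 P2 where P: "P1 > 0" "P2 > 0" "\<And>t x. t \<in> {0..T} \<Longrightarrow> norm x \<le> R \<Longrightarrow> \<bar>\<phi> t x\<bar> \<le> P1"
    "\<And>t x. t \<in> {0..T} \<Longrightarrow> norm x \<le> R \<Longrightarrow> norm (grad (\<phi> t) x) \<le> P2"
    by (force simp: bounded_pos)
  show ?thesis
    using P by (intro exI[of _ "P1 + P2"])
      (auto intro!: order_trans[OF abs_pd_le_norm_grad] order_trans[OF P(3)] order_trans[OF P(4)])
qed

lemma w_phi_adm_bound:
  "\<exists>A\<ge>0. \<forall>t\<in>{0..T}. adm (\<lambda>y. w y * \<phi> t y) lborel \<and> mass (\<lambda>y. w y * \<phi> t y) lborel \<le> A \<and>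
     (\<integral>y. \<bar>w y * \<phi> t y\<bar> * V1_sum y \<partial>lborel) \<le> A"
proof -
  have s: "(SUP t\<in>{0..T}. \<integral>\<^sup>+x. ennreal \<bar>w x * \<phi> t x\<bar> \<partial>lborel) < \<infinity>"
    "(SUP t\<in>{0..T}. \<integral>\<^sup>+x. ennreal (norm (\<phi> t x *\<^sub>R grad w x)) \<partial>lborel) < \<infinity>"
    using dual_sol unfolding dual_solution_def by blast+
  obtain A0 where A0: "A0 \<ge> 0" "\<And>t. t \<in> {0..T} \<Longrightarrow> (\<integral>\<^sup>+x. ennreal \<bar>w x * \<phi> t x\<bar> \<partial>lborel) \<le> ennreal A0"
    using SUP_lt_top_bound[OF s(1)] by blast
  obtain A1 where A1: "A1 \<ge> 0" "\<And>t. t \<in> {0..T} \<Longrightarrow> (\<integral>\<^sup>+x. ennreal (norm (\<phi> t x *\<^sub>R grad w x)) \<partial>lborel) \<le> ennreal A1"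
    using SUP_lt_top_bound[OF s(2)] by blast
  \<comment> \<open>One constant for two bounds: \<open>mass\<close> carries the factor
    \<open>L\<close>, the integral weighted by \<open>V1_sum\<close> the factor 1.\<close>
  let ?A = "(1 + L) * (A0 + real DIM('a) * A1)"
  have "adm (\<lambda>y. w y * \<phi> t y) lborel \<and> mass (\<lambda>y. w y * \<phi> t y) lborel \<le> ?A \<and>
     (\<integral>y. \<bar>w y * \<phi> t y\<bar> * V1_sum y \<partial>lborel) \<le> ?A" if t: "t \<in> {0..T}" for t
  proof -
    have cw: "continuous_on UNIV (\<lambda>y. w y * \<phi> t y)" by (intro continuous_intros w_cont phi_cont t)
    have m: "(\<lambda>y. w y * \<phi> t y) \<in> borel_measurable borel" by (rule borel_measurable_continuous_onI[OF cw])
    have "(\<lambda>y. \<bar>w y * \<phi> t y\<bar>) \<in> borel_measurable lborel" using m by simp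
    note i = nn_integral_bound_imp_integral[OF this _ A0(2)[OF t] A0(1)]
    have i1: "integrable lborel (\<lambda>y. w y * \<phi> t y)"
      using i(1) m by (simp add: integrable_abs_iff)
    have j: "integrable lborel (\<lambda>y. \<bar>w y * \<phi> t y * pd e V y\<bar>)" "(\<integral>y. \<bar>w y * \<phi> t y * pd e V y\<bar> \<partial>lborel) \<le> A1"
       "integrable lborel (\<lambda>y. w y * \<phi> t y * pd e V y)"
      if e: "e \<in> Basis" for e
    proof -
      have m': "(\<lambda>y. w y * \<phi> t y * pd e V y) \<in> borel_measurable borel"
        by (intro borel_measurable_continuous_onI continuous_on_mult[OF cw] V1_cont e)
      have "(\<integral>\<^sup>+y. ennreal \<bar>w y * \<phi> t y * pd e V y\<bar> \<partial>lborel) \<le> (\<integral>\<^sup>+y. ennreal (norm (\<phi> t y *\<^sub>R grad w y)) \<partial>lborel)"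
      proof (intro nn_integral_mono ennreal_leI)
        fix y
        have "\<bar>w y * \<phi> t y\<bar> * \<bar>pd e V y\<bar> \<le> \<bar>w y * \<phi> t y\<bar> * norm (grad V y)"
          by (intro mult_left_mono abs_pd_le_norm_grad e) auto
        then show "\<bar>w y * \<phi> t y * pd e V y\<bar> \<le> norm (\<phi> t y *\<^sub>R grad w y)"
          using w_pos[of y] by (simp add: grad_w abs_mult ac_simps)
      qed
      also have "\<dots> \<le> ennreal A1" by (rule A1(2)[OF t])
      finally have b: "(\<integral>\<^sup>+y. ennreal \<bar>w y * \<phi> t y * pd e V y\<bar> \<partial>lborel) \<le> ennreal A1" .
      have "(\<lambda>y. \<bar>w y * \<phi> t y * pd e V y\<bar>) \<in> borel_measurable lborel" using m' by simp
      from nn_integral_bound_imp_integral[OF this _ b A1(1)]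
      show "integrable lborel (\<lambda>y. \<bar>w y * \<phi> t y * pd e V y\<bar>)" "(\<integral>y. \<bar>w y * \<phi> t y * pd e V y\<bar> \<partial>lborel) \<le> A1" by auto
      then show "integrable lborel (\<lambda>y. w y * \<phi> t y * pd e V y)"
        using m' by (simp add: integrable_abs_iff)
    qed
    have S: "(\<integral>y. \<bar>w y * \<phi> t y\<bar> \<partial>lborel) + (\<Sum>e\<in>Basis. \<integral>y. \<bar>w y * \<phi> t y * pd e V y\<bar> \<partial>lborel) \<le> A0 + real DIM('a) * A1"
      using i(2) sum_mono[OF j(2)] by (intro add_mono) auto
    have S0: "0 \<le> A0 + real DIM('a) * A1" using A0(1) A1(1) by simp
    have "(\<integral>y. \<bar>w y * \<phi> t y\<bar> * V1_sum y \<partial>lborel) = (\<integral>y. \<bar>w y * \<phi> t y\<bar> + (\<Sum>e\<in>Basis. \<bar>w y * \<phi> t y * pd e V y\<bar>) \<partial>lborel)"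
      by (intro Bochner_Integration.integral_cong) (auto simp: V1_sum_def distrib_left sum_distrib_left abs_mult)
    also have "\<dots> = (\<integral>y. \<bar>w y * \<phi> t y\<bar> \<partial>lborel) + (\<Sum>e\<in>Basis. \<integral>y. \<bar>w y * \<phi> t y * pd e V y\<bar> \<partial>lborel)"
      using i(1) j(1) by (simp add: Bochner_Integration.integral_sum)
    also note S
    also have "A0 + real DIM('a) * A1 \<le> ?A" using S0 L_nonneg mult_right_mono[of 1 "1 + L"] by simp
    finally have V1: "(\<integral>y. \<bar>w y * \<phi> t y\<bar> * V1_sum y \<partial>lborel) \<le> ?A" .
    have "mass (\<lambda>y. w y * \<phi> t y) lborel \<le> L * (A0 + real DIM('a) * A1)"
      unfolding mass_def by (intro mult_left_mono L_nonneg S)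
    also have "\<dots> \<le> ?A" using S0 by (intro mult_right_mono) auto
    finally show ?thesis using V1 i1 j(3) by (simp add: adm_def)
  qed
  moreover have "0 \<le> ?A" using A0(1) A1(1) L_nonneg by simp
  ultimately show ?thesis by blast
qed

lemma w_phi_adm: "t \<in> {0..T} \<Longrightarrow> adm (\<lambda>y. w y * \<phi> t y) lborel"
  using w_phi_adm_bound by blast

definition drift :: "real \<Rightarrow> 'a \<Rightarrow> 'a \<Rightarrow> real" where
  "drift t e x = fld (\<lambda>_. 1) (\<rho> t) e x - fld (\<lambda>_. 1) N e x"

text \<open>|grad V| is at most a multiple of 1 + V, so the moment bound of the measure solution
  controls both convolutions uniformly in t and x. This finite speed is what permits a cutoff moving
  ahead of the drift.\<close>

lemma drift_bound: "\<exists>B\<ge>0. \<forall>t\<in>{0..T}. \<forall>e\<in>Basis. \<forall>x. \<bar>drift t e x\<bar> \<le> B"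
proof -
  obtain W where W: "W \<ge> 0" "\<And>t. t \<in> {0..T} \<Longrightarrow> (\<integral>x. 1 + V x \<partial>\<rho> t) \<le> W"
    using rho_weighted_bound by blast
  let ?m = "\<lambda>M. L * ((\<integral>x. 1 + V x \<partial>M) + (\<Sum>e\<in>(Basis::'a set). c * (\<integral>x. 1 + V x \<partial>M)))"
  have m: "mass (\<lambda>_. 1) M \<le> ?m M" if M: "weighted M" for M
    unfolding mass_def
  proof (intro mult_left_mono add_mono sum_mono L_nonneg)
    note a = adm_simps[OF weighted_adm[OF M]] and wm = weighted_simps[OF M]
    show "(\<integral>y. \<bar>1::real\<bar> \<partial>M) \<le> (\<integral>x. 1 + V x \<partial>M)"
      using a wm V_nonneg by (intro integral_mono) auto
    fix e :: 'a assume e: "e \<in> Basis"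
    have "(\<integral>y. \<bar>1 * pd e V y\<bar> \<partial>M) \<le> (\<integral>y. c * (1 + V y) \<partial>M)"
      by (intro integral_mono integrable_abs a(3) e integrable_mult_right wm) (use V1_bd[OF e] in auto)
    then show "(\<integral>y. \<bar>1 * pd e V y\<bar> \<partial>M) \<le> c * (\<integral>x. 1 + V x \<partial>M)" by simp
  qed
  define B where "B = L * (W + (\<Sum>e\<in>(Basis::'a set). c * W)) + mass (\<lambda>_. 1) N"
  have "\<bar>drift t e x\<bar> \<le> B" if t: "t \<in> {0..T}" and e: "e \<in> Basis" for t e x
  proof -
    have "\<bar>drift t e x\<bar> \<le> mass (\<lambda>_. 1) (\<rho> t) + mass (\<lambda>_. 1) N"
      using fld_bound(1)[OF weighted_adm[OF rho_weighted[OF t]] e, of x] fld_bound(1)[OF weighted_adm[OF rho_inf_weighted] e, of x]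
      unfolding drift_def by linarith
    moreover have "?m (\<rho> t) \<le> L * (W + (\<Sum>e\<in>(Basis::'a set). c * W))"
      by (intro mult_left_mono add_mono sum_mono L_nonneg c_nonneg W(2) t)
    ultimately show ?thesis using m[OF rho_weighted[OF t]] unfolding B_def by linarith
  qed
  then show ?thesis by (intro exI[of _ "max B 0"]) (auto simp: le_max_iff_disj)
qed

section \<open>Measurability in time of the dual norm and of the source\<close>

definition a :: "real \<Rightarrow> real" where "a t = BLV_dual_norm V (\<rho> t) N"

lemma a_nonneg: "t \<in> {0..T} \<Longrightarrow> 0 \<le> a t"
  unfolding a_def by (rule BLV_nonneg[OF rho_weighted rho_inf_weighted])

lemma a_bounded: "\<exists>A. \<forall>t\<in>{0..T}. a t \<le> A"
proof -
  obtain W where W: "\<And>t. t \<in> {0..T} \<Longrightarrow> (\<integral>x. 1 + V x \<partial>\<rho> t) \<le> W"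
    using rho_weighted_bound by blast
  have "a t \<le> W + (\<integral>x. 1 + V x \<partial>N)" if "t \<in> {0..T}" for t
    unfolding a_def using BLV_le[OF rho_weighted[OF that] rho_inf_weighted] W[OF that] by linarith
  then show ?thesis by blast
qed

definition pairing :: "('a \<Rightarrow> real) \<Rightarrow> real \<Rightarrow> real" where
  "pairing \<psi> t = (\<integral>x. \<psi> x * (1 + V x) \<partial>\<rho> t) - (\<integral>x. \<psi> x * (1 + V x) \<partial>N)"

lemma pairing_continuous:
  assumes \<psi>: "continuous_on UNIV \<psi>" and supp: "\<And>x. norm x > r \<Longrightarrow> \<psi> x = 0"
  shows "continuous_on {0..T} (pairing \<psi>)"
proof -
  have c: "continuous_on UNIV (\<lambda>x. \<psi> x * (1 + V x))" by (intro continuous_intros \<psi> V_cont)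
  obtain B where "B > 0" "\<And>x. \<bar>\<psi> x * (1 + V x)\<bar> \<le> B"
    using bounded_of_continuous_support[OF c, of r] supp by auto
  then have "bounded (range (\<lambda>x. \<psi> x * (1 + V x)))" by (auto simp: bounded_iff)
  with c have "continuous_on {0..} (\<lambda>t. \<integral>x. \<psi> x * (1 + V x) \<partial>\<rho> t)"
    using meas_sol unfolding measure_solution_def by blast
  then have "continuous_on {0..T} (\<lambda>t. \<integral>x. \<psi> x * (1 + V x) \<partial>\<rho> t)"
    by (rule continuous_on_subset) auto
  then show ?thesis unfolding pairing_def by (intro continuous_intros)
qed

text \<open>
  Narrow continuity only controls bounded functions, whence the restriction to compactly supported test
  functions; it makes the dual norm lower semicontinuous, hence measurable, in time.
\<close>

lemma a_greater_iff:
  assumes t: "t \<in> {0..T}"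
  shows "k < a t \<longleftrightarrow> (\<exists>\<psi> r. bounded_lip 1 \<psi> \<and> (\<forall>x. norm x > r \<longrightarrow> \<psi> x = 0) \<and> k < pairing \<psi> t)"
proof
  assume "\<exists>\<psi> r. bounded_lip 1 \<psi> \<and> (\<forall>x. norm x > r \<longrightarrow> \<psi> x = 0) \<and> k < pairing \<psi> t"
  then show "k < a t"
    using BLV_upper[OF rho_weighted[OF t] rho_inf_weighted] unfolding pairing_def a_def by (meson less_le_trans)
next
  assume "k < a t"
  moreover have "bounded_lip 1 (\<lambda>x::'a. 0)" by (simp add: bounded_lip_def)
  ultimately obtain \<psi> where \<psi>: "bounded_lip 1 \<psi>" "k < pairing \<psi> t"
    unfolding a_def BLV_dual_norm_alt pairing_def
    using less_cSUP_iff[OF _ BLV_bdd[OF rho_weighted[OF t] rho_inf_weighted], of k] by auto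
  \<comment> \<open>Multiplying by the cutoff raises the Lipschitz constant by at most 2 / (n + 1);
    the prefactor brings the product back into the unit ball.\<close>
  define \<psi>' where "\<psi>' n x = 1 / (1 + 2 / real (Suc n)) * (cutoff (real (Suc n)) 0 x * \<psi> x)" for n x
  have c1: "0 \<le> cutoff (real (Suc n)) 0 x" "cutoff (real (Suc n)) 0 x \<le> 1" for n and x :: 'a
    using cutoff_nonneg[of "real (Suc n)" 0 x] cutoff_le_1[of "real (Suc n)" 0 x] by simp_all
  have lip: "bounded_lip 1 (\<psi>' n)" for n
    unfolding bounded_lip_def
  proof (intro conjI allI)
    fix x y
    let ?\<chi> = "cutoff (real (Suc n)) 0 :: 'a \<Rightarrow> real"
    define k where "k = 1 + 2 / real (Suc n)"
    have k: "k \<ge> 1" by (simp add: k_def)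
    have e: "\<psi>' n z = ?\<chi> z * \<psi> z / k" for z by (simp add: \<psi>'_def k_def)
    have "\<bar>?\<chi> x\<bar> * \<bar>\<psi> x\<bar> \<le> 1 * 1" using c1 \<psi>(1) by (intro mult_mono) (auto simp: bounded_lip_def)
    also have "\<dots> \<le> k" using k by simp
    finally show "\<bar>\<psi>' n x\<bar> \<le> 1" using k by (simp add: e abs_mult divide_le_eq)
    have "\<bar>?\<chi> x * \<psi> x - ?\<chi> y * \<psi> y\<bar> = \<bar>?\<chi> x * (\<psi> x - \<psi> y) + (?\<chi> x - ?\<chi> y) * \<psi> y\<bar>" by (simp add: algebra_simps)
    also have "\<dots> \<le> \<bar>?\<chi> x\<bar> * \<bar>\<psi> x - \<psi> y\<bar> + \<bar>?\<chi> x - ?\<chi> y\<bar> * \<bar>\<psi> y\<bar>"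
      by (metis abs_mult abs_triangle_ineq)
    also have "\<dots> \<le> 1 * norm (x - y) + (2 / real (Suc n) * norm (x - y)) * 1"
      using c1 \<psi>(1) cutoff_lipschitz[of "real (Suc n)" 0 x y]
      by (intro add_mono mult_mono) (auto simp: bounded_lip_def)
    also have "\<dots> = k * norm (x - y)" by (simp add: k_def algebra_simps)
    finally have "\<bar>?\<chi> x * \<psi> x - ?\<chi> y * \<psi> y\<bar> \<le> k * norm (x - y)" .
    moreover have "\<bar>\<psi>' n x - \<psi>' n y\<bar> = \<bar>?\<chi> x * \<psi> x - ?\<chi> y * \<psi> y\<bar> / k"
      using k unfolding e diff_divide_distrib[symmetric] by (simp add: abs_mult)
    ultimately show "\<bar>\<psi>' n x - \<psi>' n y\<bar> \<le> 1 * norm (x - y)"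
      using k by (simp add: divide_le_eq mult.commute)
  qed
  have lim: "(\<lambda>n. \<psi>' n x) \<longlonglongrightarrow> \<psi> x" for x
  proof -
    have "(\<lambda>n. 1 / (1 + 2 / real (Suc n)) * (cutoff (real (Suc n)) 0 x * \<psi> x)) \<longlonglongrightarrow> 1 / (1 + 0) * (1 * \<psi> x)"
      by (intro tendsto_intros cutoff_tendsto LIMSEQ_Suc[OF lim_const_over_n]) auto
    then show ?thesis by (simp add: \<psi>'_def)
  qed
  have "(\<lambda>n. \<integral>x. \<psi>' n x * (1 + V x) \<partial>M) \<longlonglongrightarrow> (\<integral>x. \<psi> x * (1 + V x) \<partial>M)" if M: "weighted M" for M
  proof (rule integral_dominated_convergence[where w="\<lambda>x. 1 + V x"])
    show "integrable M (\<lambda>x. 1 + V x)" by (rule weighted_simps[OF M])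
    show "AE x in M. (\<lambda>n. \<psi>' n x * (1 + V x)) \<longlonglongrightarrow> \<psi> x * (1 + V x)"
      by (intro AE_I2 tendsto_intros lim)
    show "AE x in M. norm (\<psi>' n x * (1 + V x)) \<le> 1 + V x" for n
    proof (intro AE_I2)
      fix x
      have "\<bar>\<psi>' n x\<bar> * (1 + V x) \<le> 1 * (1 + V x)"
        using lip[of n] V_pos(1)[of x] by (intro mult_right_mono) (auto simp: bounded_lip_def)
      then show "norm (\<psi>' n x * (1 + V x)) \<le> 1 + V x" using V_pos(1)[of x] by (simp add: abs_mult)
    qed
    show "(\<lambda>x. \<psi> x * (1 + V x)) \<in> borel_measurable M" "(\<lambda>x. \<psi>' n x * (1 + V x)) \<in> borel_measurable M" for n
      using integrable_bounded_lip(1)[OF M \<psi>(1)] integrable_bounded_lip(1)[OF M lip] by auto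
  qed
  then have "(\<lambda>n. pairing (\<psi>' n) t) \<longlonglongrightarrow> pairing \<psi> t"
    unfolding pairing_def using rho_weighted[OF t] rho_inf_weighted by (intro tendsto_diff) auto
  then have "\<forall>\<^sub>F n in sequentially. k < pairing (\<psi>' n) t" using \<psi>(2) by (rule order_tendstoD)
  then obtain n where "k < pairing (\<psi>' n) t" using eventually_happens by fastforce
  moreover have "\<psi>' n x = 0" if "norm x > real (Suc n)" for x
    using cutoff_support[of "real (Suc n)" 0 x] that by (simp add: \<psi>'_def)
  ultimately show "\<exists>\<psi> r. bounded_lip 1 \<psi> \<and> (\<forall>x. norm x > r \<longrightarrow> \<psi> x = 0) \<and> k < pairing \<psi> t"
    using lip by blast
qed

text \<open>Superlevel sets are unions of relatively open sets, so the supremum over uncountably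
  many test functions does no harm. The indicator removes the times outside [0,T], for which no
  moment bound has been derived.\<close>

lemma a_measurable: "(\<lambda>r. indicator {0..T} r * a r) \<in> borel_measurable borel"
  unfolding borel_measurable_iff_greater
proof (intro allI)
  fix k :: real
  have 1: "{r \<in> {0..T}. k < a r} \<in> sets borel"
  proof -
    define \<Psi> where "\<Psi> = {\<psi> :: 'a \<Rightarrow> real. bounded_lip 1 \<psi> \<and> (\<exists>r. \<forall>x. norm x > r \<longrightarrow> \<psi> x = 0)}"
    have "openin (top_of_set {0..T}) {r \<in> {0..T}. k < pairing \<psi> r}" if *: "\<psi> \<in> \<Psi>" for \<psi>
    proof -
      obtain r where "bounded_lip 1 \<psi>" "\<forall>x. norm x > r \<longrightarrow> \<psi> x = 0" using * unfolding \<Psi>_def by blast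
      moreover from this have "continuous_on UNIV \<psi>"
        using lipschitz_imp_continuous[of \<psi> 1] by (simp add: bounded_lip_def)
      ultimately have "continuous_on {0..T} (pairing \<psi>)" by (intro pairing_continuous) auto
      from continuous_openin_preimage_gen[OF this open_greaterThan, of k]
      show ?thesis by (simp add: Int_def vimage_def)
    qed
    then have "openin (top_of_set {0..T}) (\<Union>\<psi>\<in>\<Psi>. {r \<in> {0..T}. k < pairing \<psi> r})"
      by (intro openin_Union) blast
    moreover have "(\<Union>\<psi>\<in>\<Psi>. {r \<in> {0..T}. k < pairing \<psi> r}) = {r \<in> {0..T}. k < a r}"
    proof (intro set_eqI iffI)
      fix r assume "r \<in> (\<Union>\<psi>\<in>\<Psi>. {r \<in> {0..T}. k < pairing \<psi> r})"
      then obtain \<psi> where \<psi>: "\<psi> \<in> \<Psi>" "r \<in> {0..T}" "k < pairing \<psi> r" by blast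
      then show "r \<in> {r \<in> {0..T}. k < a r}" using a_greater_iff[OF \<psi>(2), of k] unfolding \<Psi>_def by blast
    next
      fix r assume r: "r \<in> {r \<in> {0..T}. k < a r}"
      then have "r \<in> {0..T}" "k < a r" by auto
      then show "r \<in> (\<Union>\<psi>\<in>\<Psi>. {r \<in> {0..T}. k < pairing \<psi> r})"
        using a_greater_iff[of r k] unfolding \<Psi>_def by blast
    qed
    ultimately show ?thesis by (auto simp: openin_open)
  qed
  show "{r \<in> space borel. k < indicator {0..T} r * a r} \<in> sets borel"
  \<comment> \<open>Outside [0,T] the product is 0, so a negative level is exceeded
    everywhere.\<close>
  proof (cases "k < 0")
    case True
    have "{r \<in> space borel. k < indicator {0..T} r * a r} = UNIV"
      using True a_nonneg by (auto simp: indicator_def intro: less_le_trans)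
    then show ?thesis by simp
  next
    case False
    have "{r \<in> space borel. k < indicator {0..T} r * a r} = {r \<in> {0..T}. k < a r}"
      using False by (auto simp: indicator_def split: if_splits)
    then show ?thesis using 1 by simp
  qed
qed

definition h :: "real \<Rightarrow> real" where "h t = real_of_ereal (Linf_norm (g t))"

lemma g_cont2: "continuous_on UNIV (\<lambda>(t, x). g t x)"
  by (rule test_function_continuous[OF g_test])

lemma g_cont: "continuous_on UNIV (g t)" "continuous_on UNIV (\<lambda>t. g t x)"
proof -
  have "continuous_on UNIV (\<lambda>x. case (t, x) of (t, x) \<Rightarrow> g t x)"
    by (rule continuous_on_compose2[OF g_cont2]) (auto intro!: continuous_intros)
  then show "continuous_on UNIV (g t)" by simp
  have "continuous_on UNIV (\<lambda>t. case (t, x) of (t, x) \<Rightarrow> g t x)"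
    by (rule continuous_on_compose2[OF g_cont2]) (auto intro!: continuous_intros)
  then show "continuous_on UNIV (\<lambda>t. g t x)" by simp
qed

lemma g_bounded: "\<exists>G. \<forall>t x. \<bar>g t x\<bar> \<le> G"
  using test_function_bounded[OF g_test] by auto

lemma g_le_h: "\<bar>g t x\<bar> \<le> h t"
proof -
  obtain G where "\<And>t x. \<bar>g t x\<bar> \<le> G" using g_bounded by blast
  then show ?thesis unfolding h_def by (intro Linf_norm_continuous(1)[OF g_cont(1)])
qed

lemma h_le: "(\<And>x. \<bar>g t x\<bar> \<le> k) \<Longrightarrow> h t \<le> k"
proof -
  obtain G where "\<And>t x. \<bar>g t x\<bar> \<le> G" using g_bounded by blast
  then show "(\<And>x. \<bar>g t x\<bar> \<le> k) \<Longrightarrow> h t \<le> k" unfolding h_def by (intro Linf_norm_continuous(2)[OF g_cont(1)])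
qed

lemma h_nonneg: "0 \<le> h t"
  using g_le_h[of t 0] by linarith

text \<open>For the continuous slices of g the essential supremum is the supremum, so a superlevel
  set is a union over x of open sets of times.\<close>

lemma h_measurable: "h \<in> borel_measurable borel"
  unfolding borel_measurable_iff_greater
proof (intro allI)
  fix k :: real
  have "k < h t \<longleftrightarrow> (\<exists>x. k < \<bar>g t x\<bar>)" for t
    using h_le[of t k] less_le_trans[OF _ g_le_h] by (auto simp: not_le[symmetric])
  then have "{t \<in> space borel. k < h t} = (\<Union>x. {t. k < \<bar>g t x\<bar>})"
    by auto
  moreover have "open (\<Union>x. {t. k < \<bar>g t x\<bar>})"
    by (intro open_UN ballI open_Collect_less continuous_intros g_cont)
  ultimately show "{t \<in> space borel. k < h t} \<in> sets borel" by simp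
qed

end

section \<open>The localised energy and its differential inequality\<close>

lemma cutoff_slope_support:
  assumes "R > 0" "s \<ge> 0" "norm x > R"
  shows "cutoff_slope R s x = 0"
proof -
  have "R \<le> jb x + s" using norm_le_jb[of x] assms by linarith
  then have "1 - (jb x + s) / R \<le> 0" using assms by (simp add: field_simps)
  then show ?thesis by (simp add: cutoff_slope_def)
qed

context stein_setting
begin

text \<open>The second moment that Cauchy-Schwarz extracts from the source term g (1 + V); the
  summand 1 makes positivity immediate.\<close>

definition D :: real where "D = (\<integral>x. w x * (1 + V x)\<^sup>2 \<partial>lborel) + 1"

lemma D_pos: "D > 0"
proof -
  have "0 \<le> (\<integral>x. w x * (1 + V x)\<^sup>2 \<partial>lborel)" using w_pos by (intro Bochner_Integration.integral_nonneg) (simp add: less_imp_le)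
  then show ?thesis by (simp add: D_def)
qed

end

context stein_dual
begin

definition u :: "real \<Rightarrow> 'a \<Rightarrow> real" where "u t y = w y * \<phi> t y"

definition ddrift :: "real \<Rightarrow> 'a \<Rightarrow> 'a \<Rightarrow> real" where
  "ddrift t e x = dfld (\<lambda>_. 1) (\<rho> t) e x - dfld (\<lambda>_. 1) N e x"

definition dphi :: "real \<Rightarrow> 'a \<Rightarrow> real" where
  "dphi t x = (\<Sum>e\<in>Basis. pd e (\<phi> t) x * drift t e x) - dvg (u t) lborel x + g t x * (1 + V x)"

lemma u_adm: "t \<in> {0..T} \<Longrightarrow> adm (u t) lborel"
  using w_phi_adm by (simp add: u_def[abs_def])

lemma u_cont: "t \<in> {0..T} \<Longrightarrow> continuous_on UNIV (u t)"
  unfolding u_def by (intro continuous_intros w_cont phi_cont)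

lemma drift_continuous: "t \<in> {0..T} \<Longrightarrow> e \<in> Basis \<Longrightarrow> continuous_on UNIV (drift t e)"
  unfolding drift_def
  by (intro continuous_intros fld_continuous weighted_adm rho_weighted rho_inf_weighted)

lemma ddrift_continuous: "t \<in> {0..T} \<Longrightarrow> e \<in> Basis \<Longrightarrow> continuous_on UNIV (ddrift t e)"
  unfolding ddrift_def
  by (intro continuous_intros dfld_continuous weighted_adm rho_weighted rho_inf_weighted)

lemma drift_deriv:
  assumes "t \<in> {0..T}" "e \<in> Basis"
  shows "((\<lambda>s. drift t e (x + s *\<^sub>R e)) has_real_derivative ddrift t e (x + s *\<^sub>R e)) (at s)"
  unfolding drift_def ddrift_def
  by (intro DERIV_diff fld_deriv weighted_adm rho_weighted rho_inf_weighted assms)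

lemma divergence_drift_le:
  assumes "t \<in> {0..T}"
  shows "(\<Sum>e\<in>Basis. ddrift t e x - pd e V x * drift t e x) \<le> dvg_const * a t"
proof -
  have "(\<Sum>e\<in>Basis. ddrift t e x - pd e V x * drift t e x) = dvg (\<lambda>_. 1) (\<rho> t) x - dvg (\<lambda>_. 1) N x"
    unfolding dvg_def ddrift_def drift_def sum_subtractf[symmetric] by (intro sum.cong) (auto simp: algebra_simps)
  then show ?thesis
    using dvg_diff_le[OF rho_weighted[OF assms] rho_inf_weighted] by (simp add: a_def)
qed

lemma phi_time_deriv:
  assumes t: "t \<in> {0..T}"
  shows "((\<lambda>s. \<phi> s x) has_real_derivative dphi t x) (at t within {0..T})"
proof -
  have "((\<lambda>s. \<phi> s x) has_real_derivative dual_rhs K V (\<rho> t) N (g t) (\<phi> t) x) (at t within {0..T})"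
    using dual_sol t unfolding dual_solution_def by blast
  then show ?thesis
    unfolding dual_rhs_eq[OF rho_weighted[OF t] rho_inf_weighted w_phi_adm[OF t]] dphi_def drift_def u_def .
qed

lemma dphi_continuous: "t \<in> {0..T} \<Longrightarrow> continuous_on UNIV (dphi t)"
  unfolding dphi_def
  by (intro continuous_intros phi1_cont drift_continuous dvg_continuous u_adm g_cont V_cont)

context
  fixes Bd R :: real
  assumes Bd: "0 \<le> Bd" "\<forall>t\<in>{0..T}. \<forall>e\<in>Basis. \<forall>x. \<bar>drift t e x\<bar> \<le> Bd" and R: "R > 0"
begin

lemma drift_le: "t \<in> {0..T} \<Longrightarrow> e \<in> Basis \<Longrightarrow> \<bar>drift t e x\<bar> \<le> Bd"
  using Bd(2) by blast

text \<open>Bounds the sum of the absolute components of the drift, the form in which the drift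
  meets the gradient of the cutoff.\<close>

definition B :: real where "B = real DIM('a) * Bd"

text \<open>The drift is bounded by \<open>B\<close>, so the boundary of the cutoff moves at least as fast as the drift.\<close>

definition chi :: "real \<Rightarrow> 'a \<Rightarrow> real" where "chi t = cutoff R (B * (T - t))"

definition slope :: "real \<Rightarrow> 'a \<Rightarrow> real" where "slope t = cutoff_slope R (B * (T - t))"

definition energy :: "real \<Rightarrow> real" where "energy t = (\<integral>x. w x * chi t x * (\<phi> t x)\<^sup>2 \<partial>lborel)"

definition denergy :: "real \<Rightarrow> 'a \<Rightarrow> real" where
  "denergy t x = w x * (B * slope t x * (\<phi> t x)\<^sup>2 + chi t x * (2 * \<phi> t x * dphi t x))"

lemma B_nonneg: "0 \<le> B" using Bd by (simp add: B_def)

lemma shift_nonneg: "t \<in> {0..T} \<Longrightarrow> 0 \<le> B * (T - t)"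
  using B_nonneg by simp

lemma chi_simps:
  assumes "t \<in> {0..T}"
  shows "0 \<le> chi t x" "chi t x \<le> 1" "norm x > R \<Longrightarrow> chi t x = 0"
    "0 \<le> slope t x" "slope t x \<le> 2 / R" "norm x > R \<Longrightarrow> slope t x = 0"
  unfolding chi_def slope_def using R shift_nonneg[OF assms]
  by (auto intro: cutoff_nonneg cutoff_le_1 cutoff_support cutoff_slope_nonneg cutoff_slope_le cutoff_slope_support)

lemma chi_continuous: "continuous_on UNIV (chi t)" "continuous_on UNIV (slope t)"
  "continuous_on UNIV (pd e (chi t))" "chi t differentiable_on UNIV"
  unfolding chi_def slope_def
  by (intro cutoff_continuous[OF R] cutoff_slope_continuous[OF R] pd_cutoff_continuous[OF R] cutoff_differentiable[OF R])+

lemma chi_time_deriv: "((\<lambda>t. chi t x) has_real_derivative B * slope t x) (at t within S)"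
proof -
  have "((\<lambda>t. B * (T - t)) has_real_derivative - B) (at t)" by (auto intro!: derivative_eq_intros)
  from DERIV_chain2[OF cutoff_time_deriv[OF R] this]
  show ?thesis unfolding chi_def slope_def by (auto intro: has_field_derivative_at_within simp: mult.commute)
qed

lemma energy_integrand_deriv:
  assumes t: "t \<in> {0..T}"
  shows "((\<lambda>t. w x * chi t x * (\<phi> t x)\<^sup>2) has_real_derivative denergy t x) (at t within {0..T})"
  unfolding denergy_def
  by (rule derivative_eq_intros phi_time_deriv[OF t] chi_time_deriv refl)+ (simp add: algebra_simps)

lemma denergy_continuous: "t \<in> {0..T} \<Longrightarrow> continuous_on UNIV (denergy t)"
  unfolding denergy_def
  by (intro continuous_intros w_cont chi_continuous phi_cont dphi_continuous)

lemma denergy_support: "t \<in> {0..T} \<Longrightarrow> norm x > R \<Longrightarrow> denergy t x = 0"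
  by (simp add: denergy_def chi_simps)

text \<open>The majorant for differentiating the energy under the integral. The cutoff confines
  everything to a ball; there \<phi> and its gradient are bounded uniformly in time by compactness,
  and the nonlocal term by the uniform L^1 masses.\<close>

lemma denergy_bounded: "\<exists>Q\<ge>0. \<forall>t\<in>{0..T}. \<forall>x. \<bar>denergy t x\<bar> \<le> Q * indicator (cball 0 R) x"
proof -
  obtain P where P: "P \<ge> 0" "\<And>t x. t \<in> {0..T} \<Longrightarrow> norm x \<le> R \<Longrightarrow> \<bar>\<phi> t x\<bar> \<le> P"
    "\<And>t x e. t \<in> {0..T} \<Longrightarrow> norm x \<le> R \<Longrightarrow> e \<in> Basis \<Longrightarrow> \<bar>pd e (\<phi> t) x\<bar> \<le> P"
    using phi_bounded_on_cball[of R] by blast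
  obtain A where A: "A \<ge> 0" "\<And>t. t \<in> {0..T} \<Longrightarrow> mass (u t) lborel \<le> A"
    using w_phi_adm_bound unfolding u_def[abs_def] by blast
  obtain G where G: "\<And>t x. \<bar>g t x\<bar> \<le> G" using g_bounded by blast
  obtain Wb where Wb: "Wb > 0" "\<And>x. norm x \<le> R \<Longrightarrow> \<bar>w x\<bar> \<le> Wb" using continuous_bounded_on_cball[OF w_cont] by blast
  obtain Vb where Vb: "Vb > 0" "\<And>x. norm x \<le> R \<Longrightarrow> \<bar>V x\<bar> \<le> Vb" using continuous_bounded_on_cball[OF V_cont] by blast
  have "continuous_on UNIV V1_sum" unfolding V1_sum_def by (intro continuous_intros V1_cont)
  then obtain S where S: "S > 0" "\<And>x. norm x \<le> R \<Longrightarrow> \<bar>V1_sum x\<bar> \<le> S" using continuous_bounded_on_cball by blast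
  have G0: "0 \<le> G" using G[of 0 0] by linarith
  define Dp where "Dp = real DIM('a) * (P * Bd) + real DIM('a) * A * S + G * (1 + Vb)"
  define Q where "Q = Wb * (B * (2 / R) * P\<^sup>2 + 1 * (2 * P * Dp))"
  have Dp: "\<bar>dphi t x\<bar> \<le> Dp" if t: "t \<in> {0..T}" and x: "norm x \<le> R" for t x
  proof -
    have "\<bar>\<Sum>e\<in>Basis. pd e (\<phi> t) x * drift t e x\<bar> \<le> (\<Sum>e\<in>(Basis::'a set). \<bar>pd e (\<phi> t) x * drift t e x\<bar>)" by (rule sum_abs)
    also have "\<dots> \<le> (\<Sum>e\<in>(Basis::'a set). P * Bd)"
      unfolding abs_mult by (intro sum_mono mult_mono P(3) drift_le t x P(1)) auto
    finally have 1: "\<bar>\<Sum>e\<in>Basis. pd e (\<phi> t) x * drift t e x\<bar> \<le> real DIM('a) * (P * Bd)" by simp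
    have "\<bar>dvg (u t) lborel x\<bar> \<le> real DIM('a) * mass (u t) lborel * V1_sum x" by (rule dvg_bound[OF u_adm[OF t]])
    also have "\<dots> \<le> real DIM('a) * A * S"
      using S(2)[OF x] A t mass_nonneg[OF u_adm[OF t]] by (intro mult_mono) (auto simp: V1_sum_def add_nonneg_nonneg sum_nonneg)
    finally have 2: "\<bar>dvg (u t) lborel x\<bar> \<le> real DIM('a) * A * S" .
    have "\<bar>g t x\<bar> * \<bar>1 + V x\<bar> \<le> G * (1 + Vb)"
      using Vb(2)[OF x] V_nonneg[of x] by (intro mult_mono G G0) auto
    then have "\<bar>g t x * (1 + V x)\<bar> \<le> G * (1 + Vb)" by (simp add: abs_mult)
    with 1 2 show ?thesis unfolding dphi_def Dp_def by linarith
  qed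
  have Dp0: "0 \<le> Dp" using P(1) Bd(1) A(1) S(1) G0 Vb(1) by (simp add: Dp_def)
  have Q0: "0 \<le> Q" using Wb(1) B_nonneg R P(1) Dp0 by (simp add: Q_def)
  have "\<bar>denergy t x\<bar> \<le> Q * indicator (cball 0 R) x" if t: "t \<in> {0..T}" for t x
  proof (cases "norm x \<le> R")
    case False
    then show ?thesis using denergy_support[OF t] Q0 by simp
  next
    case x: True
    note c = chi_simps[OF t, of x]
    have "\<bar>B * slope t x * (\<phi> t x)\<^sup>2\<bar> \<le> B * (2 / R) * P\<^sup>2"
      unfolding abs_mult power_abs power2_abs using c P(2)[OF t x] B_nonneg R P(1)
      by (intro mult_mono) (auto simp: abs_le_square_iff[symmetric] intro!: mult_nonneg_nonneg)
    moreover have "\<bar>chi t x * (2 * \<phi> t x * dphi t x)\<bar> \<le> 1 * (2 * P * Dp)"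
      unfolding abs_mult using c P(2)[OF t x] Dp[OF t x] P(1)
      by (intro mult_mono) auto
    ultimately have "\<bar>B * slope t x * (\<phi> t x)\<^sup>2 + chi t x * (2 * \<phi> t x * dphi t x)\<bar> \<le> B * (2 / R) * P\<^sup>2 + 1 * (2 * P * Dp)"
      by linarith
    then have "\<bar>denergy t x\<bar> \<le> Q" 
      unfolding denergy_def Q_def abs_mult[of "w x"] using Wb(1) Wb(2)[OF x] by (intro mult_mono) auto
    then show ?thesis using x by simp
  qed
  with Q0 show ?thesis by blast
qed

lemma energy_integrable: "t \<in> {0..T} \<Longrightarrow> integrable lborel (\<lambda>x. w x * chi t x * (\<phi> t x)\<^sup>2)"
  by (rule continuous_imp_integrable_support[of _ R])
     (auto intro!: continuous_intros w_cont chi_continuous phi_cont simp: chi_simps)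

lemma energy_deriv:
  assumes t: "t \<in> {0..T}"
  shows "(energy has_real_derivative (\<integral>x. denergy t x \<partial>lborel)) (at t within {0..T})"
proof -
  obtain Q where Q: "\<And>t x. t \<in> {0..T} \<Longrightarrow> \<bar>denergy t x\<bar> \<le> Q * indicator (cball 0 R) x"
    using denergy_bounded by blast
  show ?thesis
    unfolding energy_def
  proof (rule has_real_derivative_integral[where g="\<lambda>x. Q * indicator (cball 0 R) x"])
    show "integrable lborel (\<lambda>y::'a. Q * indicator (cball 0 R) y)"
      by (intro integrable_mult_right integrable_real_indicator) (use emeasure_bounded_finite[of "cball 0 R"] in auto)
    show "denergy t \<in> borel_measurable lborel"
      using borel_measurable_continuous_onI[OF denergy_continuous[OF t]] by simp
  qed (use t energy_integrable energy_integrand_deriv Q in auto)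
qed

lemma energy_nonneg: "t \<in> {0..T} \<Longrightarrow> 0 \<le> energy t"
  unfolding energy_def using w_pos chi_simps(1) by (intro Bochner_Integration.integral_nonneg) (simp add: less_imp_le)

lemma denergy_integral_bounded: "\<exists>Q. \<forall>t\<in>{0..T}. \<bar>\<integral>x. denergy t x \<partial>lborel\<bar> \<le> Q"
proof -
  obtain Q where Q: "\<And>t x. t \<in> {0..T} \<Longrightarrow> \<bar>denergy t x\<bar> \<le> Q * indicator (cball 0 R) x"
    using denergy_bounded by blast
  have i: "integrable lborel (\<lambda>y::'a. Q * indicator (cball 0 R) y)"
    by (intro integrable_mult_right integrable_real_indicator) (use emeasure_bounded_finite[of "cball 0 R"] in auto)
  have "\<bar>\<integral>x. denergy t x \<partial>lborel\<bar> \<le> (\<integral>x. Q * indicator (cball 0 R) x \<partial>(lborel::'a measure))" if t: "t \<in> {0..T}" for t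
    by (rule integral_abs_bound_integral[OF continuous_imp_integrable_support[OF denergy_continuous[OF t] denergy_support[OF t]] i Q[OF t]])
  then show ?thesis by blast
qed

text \<open>The nonlocal term of the localised energy. The cutoff stands outside the field generated
  by u, so this is not a value of the quadratic form of \<open>K\<close> and has no evident
  sign.\<close>

definition kappa :: "real \<Rightarrow> real" where
  "kappa t = (\<integral>x. chi t x * (u t x * dvg (u t) lborel x) \<partial>lborel)"

text \<open>Cauchy-Schwarz for the measure w chi dx, derived from the nonnegative square of |\<phi>|
  - s (1 + V) for all real s.\<close>

lemma weight_pairing_le:
  assumes t: "t \<in> {0..T}"
  shows "(\<integral>x. w x * chi t x * (\<bar>\<phi> t x\<bar> * (1 + V x)) \<partial>lborel) \<le> sqrt (energy t) * sqrt D"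
proof -
  define I where "I = (\<integral>x. w x * chi t x * (\<bar>\<phi> t x\<bar> * (1 + V x)) \<partial>lborel)"
  have ii: "integrable lborel (\<lambda>x. w x * chi t x * (\<bar>\<phi> t x\<bar> * (1 + V x)))"
    "integrable lborel (\<lambda>x. w x * chi t x * (1 + V x)\<^sup>2)"
    by (rule continuous_imp_integrable_support[of _ R];
        auto intro!: continuous_intros w_cont chi_continuous phi_cont t V_cont simp: chi_simps[OF t])+
  have I0: "0 \<le> I" unfolding I_def
  proof (intro Bochner_Integration.integral_nonneg)
    show "0 \<le> w x * chi t x * (\<bar>\<phi> t x\<bar> * (1 + V x))" for x
      using w_pos[of x] chi_simps(1)[OF t, of x] V_pos(1)[of x] by (intro mult_nonneg_nonneg) auto
  qed
  have Dle: "(\<integral>x. w x * chi t x * (1 + V x)\<^sup>2 \<partial>lborel) \<le> D"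
  proof -
    have "(\<integral>x. w x * chi t x * (1 + V x)\<^sup>2 \<partial>lborel) \<le> (\<integral>x. w x * (1 + V x)\<^sup>2 \<partial>lborel)"
    proof (rule integral_mono[OF ii(2) w_weight2_integrable])
      fix x
      have "w x * chi t x \<le> w x * 1" using chi_simps[OF t, of x] w_pos[of x] by (intro mult_left_mono) auto
      then show "w x * chi t x * (1 + V x)\<^sup>2 \<le> w x * (1 + V x)\<^sup>2" by (intro mult_right_mono) auto
    qed
    then show ?thesis by (simp add: D_def)
  qed
  have q: "2 * s * I \<le> energy t + s\<^sup>2 * D" for s
  proof -
    have "0 \<le> (\<integral>x. w x * chi t x * (\<bar>\<phi> t x\<bar> - s * (1 + V x))\<^sup>2 \<partial>lborel)"
      using w_pos chi_simps(1)[OF t] by (intro Bochner_Integration.integral_nonneg) (simp add: less_imp_le)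
    also have "\<dots> = (\<integral>x. w x * chi t x * (\<phi> t x)\<^sup>2 - 2 * s * (w x * chi t x * (\<bar>\<phi> t x\<bar> * (1 + V x)))
        + s\<^sup>2 * (w x * chi t x * (1 + V x)\<^sup>2) \<partial>lborel)"
    proof (intro Bochner_Integration.integral_cong refl)
      fix x
      have "(\<bar>\<phi> t x\<bar> - s * (1 + V x))\<^sup>2 = (\<phi> t x)\<^sup>2 - 2 * s * (\<bar>\<phi> t x\<bar> * (1 + V x)) + s\<^sup>2 * (1 + V x)\<^sup>2"
        unfolding power2_diff power_mult_distrib power2_abs by simp
      then show "w x * chi t x * (\<bar>\<phi> t x\<bar> - s * (1 + V x))\<^sup>2 = w x * chi t x * (\<phi> t x)\<^sup>2
          - 2 * s * (w x * chi t x * (\<bar>\<phi> t x\<bar> * (1 + V x))) + s\<^sup>2 * (w x * chi t x * (1 + V x)\<^sup>2)"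
        by (simp only:) (simp only: distrib_left right_diff_distrib mult.assoc mult.left_commute mult.commute)
    qed
    also have "\<dots> = energy t - 2 * s * I + s\<^sup>2 * (\<integral>x. w x * chi t x * (1 + V x)\<^sup>2 \<partial>lborel)"
      unfolding energy_def I_def using energy_integrable[OF t] ii by simp
    also have "\<dots> \<le> energy t - 2 * s * I + s\<^sup>2 * D" using Dle by (intro add_left_mono mult_left_mono) auto
    finally show ?thesis by simp
  qed
  \<comment> \<open>s = I / D minimises the quadratic polynomial.\<close>
  have "I\<^sup>2 \<le> energy t * D"
    using q[of "I / D"] D_pos by (simp add: power2_eq_square field_simps)
  then have "sqrt (I\<^sup>2) \<le> sqrt (energy t * D)" by (rule real_sqrt_le_mono)
  then show ?thesis using I0 unfolding I_def[symmetric] by (simp add: real_sqrt_mult)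
qed

text \<open>The divergence of the field w chi \<phi>^2 b has integral zero; adding it to -
  \<open>denergy\<close> eliminates grad \<phi>. The remaining integrand is compared pointwise with
  the divergence term, the nonlocal term and the source.\<close>

lemma energy_inequality:
  assumes t: "t \<in> {0..T}"
  shows "- (\<integral>x. denergy t x \<partial>lborel) \<le> dvg_const * a t * energy t + 2 * kappa t + 2 * (sqrt D * h t) * sqrt (energy t)"
proof -
  define P where "P x = (w x * chi t x) * (\<phi> t x * \<phi> t x)" for x
  have dP: "P differentiable_on UNIV"
    unfolding P_def by (intro differentiable_on_mult w_diff chi_continuous(4) phi_diff t)
  have pP: "pd e P x = (w x * chi t x) * (2 * \<phi> t x * pd e (\<phi> t) x) + (w x * pd e (chi t) x - w x * pd e V x * chi t x) * (\<phi> t x)\<^sup>2" for e x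
  proof -
    have "pd e P x = (w x * chi t x) * (\<phi> t x * pd e (\<phi> t) x + pd e (\<phi> t) x * \<phi> t x) + (w x * pd e (chi t) x + pd e w x * chi t x) * (\<phi> t x * \<phi> t x)"
      unfolding P_def[abs_def]
      by (simp only: pd_mult[OF differentiable_on_mult[OF w_diff chi_continuous(4)] differentiable_on_mult[OF phi_diff[OF t] phi_diff[OF t]]]
          pd_mult[OF w_diff chi_continuous(4)] pd_mult[OF phi_diff[OF t] phi_diff[OF t]])
    then show ?thesis by (simp add: pd_w power2_eq_square algebra_simps)
  qed
  have cP: "continuous_on UNIV P" by (rule differentiable_imp_continuous_on[OF dP])
  have cpP: "continuous_on UNIV (pd e P)" if "e \<in> Basis" for e
    unfolding pP[abs_def] by (intro continuous_intros w_cont chi_continuous phi_cont phi1_cont V1_cont t that)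
  have sP: "P x = 0" if "norm x > R" for x using chi_simps(3)[OF t that] by (simp add: P_def)
  have lP: "((\<lambda>s. P (x + s *\<^sub>R e)) has_real_derivative pd e P (x + s *\<^sub>R e)) (at s)" for x e s
    by (rule has_real_derivative_pd_line[OF dP])
  have sP1: "pd e P x = 0" if "norm x > R" for e x
    using has_real_derivative_locally_zero[of P x e "pd e P" R] lP sP that by blast
  define De where "De e x = P x * ddrift t e x + pd e P x * drift t e x" for e x
  have De: "(\<integral>x. De e x \<partial>lborel) = 0" "integrable lborel (De e)" if e: "e \<in> Basis" for e
  proof -
    have cDe: "continuous_on UNIV (De e)"
      unfolding De_def by (intro continuous_intros cP cpP drift_continuous ddrift_continuous t e)
    show "(\<integral>x. De e x \<partial>lborel) = 0"
      by (rule integral_divergence_eq_0[where F="\<lambda>x. P x * drift t e x" and e=e and r=R, OF _ _ cDe])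
         (auto simp: De_def sP intro!: DERIV_mult'[OF lP drift_deriv[OF t e]] continuous_intros cP drift_continuous t e)
    show "integrable lborel (De e)"
      by (rule continuous_imp_integrable_support[OF cDe, of R]) (simp add: De_def sP sP1)
  qed
  have S: "(\<integral>x. (\<Sum>e\<in>Basis. De e x) \<partial>lborel) = 0"
    using De by (simp add: Bochner_Integration.integral_sum)
  have iS: "integrable lborel (\<lambda>x. \<Sum>e\<in>Basis. De e x)" using De(2) by (rule Bochner_Integration.integrable_sum)
  have iE: "integrable lborel (denergy t)"
    by (rule continuous_imp_integrable_support[OF denergy_continuous[OF t] denergy_support[OF t]])
  define I where "I = (\<integral>x. w x * chi t x * (\<bar>\<phi> t x\<bar> * (1 + V x)) \<partial>lborel)"
  define rhs where "rhs x = dvg_const * a t * (w x * chi t x * (\<phi> t x)\<^sup>2) + 2 * (chi t x * (u t x * dvg (u t) lborel x))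
    + 2 * h t * (w x * chi t x * (\<bar>\<phi> t x\<bar> * (1 + V x)))" for x
  have i1: "integrable lborel (\<lambda>x. chi t x * (u t x * dvg (u t) lborel x))"
    and i2: "integrable lborel (\<lambda>x. w x * chi t x * (\<bar>\<phi> t x\<bar> * (1 + V x)))"
    by (rule continuous_imp_integrable_support[of _ R];
        auto intro!: continuous_intros w_cont chi_continuous phi_cont u_cont dvg_continuous u_adm t V_cont simp: chi_simps[OF t])+
  have irhs: "integrable lborel rhs" "(\<integral>x. rhs x \<partial>lborel) = dvg_const * a t * energy t + 2 * kappa t + 2 * h t * I"
    unfolding rhs_def energy_def kappa_def I_def using energy_integrable[OF t] i1 i2 by auto
  have pw: "- denergy t x + (\<Sum>e\<in>Basis. De e x) \<le> rhs x" for x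
  proof -
    define m where "m = (\<Sum>e\<in>Basis. ddrift t e x - pd e V x * drift t e x)"
    define q where "q = (\<Sum>e\<in>Basis. pd e (\<phi> t) x * drift t e x)"
    define r where "r = (\<Sum>e\<in>Basis. pd e (chi t) x * drift t e x)"
    note c = chi_simps[OF t, of x]
    have wc: "0 \<le> w x * chi t x" using w_pos[of x] c by simp
    have "(\<Sum>e\<in>Basis. De e x) = (\<Sum>e\<in>Basis. (w x * chi t x * (\<phi> t x)\<^sup>2) * (ddrift t e x - pd e V x * drift t e x) +
       (2 * (w x * chi t x * \<phi> t x) * (pd e (\<phi> t) x * drift t e x) + (w x * (\<phi> t x)\<^sup>2) * (pd e (chi t) x * drift t e x)))"
      by (intro sum.cong refl) (simp add: De_def pP P_def power2_eq_square algebra_simps)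
    also have "\<dots> = (w x * chi t x * (\<phi> t x)\<^sup>2) * m + (2 * (w x * chi t x * \<phi> t x) * q + (w x * (\<phi> t x)\<^sup>2) * r)"
      unfolding m_def q_def r_def sum_distrib_left sum.distrib ..
    finally have De_eq: "(\<Sum>e\<in>Basis. De e x) = (w x * chi t x * (\<phi> t x)\<^sup>2) * m + (2 * (w x * chi t x * \<phi> t x) * q + (w x * (\<phi> t x)\<^sup>2) * r)" .
    have dp: "dphi t x = q - dvg (u t) lborel x + g t x * (1 + V x)" by (simp add: dphi_def q_def)
    \<comment> \<open>The terms with \<open>q\<close>, the only ones containing grad \<phi>,
      cancel.\<close>
    have eq: "- denergy t x + (\<Sum>e\<in>Basis. De e x) = (w x * chi t x * (\<phi> t x)\<^sup>2) * m + (w x * (\<phi> t x)\<^sup>2) * (r - B * slope t x)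
       + 2 * (chi t x * (u t x * dvg (u t) lborel x)) - 2 * (w x * chi t x * (\<phi> t x * g t x * (1 + V x)))"
      unfolding De_eq denergy_def dp u_def by (simp add: algebra_simps)
    have "(w x * chi t x * (\<phi> t x)\<^sup>2) * m \<le> (w x * chi t x * (\<phi> t x)\<^sup>2) * (dvg_const * a t)"
      using divergence_drift_le[OF t, of x] wc unfolding m_def by (intro mult_left_mono) auto
    \<comment> \<open>The boundary term of the cutoff: each partial derivative of chi is at most
      \<open>slope\<close> in absolute value, so its pairing with the drift is at most
      \<open>B\<close> times \<open>slope\<close>, the time derivative of chi.\<close>
    moreover have "(w x * (\<phi> t x)\<^sup>2) * (r - B * slope t x) \<le> 0"
    proof (rule mult_nonneg_nonpos)
      have "r \<le> (\<Sum>e\<in>(Basis::'a set). slope t x * Bd)"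
        unfolding r_def
      proof (rule sum_mono)
        fix e :: 'a assume e: "e \<in> Basis"
        have "pd e (chi t) x * drift t e x \<le> \<bar>pd e (chi t) x\<bar> * \<bar>drift t e x\<bar>"
          by (metis abs_ge_self abs_mult)
        also have "\<bar>pd e (chi t) x\<bar> = slope t x * (\<bar>x \<bullet> e\<bar> / jb x)"
          using c(4) jb_ge_1[of x] unfolding chi_def slope_def pd_cutoff[OF R] by (simp add: abs_mult)
        also have "slope t x * (\<bar>x \<bullet> e\<bar> / jb x) * \<bar>drift t e x\<bar> \<le> slope t x * 1 * Bd"
          using abs_inner_div_jb_le[of x e] e c(4) drift_le[OF t e] jb_ge_1[of x] 
          by (intro mult_mono mult_left_mono mult_nonneg_nonneg) auto
        finally show "pd e (chi t) x * drift t e x \<le> slope t x * Bd" by simp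
      qed
      then show "r - B * slope t x \<le> 0" by (simp add: B_def algebra_simps)
      show "0 \<le> w x * (\<phi> t x)\<^sup>2" using w_pos[of x] by simp
    qed
    moreover have "- (w x * chi t x * (\<phi> t x * g t x * (1 + V x))) \<le> h t * (w x * chi t x * (\<bar>\<phi> t x\<bar> * (1 + V x)))"
    proof -
      have "- (\<phi> t x * g t x) \<le> \<bar>\<phi> t x\<bar> * \<bar>g t x\<bar>" by (metis abs_ge_minus_self abs_mult)
      also have "\<dots> \<le> \<bar>\<phi> t x\<bar> * h t" by (intro mult_left_mono g_le_h) auto
      finally have "(w x * chi t x * (1 + V x)) * - (\<phi> t x * g t x) \<le> (w x * chi t x * (1 + V x)) * (\<bar>\<phi> t x\<bar> * h t)"
        using wc V_pos(1)[of x] by (intro mult_left_mono) auto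
      then show ?thesis by (simp add: algebra_simps)
    qed
    ultimately show ?thesis unfolding eq rhs_def by (simp add: algebra_simps)
  qed
  have "- (\<integral>x. denergy t x \<partial>lborel) = (\<integral>x. - denergy t x + (\<Sum>e\<in>Basis. De e x) \<partial>lborel)"
    using S iS iE by simp
  also have "\<dots> \<le> (\<integral>x. rhs x \<partial>lborel)"
    by (rule integral_mono[OF _ irhs(1) pw]) (use iS iE in simp)
  also have "\<dots> = dvg_const * a t * energy t + 2 * kappa t + 2 * h t * I" by (rule irhs(2))
  also have "2 * h t * I \<le> 2 * h t * (sqrt (energy t) * sqrt D)"
    using weight_pairing_le[OF t] h_nonneg[of t] unfolding I_def by (intro mult_left_mono) auto
  finally show ?thesis by (simp add: algebra_simps)
qed

end

end

text \<open>A sufficient condition for integrability over an interval that, unlike integrability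
  itself, is stable under products. The indicator is there because nothing is claimed outside
  S.\<close>

definition bounded_measurable_on :: "real set \<Rightarrow> (real \<Rightarrow> real) \<Rightarrow> bool" where
  "bounded_measurable_on S f \<longleftrightarrow> (\<lambda>r. indicator S r * f r) \<in> borel_measurable borel \<and> (\<exists>B. \<forall>r\<in>S. \<bar>f r\<bar> \<le> B)"

lemma bounded_measurable_on_imp_set_integrable:
  "bounded_measurable_on {a..b} f \<Longrightarrow> set_integrable lborel {a..b} f"
  unfolding bounded_measurable_on_def using set_integrable_bounded_interval by blast

lemma bounded_measurable_on_add:
  assumes "bounded_measurable_on S f" "bounded_measurable_on S g"
  shows "bounded_measurable_on S (\<lambda>r. f r + g r)"
proof -
  obtain A B where "\<forall>r\<in>S. \<bar>f r\<bar> \<le> A" "\<forall>r\<in>S. \<bar>g r\<bar> \<le> B" using assms by (auto simp: bounded_measurable_on_def)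
  then have "\<forall>r\<in>S. \<bar>f r + g r\<bar> \<le> A + B" by (auto intro: order_trans[OF abs_triangle_ineq add_mono])
  moreover have "(\<lambda>r. indicator S r * f r + indicator S r * g r) \<in> borel_measurable borel"
    by (rule borel_measurable_add) (use assms in \<open>simp_all add: bounded_measurable_on_def\<close>)
  ultimately show ?thesis unfolding bounded_measurable_on_def distrib_left by blast
qed

lemma bounded_measurable_on_mult:
  assumes "bounded_measurable_on S f" "bounded_measurable_on S g"
  shows "bounded_measurable_on S (\<lambda>r. f r * g r)"
proof -
  obtain A B where AB: "\<forall>r\<in>S. \<bar>f r\<bar> \<le> A" "\<forall>r\<in>S. \<bar>g r\<bar> \<le> B" using assms by (auto simp: bounded_measurable_on_def)
  have "\<bar>f r * g r\<bar> \<le> \<bar>A\<bar> * \<bar>B\<bar>" if "r \<in> S" for r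
    unfolding abs_mult using AB that by (intro mult_mono) (auto intro: order_trans[OF _ abs_ge_self])
  moreover have "(\<lambda>r. (indicator S r * f r) * (indicator S r * g r)) \<in> borel_measurable borel"
    by (rule borel_measurable_times) (use assms in \<open>simp_all add: bounded_measurable_on_def\<close>)
  moreover have "(\<lambda>r. (indicator S r * f r) * (indicator S r * g r)) = (\<lambda>r. indicator S r * (f r * g r))"
    by (auto simp: indicator_def)
  ultimately show ?thesis unfolding bounded_measurable_on_def by auto
qed

lemma bounded_measurable_on_sqrt:
  assumes "bounded_measurable_on S f"
  shows "bounded_measurable_on S (\<lambda>r. sqrt (f r))"
proof -
  obtain A where A: "\<forall>r\<in>S. \<bar>f r\<bar> \<le> A" using assms by (auto simp: bounded_measurable_on_def)
  have "\<bar>sqrt (f r)\<bar> \<le> sqrt A" if "r \<in> S" for r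
  proof -
    \<comment> \<open>\<open>sqrt\<close> is an odd function on the reals, so negative values of f
      are covered as well.\<close>
    have "\<bar>sqrt (f r)\<bar> = sqrt \<bar>f r\<bar>"
      using real_sqrt_minus[of "f r"] by (cases "f r \<ge> 0") (auto simp: abs_if)
    also have "\<dots> \<le> sqrt A" using A that by (intro real_sqrt_le_mono) auto
    finally show ?thesis .
  qed
  moreover have "(\<lambda>r. sqrt (indicator S r * f r)) \<in> borel_measurable borel"
  proof (rule measurable_compose[where g=sqrt and N=borel])
    show "(\<lambda>r. indicator S r * f r) \<in> borel_measurable borel" using assms by (simp add: bounded_measurable_on_def)
    show "sqrt \<in> borel_measurable borel" by (intro borel_measurable_continuous_onI continuous_intros)
  qed
  moreover have "(\<lambda>r. sqrt (indicator S r * f r)) = (\<lambda>r. indicator S r * sqrt (f r))"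
    by (auto simp: indicator_def)
  ultimately show ?thesis unfolding bounded_measurable_on_def by auto
qed

lemma bounded_measurable_on_const: "S \<in> sets borel \<Longrightarrow> bounded_measurable_on S (\<lambda>r. k)"
  unfolding bounded_measurable_on_def by auto

lemma bounded_measurable_on_continuous:
  assumes "continuous_on {a..b} f"
  shows "bounded_measurable_on {a..b} f"
proof -
  have "bounded (f ` {a..b})" by (intro compact_imp_bounded compact_continuous_image assms) auto
  then have "\<exists>B. \<forall>r\<in>{a..b}. \<bar>f r\<bar> \<le> B" by (auto simp: bounded_iff)
  moreover have "(\<lambda>r. indicator {a..b} r *\<^sub>R f r) \<in> borel_measurable borel"
    by (rule borel_measurable_continuous_on_indicator) (use assms in auto)
  ultimately show ?thesis by (simp add: bounded_measurable_on_def)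
qed

lemma ftc_lower_derivative_bound:
  fixes E E' :: "real \<Rightarrow> real"
  assumes "0 \<le> s" "s \<le> t" "t \<le> T"
    and der: "\<And>r. r \<in> {0..T} \<Longrightarrow> (E has_real_derivative E' r) (at r within {0..T})"
  shows "((\<lambda>r. - E' r) has_integral (E s - E t)) {s..t}"
proof -
  have "(E' has_integral (E t - E s)) {s..t}"
  proof (rule fundamental_theorem_of_calculus[OF assms(2)])
    fix r assume "r \<in> {s..t}"
    then have "(E has_real_derivative E' r) (at r within {s..t})"
      using assms by (intro DERIV_subset[OF der]) auto
    then show "(E has_vector_derivative E' r) (at r within {s..t})"
      by (simp add: has_real_derivative_iff_has_vector_derivative)
  qed
  from has_integral_neg[OF this] show ?thesis by simp
qed

context stein_dual
begin

lemma rate_bounded_measurable: "bounded_measurable_on {0..T} (\<lambda>t. dvg_const * a t)"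
proof -
  obtain A where "\<And>t. t \<in> {0..T} \<Longrightarrow> a t \<le> A" using a_bounded by blast
  then have "bounded_measurable_on {0..T} a"
    unfolding bounded_measurable_on_def using a_measurable a_nonneg by (auto intro!: exI[of _ A])
  then show ?thesis by (intro bounded_measurable_on_mult bounded_measurable_on_const) auto
qed

lemma source_bounded_measurable: "bounded_measurable_on {0..T} (\<lambda>t. sqrt D * h t)"
proof -
  obtain G where "\<And>t x. \<bar>g t x\<bar> \<le> G" using g_bounded by blast
  then have "bounded_measurable_on {0..T} h"
    unfolding bounded_measurable_on_def using h_measurable h_nonneg by (auto intro!: exI[of _ G] h_le)
  then show ?thesis by (intro bounded_measurable_on_mult bounded_measurable_on_const) auto
qed

section \<open>Bounds uniform in the cutoff and its removal\<close>

context
  fixes Bd A :: real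
  assumes Bd: "0 \<le> Bd" "\<forall>t\<in>{0..T}. \<forall>e\<in>Basis. \<forall>x. \<bar>drift t e x\<bar> \<le> Bd"
    and mass_A: "\<forall>t\<in>{0..T}. mass (u t) lborel \<le> A \<and> (\<integral>y. \<bar>u t y\<bar> * V1_sum y \<partial>lborel) \<le> A"
begin

lemma mass_le: "t \<in> {0..T} \<Longrightarrow> mass (u t) lborel \<le> A" "t \<in> {0..T} \<Longrightarrow> (\<integral>y. \<bar>u t y\<bar> * V1_sum y \<partial>lborel) \<le> A"
  using mass_A by blast+

abbreviation E :: "nat \<Rightarrow> real \<Rightarrow> real" where "E n \<equiv> energy Bd (real (Suc n))"
abbreviation E' :: "nat \<Rightarrow> real \<Rightarrow> real" where "E' n t \<equiv> \<integral>x. denergy Bd (real (Suc n)) t x \<partial>lborel"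
abbreviation ka :: "nat \<Rightarrow> real \<Rightarrow> real" where "ka n \<equiv> kappa Bd (real (Suc n))"
abbreviation ch :: "nat \<Rightarrow> real \<Rightarrow> 'a \<Rightarrow> real" where "ch n \<equiv> chi Bd (real (Suc n))"

lemma E_facts:
  assumes t: "t \<in> {0..T}"
  shows "0 \<le> E n t" "(E n has_real_derivative E' n t) (at t within {0..T})"
    "- E' n t \<le> dvg_const * a t * E n t + 2 * ka n t + 2 * (sqrt D * h t) * sqrt (E n t)"
  using energy_nonneg[OF Bd _ t, of "real (Suc n)"] energy_deriv[OF Bd _ t, of "real (Suc n)"]
    energy_inequality[OF Bd _ t, of "real (Suc n)"] by simp_all

lemma E_continuous: "continuous_on {0..T} (E n)"
  by (rule DERIV_continuous_on[OF E_facts(2)])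

lemma E_terminal: "E n T = 0"
  unfolding energy_def[OF Bd cutoff_Suc] using terminal by simp

lemma ch_simps: "t \<in> {0..T} \<Longrightarrow> 0 \<le> ch n t x" "t \<in> {0..T} \<Longrightarrow> ch n t x \<le> 1"
  using chi_simps[OF Bd, of "real (Suc n)"] by auto

lemma ch_cont: "continuous_on UNIV (ch n t)"
  using chi_continuous(1)[OF Bd, of "real (Suc n)"] by simp

lemma ch_tendsto: "(\<lambda>n. ch n t x) \<longlonglongrightarrow> 1"
  unfolding chi_def[OF Bd cutoff_Suc] by (rule cutoff_tendsto)

lemma u_dvg_bound:
  assumes t: "t \<in> {0..T}"
  shows "\<bar>u t x * dvg (u t) lborel x\<bar> \<le> real DIM('a) * A * (\<bar>u t x\<bar> * V1_sum x)"
proof -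
  have V: "0 \<le> V1_sum x" by (simp add: V1_sum_def sum_nonneg add_nonneg_nonneg)
  have "\<bar>u t x\<bar> * \<bar>dvg (u t) lborel x\<bar> \<le> \<bar>u t x\<bar> * (real DIM('a) * mass (u t) lborel * V1_sum x)"
    by (intro mult_left_mono dvg_bound u_adm t) auto
  also have "\<dots> \<le> \<bar>u t x\<bar> * (real DIM('a) * A * V1_sum x)"
    by (intro mult_left_mono mult_right_mono mass_le(1) t V) auto
  finally show ?thesis by (simp add: abs_mult ac_simps)
qed

lemma u_dvg_integrable:
  assumes t: "t \<in> {0..T}"
  shows "integrable lborel (\<lambda>x. real DIM('a) * A * (\<bar>u t x\<bar> * V1_sum x))"
    "integrable lborel (\<lambda>x. u t x * dvg (u t) lborel x)"
    "integrable lborel (\<lambda>x. ch n t x * (u t x * dvg (u t) lborel x))"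
proof -
  show i: "integrable lborel (\<lambda>x. real DIM('a) * A * (\<bar>u t x\<bar> * V1_sum x))"
    using integrable_mult_V1_sum[OF u_adm[OF t]] by simp
  have c: "continuous_on UNIV (\<lambda>x. u t x * dvg (u t) lborel x)" "continuous_on UNIV (\<lambda>x. ch n t x * (u t x * dvg (u t) lborel x))"
    by (intro continuous_intros u_cont dvg_continuous u_adm ch_cont t)+
  show "integrable lborel (\<lambda>x. u t x * dvg (u t) lborel x)"
    by (rule Bochner_Integration.integrable_bound[OF i])
       (use borel_measurable_continuous_onI[OF c(1)] order_trans[OF u_dvg_bound[OF t] abs_ge_self] in auto)
  have "\<bar>ch n t x * (u t x * dvg (u t) lborel x)\<bar> \<le> \<bar>u t x * dvg (u t) lborel x\<bar>" for x
    using ch_simps[OF t, of n x] unfolding abs_mult[of "ch n t x"] by (simp add: mult_left_le_one_le)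
  then show "integrable lborel (\<lambda>x. ch n t x * (u t x * dvg (u t) lborel x))"
    by (intro Bochner_Integration.integrable_bound[OF i])
       (use borel_measurable_continuous_onI[OF c(2)] order_trans[OF _ order_trans[OF u_dvg_bound[OF t] abs_ge_self]] in auto)
qed

text \<open>The cutoff is at most 1, so the bound is uniform in n and t: one factor \<open>A\<close>
  is the size of the field generated by u, the other the integral of |u| against
  \<open>V1_sum\<close>.\<close>

lemma ka_le: "t \<in> {0..T} \<Longrightarrow> \<bar>ka n t\<bar> \<le> real DIM('a) * A * A"
proof -
  assume t: "t \<in> {0..T}"
  have A0: "0 \<le> A" using mass_le(1)[OF t] mass_nonneg[OF u_adm[OF t]] by linarith
  have "\<bar>ka n t\<bar> \<le> (\<integral>x. real DIM('a) * A * (\<bar>u t x\<bar> * V1_sum x) \<partial>lborel)"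
    unfolding kappa_def[OF Bd cutoff_Suc]
  proof (rule integral_abs_bound_integral[OF u_dvg_integrable(3)[OF t] u_dvg_integrable(1)[OF t]])
    fix x
    have "\<bar>ch n t x * (u t x * dvg (u t) lborel x)\<bar> \<le> \<bar>u t x * dvg (u t) lborel x\<bar>"
      using ch_simps[OF t, of n x] unfolding abs_mult[of "ch n t x"] by (simp add: mult_left_le_one_le)
    also note u_dvg_bound[OF t]
    finally show "\<bar>ch n t x * (u t x * dvg (u t) lborel x)\<bar> \<le> real DIM('a) * A * (\<bar>u t x\<bar> * V1_sum x)" .
  qed
  also have "\<dots> = real DIM('a) * A * (\<integral>x. \<bar>u t x\<bar> * V1_sum x \<partial>lborel)" by simp
  also have "\<dots> \<le> real DIM('a) * A * A" by (intro mult_left_mono mass_le(2) t mult_nonneg_nonneg A0) auto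
  finally show ?thesis .
qed

lemma ka_tendsto:
  assumes t: "t \<in> {0..T}"
  shows "(\<lambda>n. ka n t) \<longlonglongrightarrow> (\<integral>x. u t x * dvg (u t) lborel x \<partial>lborel)"
  unfolding kappa_def[OF Bd cutoff_Suc]
proof (rule integral_dominated_convergence[OF _ _ u_dvg_integrable(1)[OF t]])
  show "AE x in lborel. (\<lambda>n. ch n t x * (u t x * dvg (u t) lborel x)) \<longlonglongrightarrow> u t x * dvg (u t) lborel x"
  proof (intro AE_I2)
    fix x
    have "(\<lambda>n. ch n t x * (u t x * dvg (u t) lborel x)) \<longlonglongrightarrow> 1 * (u t x * dvg (u t) lborel x)"
      by (intro tendsto_mult ch_tendsto tendsto_const)
    then show "(\<lambda>n. ch n t x * (u t x * dvg (u t) lborel x)) \<longlonglongrightarrow> u t x * dvg (u t) lborel x" by simp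
  qed
  show "AE x in lborel. norm (ch n t x * (u t x * dvg (u t) lborel x)) \<le> real DIM('a) * A * (\<bar>u t x\<bar> * V1_sum x)" for n
  proof (intro AE_I2)
    fix x
    have "\<bar>ch n t x * (u t x * dvg (u t) lborel x)\<bar> \<le> \<bar>u t x * dvg (u t) lborel x\<bar>"
      using ch_simps[OF t, of n x] unfolding abs_mult[of "ch n t x"] by (simp add: mult_left_le_one_le)
    also note u_dvg_bound[OF t]
    finally show "norm (ch n t x * (u t x * dvg (u t) lborel x)) \<le> real DIM('a) * A * (\<bar>u t x\<bar> * V1_sum x)" by simp
  qed
qed (use u_dvg_integrable[OF t] in auto)

lemma u_dvg_integral_nonpos:
  assumes t: "t \<in> {0..T}"
  shows "(\<integral>x. u t x * dvg (u t) lborel x \<partial>lborel) \<le> 0"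
proof (rule integral_dvg_nonpos[OF _ _ u_adm[OF t]])
  show "u t differentiable_on UNIV"
    unfolding u_def[abs_def] by (intro differentiable_on_mult w_diff phi_diff t)
  show "continuous_on UNIV (pd e (u t))" if "e \<in> Basis" for e
    unfolding u_def[abs_def] pd_mult[OF w_diff phi_diff[OF t]] pd_w
    by (intro continuous_intros w_cont phi_cont phi1_cont V1_cont t that)
qed

text \<open>The sign of the nonlocal term is not available for a fixed cutoff; here it is only bounded.\<close>

lemma energy_uniform_bound: "\<exists>Eb\<ge>0. \<forall>n. \<forall>t\<in>{0..T}. E n t \<le> Eb"
proof -
  define C0 where "C0 = real DIM('a) * A * A"
  have C0: "0 \<le> C0" using ka_le[of 0 0] T by (force simp: C0_def)
  let ?al = "\<lambda>t. dvg_const * a t" and ?be = "\<lambda>t. sqrt D * h t + C0"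
  obtain Aa where Aa: "\<And>t. t \<in> {0..T} \<Longrightarrow> \<bar>?al t\<bar> \<le> Aa"
    using rate_bounded_measurable unfolding bounded_measurable_on_def by blast
  have bmbe: "bounded_measurable_on {0..T} ?be"
    by (intro bounded_measurable_on_add source_bounded_measurable bounded_measurable_on_const) auto
  obtain Hb where Hb: "\<And>t. t \<in> {0..T} \<Longrightarrow> \<bar>?be t\<bar> \<le> Hb"
    using bmbe unfolding bounded_measurable_on_def by blast
  have T0: "0 \<in> {0..T}" using T by simp
  have Aa0: "0 \<le> Aa" using Aa[OF T0] by linarith
  have al0: "0 \<le> ?al t" if "t \<in> {0..T}" for t using a_nonneg[OF that] dvg_const_pos by simp
  have be0: "0 \<le> ?be t" for t using h_nonneg[of t] D_pos C0 by simp
  define K0 where "K0 = exp (2 * (Aa * T)) * (1 + 2 * (Hb * T))"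
  have "E n s \<le> K0\<^sup>2" if s: "s \<in> {0..T}" for n s
  proof -
    \<comment> \<open>Adding 1 makes sqrt F at least 1, so the constant bound \<open>C0\<close> of
      the nonlocal term is at most C0 sqrt F and joins the source in the Gronwall
      inequality.\<close>
    define F where "F t = E n t + 1" for t
    obtain Q where Q: "\<And>t. t \<in> {0..T} \<Longrightarrow> \<bar>E n t\<bar> \<le> Q"
      using bounded_measurable_on_continuous[OF E_continuous[of n]] unfolding bounded_measurable_on_def by blast
    have FT: "F T = 1" unfolding F_def E_terminal by simp
    have bmF: "bounded_measurable_on {0..T} F"
      unfolding F_def by (intro bounded_measurable_on_continuous continuous_intros E_continuous)
    have bm: "bounded_measurable_on {0..T} (\<lambda>r. ?al r * F r + 2 * ?be r * sqrt (F r))"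
      by (intro bounded_measurable_on_add bounded_measurable_on_mult bounded_measurable_on_sqrt rate_bounded_measurable
          bmF bmbe source_bounded_measurable bounded_measurable_on_const) auto
    note si = bounded_measurable_on_imp_set_integrable
    have "sqrt (F s) \<le> exp (2 * (LINT r:{s..T}|lborel. ?al r)) * (sqrt (F T) + 2 * (LINT r:{s..T}|lborel. ?be r))"
    proof (rule sqrt_gronwall[OF s, of _ "Q + 1" _ Aa])
      fix s t assume st: "0 \<le> s" "s \<le> t" "t \<le> T"
      have "set_integrable lborel {s..t} (\<lambda>r. ?al r * F r + 2 * ?be r * sqrt (F r))"
        by (rule set_integrable_subset[OF si[OF bm]]) (use st in auto)
      from set_borel_integral_eq_integral[OF this]
      have hi: "((\<lambda>r. ?al r * F r + 2 * ?be r * sqrt (F r)) has_integral (LINT r:{s..t}|lborel. ?al r * F r + 2 * ?be r * sqrt (F r))) {s..t}"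
        by (simp add: has_integral_iff)
      have "E n s - E n t \<le> (LINT r:{s..t}|lborel. ?al r * F r + 2 * ?be r * sqrt (F r))"
      proof (rule has_integral_le[OF ftc_lower_derivative_bound[OF st E_facts(2)] hi])
        fix r assume "r \<in> {s..t}"
        then have r: "r \<in> {0..T}" using st by auto
        have sq: "sqrt (E n r) \<le> sqrt (F r)" "1 \<le> sqrt (F r)" using E_facts(1)[OF r, of n] by (auto simp: F_def)
        have "- E' n r \<le> ?al r * E n r + 2 * ka n r + 2 * (sqrt D * h r) * sqrt (E n r)" by (rule E_facts(3)[OF r])
        also have "\<dots> \<le> ?al r * F r + 2 * (C0 * sqrt (F r)) + 2 * (sqrt D * h r) * sqrt (F r)"
        proof (intro add_mono mult_left_mono)
          show "ka n r \<le> C0 * sqrt (F r)"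
            using ka_le[OF r, of n] mult_left_mono[OF sq(2) C0] unfolding C0_def by linarith
        qed (use al0[OF r] sq h_nonneg[of r] D_pos in \<open>auto simp: F_def\<close>)
        finally show "- E' n r \<le> ?al r * F r + 2 * ?be r * sqrt (F r)" by (simp add: algebra_simps)
      qed
      then show "F s \<le> F t + (LINT r:{s..t}|lborel. ?al r * F r + 2 * ?be r * sqrt (F r))" by (simp add: F_def)
    qed (use E_facts(1) Q Aa al0 be0 si[OF rate_bounded_measurable] si[OF bmbe] si[OF bm] in \<open>auto simp: F_def abs_le_iff\<close>)
    also have "\<dots> \<le> K0"
      unfolding K0_def
    proof (intro mult_mono)
      have int_le: "(LINT r:{s..T}|lborel. f r) \<le> M * T" if bm: "bounded_measurable_on {0..T} f" and M: "\<And>t. t \<in> {0..T} \<Longrightarrow> \<bar>f t\<bar> \<le> M" for f M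
      proof -
        have M0: "0 \<le> M" using M[OF T0] by linarith
        have "(LINT r:{s..T}|lborel. f r) \<le> (LINT r:{s..T}|lborel. M)"
        proof (rule set_integral_mono)
          show "set_integrable lborel {s..T} f" by (rule set_integrable_subset[OF si[OF bm]]) (use s in auto)
          show "set_integrable lborel {s..T} (\<lambda>_. M)" by (rule borel_integrable_atLeastAtMost') auto
          show "f r \<le> M" if "r \<in> {s..T}" for r using M[of r] that s by auto
        qed
        also have "\<dots> = M * (T - s)" using s by (simp add: set_lebesgue_integral_def)
        also have "\<dots> \<le> M * T" using s M0 by (intro mult_left_mono) auto
        finally show ?thesis .
      qed
      show "exp (2 * (LINT r:{s..T}|lborel. ?al r)) \<le> exp (2 * (Aa * T))"
        using int_le[OF rate_bounded_measurable Aa] by simp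
      show "sqrt (F T) + 2 * (LINT r:{s..T}|lborel. ?be r) \<le> 1 + 2 * (Hb * T)"
        using int_le[OF bmbe Hb] by (simp add: FT)
      have "0 \<le> (LINT r:{s..T}|lborel. ?be r)"
        unfolding set_lebesgue_integral_def using be0 by (intro Bochner_Integration.integral_nonneg) (simp add: indicator_def)
      then show "0 \<le> sqrt (F T) + 2 * (LINT r:{s..T}|lborel. ?be r)" by (simp add: FT)
    qed auto
    finally have "F s \<le> K0\<^sup>2" by (rule sqrt_le_D)
    then show ?thesis by (simp add: F_def)
  qed
  then show ?thesis by (intro exI[of _ "K0\<^sup>2"]) auto
qed

definition Einf :: "real \<Rightarrow> real" where "Einf t = (\<integral>x. w x * (\<phi> t x)\<^sup>2 \<partial>lborel)"

lemma w_phi2_measurable: "t \<in> {0..T} \<Longrightarrow> (\<lambda>x. w x * (\<phi> t x)\<^sup>2) \<in> borel_measurable borel"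
  "t \<in> {0..T} \<Longrightarrow> (\<lambda>x. w x * ch n t x * (\<phi> t x)\<^sup>2) \<in> borel_measurable borel"
  by (intro borel_measurable_continuous_onI continuous_intros w_cont phi_cont ch_cont; assumption)+

text \<open>Fatou's lemma along the growing cutoffs, with the energy bound that is uniform in
  n.\<close>

lemma w_phi2_integrable:
  assumes t: "t \<in> {0..T}"
  shows "integrable lborel (\<lambda>x. w x * (\<phi> t x)\<^sup>2)"
proof (rule integrableI_nonneg)
  obtain Eb where Eb: "\<And>n. E n t \<le> Eb" using energy_uniform_bound t by blast
  have lim: "(\<lambda>n. ennreal (w x * ch n t x * (\<phi> t x)\<^sup>2)) \<longlonglongrightarrow> ennreal (w x * 1 * (\<phi> t x)\<^sup>2)" for x
    by (intro tendsto_ennrealI tendsto_intros ch_tendsto)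
  have "(\<integral>\<^sup>+x. ennreal (w x * (\<phi> t x)\<^sup>2) \<partial>lborel) = (\<integral>\<^sup>+x. liminf (\<lambda>n. ennreal (w x * ch n t x * (\<phi> t x)\<^sup>2)) \<partial>lborel)"
    using lim_imp_Liminf[OF _ lim] by (intro nn_integral_cong) simp
  also have "\<dots> \<le> liminf (\<lambda>n. \<integral>\<^sup>+x. ennreal (w x * ch n t x * (\<phi> t x)\<^sup>2) \<partial>lborel)"
    by (rule nn_integral_liminf) (use w_phi2_measurable[OF t] in auto)
  also have "\<dots> \<le> liminf (\<lambda>n. ennreal Eb)"
  proof (intro Liminf_mono always_eventually allI)
    fix n
    have "(\<integral>\<^sup>+x. ennreal (w x * ch n t x * (\<phi> t x)\<^sup>2) \<partial>lborel) = ennreal (E n t)"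
      unfolding energy_def[OF Bd cutoff_Suc]
      by (rule nn_integral_eq_integral[OF energy_integrable[OF Bd cutoff_Suc t]])
         (use w_pos ch_simps[OF t] in \<open>auto simp: less_imp_le\<close>)
    then show "(\<integral>\<^sup>+x. ennreal (w x * ch n t x * (\<phi> t x)\<^sup>2) \<partial>lborel) \<le> ennreal Eb"
      using Eb by (simp add: ennreal_leI)
  qed
  also have "\<dots> < \<infinity>" by (simp add: Liminf_const)
  finally show "(\<integral>\<^sup>+x. ennreal (w x * (\<phi> t x)\<^sup>2) \<partial>lborel) < \<infinity>" .
qed (use w_phi2_measurable[OF t] w_pos in \<open>auto simp: less_imp_le\<close>)

lemma E_le_Einf: "t \<in> {0..T} \<Longrightarrow> E n t \<le> Einf t"
  unfolding energy_def[OF Bd cutoff_Suc] Einf_def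
proof (rule integral_mono[OF energy_integrable[OF Bd cutoff_Suc] w_phi2_integrable])
  fix x assume t: "t \<in> {0..T}"
  have "w x * ch n t x \<le> w x * 1" using ch_simps[OF t, of n x] w_pos[of x] by (intro mult_left_mono) auto
  then show "w x * ch n t x * (\<phi> t x)\<^sup>2 \<le> w x * (\<phi> t x)\<^sup>2" by (intro mult_right_mono) auto
qed

lemma E_tendsto:
  assumes t: "t \<in> {0..T}"
  shows "(\<lambda>n. E n t) \<longlonglongrightarrow> Einf t"
  unfolding energy_def[OF Bd cutoff_Suc] Einf_def
proof (rule integral_dominated_convergence[OF _ _ w_phi2_integrable[OF t]])
  have "(\<lambda>n. w x * ch n t x * (\<phi> t x)\<^sup>2) \<longlonglongrightarrow> w x * 1 * (\<phi> t x)\<^sup>2" for x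
    by (intro tendsto_intros ch_tendsto)
  then show "AE x in lborel. (\<lambda>n. w x * ch n t x * (\<phi> t x)\<^sup>2) \<longlonglongrightarrow> w x * (\<phi> t x)\<^sup>2" by simp
  show "AE x in lborel. norm (w x * ch n t x * (\<phi> t x)\<^sup>2) \<le> w x * (\<phi> t x)\<^sup>2" for n
  proof (intro AE_I2)
    fix x
    have "w x * ch n t x \<le> w x * 1" using ch_simps[OF t, of n x] w_pos[of x] by (intro mult_left_mono) auto
    then show "norm (w x * ch n t x * (\<phi> t x)\<^sup>2) \<le> w x * (\<phi> t x)\<^sup>2"
      using ch_simps[OF t, of n x] w_pos[of x] by (simp add: abs_mult mult_right_mono)
  qed
qed (use w_phi2_measurable[OF t] in auto)

text \<open>The full energy inherits measurability in time as a pointwise limit of the continuous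
  localised energies, and boundedness from their uniform bound.\<close>

lemma Einf_bounded_measurable: "bounded_measurable_on {0..T} Einf"
  unfolding bounded_measurable_on_def
proof (intro conjI)
  obtain Eb where Eb: "\<And>n t. t \<in> {0..T} \<Longrightarrow> E n t \<le> Eb" using energy_uniform_bound by blast
  have "\<bar>Einf t\<bar> \<le> Eb" if t: "t \<in> {0..T}" for t
  proof -
    have "Einf t \<le> Eb" by (rule LIMSEQ_le_const2[OF E_tendsto[OF t]]) (use Eb[OF t] in auto)
    moreover have "0 \<le> Einf t" by (rule LIMSEQ_le_const[OF E_tendsto[OF t]]) (use E_facts(1)[OF t] in auto)
    ultimately show ?thesis by simp
  qed
  then show "\<exists>B. \<forall>r\<in>{0..T}. \<bar>Einf r\<bar> \<le> B" by blast
  show "(\<lambda>r. indicator {0..T} r * Einf r) \<in> borel_measurable borel"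
  proof (rule borel_measurable_LIMSEQ_real)
    show "(\<lambda>r. indicator {0..T} r * E n r) \<in> borel_measurable borel" for n
      using bounded_measurable_on_continuous[OF E_continuous[of n]] by (simp add: bounded_measurable_on_def)
    show "(\<lambda>n. indicator {0..T} r * E n r) \<longlonglongrightarrow> indicator {0..T} r * Einf r" for r
      using E_tendsto[of r] by (cases "r \<in> {0..T}") auto
  qed
qed

lemma Einf_nonneg: "0 \<le> Einf t"
  unfolding Einf_def using w_pos by (intro Bochner_Integration.integral_nonneg) (simp add: less_imp_le)

abbreviation rate :: "real \<Rightarrow> real" where
  "rate r \<equiv> dvg_const * a r * Einf r + 2 * (sqrt D * h r) * sqrt (Einf r)"

lemma rate_bm: "bounded_measurable_on {0..T} rate"
  by (intro bounded_measurable_on_add bounded_measurable_on_mult[OF rate_bounded_measurable Einf_bounded_measurable]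
      bounded_measurable_on_mult bounded_measurable_on_sqrt Einf_bounded_measurable source_bounded_measurable
      bounded_measurable_on_const) auto

text \<open>The differential inequality for fixed n is integrated first and n is sent to infinity
  afterwards. In the limit the nonlocal term contributes at most 0.\<close>

lemma Einf_integral_inequality:
  assumes st: "0 \<le> s" "s \<le> t" "t \<le> T"
  shows "Einf s \<le> Einf t + (LINT r:{s..t}|lborel. rate r)"
proof -
  define C0 where "C0 = real DIM('a) * A * A"
  have sub: "r \<in> {0..T}" if "r \<in> {s..t}" for r using that st by auto
  have si: "set_integrable lborel {s..t} rate"
    by (rule set_integrable_subset[OF bounded_measurable_on_imp_set_integrable[OF rate_bm]]) (use st in auto)
  note hk = set_borel_integral_eq_integral[OF si]
  obtain F where F: "\<And>r. r \<in> {s..t} \<Longrightarrow> \<bar>rate r\<bar> \<le> F"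
    using rate_bm sub unfolding bounded_measurable_on_def by blast
  have rate_abs: "rate absolutely_integrable_on {s..t}"
    by (rule absolutely_integrable_integrable_bound[OF _ hk(1), of "\<lambda>_. F"]) (use F in \<open>auto intro: integrable_const_ivl\<close>)
  \<comment> \<open>The bound at hand for \<open>- E' n\<close> depends on n, which is useless for
    domination. The maximum with \<open>rate\<close> lies between \<open>rate\<close> and
    \<open>rate\<close> plus twice the positive part of \<open>ka n\<close>, where dominated
    convergence applies.\<close>
  define d where "d n r = max (- E' n r) (rate r)" for n r
  \<comment> \<open>A derivative is Henstock-Kurzweil integrable; being bounded as well, it is
    absolutely integrable, which makes the maximum integrable.\<close>
  have Eabs: "(\<lambda>r. - E' n r) absolutely_integrable_on {s..t}" for n
  proof -
    obtain Q where Q: "\<And>r. r \<in> {0..T} \<Longrightarrow> \<bar>E' n r\<bar> \<le> Q"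
      using denergy_integral_bounded[OF Bd cutoff_Suc] by blast
    show ?thesis
      by (rule absolutely_integrable_integrable_bound[of _ _ "\<lambda>_. Q"])
         (use Q sub ftc_lower_derivative_bound[OF st E_facts(2)] in \<open>auto intro: integrable_const_ivl simp: has_integral_iff\<close>)
  qed
  have dint: "d n integrable_on {s..t}" for n
    unfolding d_def by (intro set_lebesgue_integral_eq_integral(1) absolutely_integrable_max_1 Eabs rate_abs)
  have upper: "- E' n r \<le> rate r + 2 * ka n r" if "r \<in> {s..t}" for n r
  proof -
    note r = sub[OF that]
    have "- E' n r \<le> dvg_const * a r * E n r + 2 * ka n r + 2 * (sqrt D * h r) * sqrt (E n r)" by (rule E_facts(3)[OF r])
    also have "\<dots> \<le> dvg_const * a r * Einf r + 2 * ka n r + 2 * (sqrt D * h r) * sqrt (Einf r)"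
      using E_le_Einf[OF r, of n] a_nonneg[OF r] dvg_const_pos h_nonneg[of r] D_pos
      by (intro add_mono mult_left_mono) auto
    finally show ?thesis by simp
  qed
  have dle: "rate r \<le> d n r" "d n r \<le> rate r + 2 * max 0 (ka n r)" if "r \<in> {s..t}" for n r
    using upper[OF that, of n] by (auto simp: d_def max_def)
  have dlim: "(\<lambda>n. d n r) \<longlonglongrightarrow> rate r" if r: "r \<in> {s..t}" for r
  proof (rule tendsto_sandwich[OF _ _ tendsto_const])
    \<comment> \<open>Positivity of the kernel enters the energy argument at this point: the limit
      of \<open>ka n\<close> is nonpositive, so its positive part disappears.\<close>
    have "(\<lambda>n. rate r + 2 * max 0 (ka n r)) \<longlonglongrightarrow> rate r + 2 * max 0 (\<integral>x. u r x * dvg (u r) lborel x \<partial>lborel)"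
      by (intro tendsto_intros tendsto_max ka_tendsto sub r)
    then show "(\<lambda>n. rate r + 2 * max 0 (ka n r)) \<longlonglongrightarrow> rate r"
      using u_dvg_integral_nonpos[OF sub[OF r]] by (simp add: max_absorb1)
  qed (use dle[OF r] in auto)
  have dbound: "norm (d n r) \<le> F + 2 * C0" if r: "r \<in> {s..t}" for n r
  proof -
    have "ka n r \<le> C0" "0 \<le> C0" using ka_le[OF sub[OF r], of n] unfolding C0_def by linarith+
    then show ?thesis using dle[OF r, of n] F[OF r] by auto
  qed
  have lim: "(\<lambda>n. integral {s..t} (d n)) \<longlonglongrightarrow> integral {s..t} rate"
    by (rule dominated_convergence(2)[where h="\<lambda>_. F + 2 * C0"])
       (use dint dbound dlim in \<open>auto intro: integrable_const_ivl\<close>)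
  have "E n s - E n t \<le> integral {s..t} (d n)" for n
    by (rule has_integral_le[OF ftc_lower_derivative_bound[OF st E_facts(2)] integrable_integral[OF dint]])
       (auto simp: d_def)
  moreover have "(\<lambda>n. E n s - E n t) \<longlonglongrightarrow> Einf s - Einf t"
    using st by (intro tendsto_diff E_tendsto) auto
  ultimately have "Einf s - Einf t \<le> integral {s..t} rate"
    by (intro LIMSEQ_le[OF _ lim]) auto
  then show ?thesis using hk(2) by simp
qed

lemma Einf_terminal: "Einf T = 0"
  by (simp add: Einf_def terminal)

lemma sqrt_Einf_le:
  assumes s: "s \<in> {0..T}"
  shows "sqrt (Einf s) \<le> exp (2 * (LINT r:{s..T}|lborel. dvg_const * a r)) * (2 * (LINT r:{s..T}|lborel. sqrt D * h r))"
proof -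
  obtain Eb where Eb: "\<And>t. t \<in> {0..T} \<Longrightarrow> \<bar>Einf t\<bar> \<le> Eb"
    using Einf_bounded_measurable unfolding bounded_measurable_on_def by blast
  obtain Aa where Aa: "\<And>t. t \<in> {0..T} \<Longrightarrow> \<bar>dvg_const * a t\<bar> \<le> Aa"
    using rate_bounded_measurable unfolding bounded_measurable_on_def by blast
  note si = bounded_measurable_on_imp_set_integrable
  have "sqrt (Einf s) \<le> exp (2 * (LINT r:{s..T}|lborel. dvg_const * a r)) * (sqrt (Einf T) + 2 * (LINT r:{s..T}|lborel. sqrt D * h r))"
  proof (rule sqrt_gronwall[OF s, of _ Eb _ Aa])
    show "set_integrable lborel {0..T} rate" by (rule si[OF rate_bm])
    show "Einf s \<le> Einf t + (LINT r:{s..t}|lborel. rate r)" if "0 \<le> s" "s \<le> t" "t \<le> T" for s t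
      by (rule Einf_integral_inequality[OF that])
  qed (use Einf_nonneg Eb Aa a_nonneg dvg_const_pos h_nonneg D_pos si[OF rate_bounded_measurable] si[OF source_bounded_measurable]
       in \<open>auto simp: abs_le_iff\<close>)
  then show ?thesis by (simp add: Einf_terminal)
qed

end

text \<open>The bounds \<open>Bd\<close> and \<open>A\<close> depend on the solution, but serve only
  to build the cutoff and to justify the limits; \<open>C\<close> has to dominate just the factor in
  the exponent and the factor of the source.\<close>

lemma Q_norm_estimate:
  assumes t: "t \<in> {0..T}" and C: "2 * dvg_const \<le> C" "2 * sqrt D \<le> C"
  shows "integrable lborel (\<lambda>x. w x * \<bar>\<phi> t x\<bar>\<^sup>2)"
    and "Q_norm V (\<phi> t) \<le> C * (LINT s:{t..T}|lborel. real_of_ereal (Linf_norm (g s)))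
            * exp (C * (LINT s:{t..T}|lborel. BLV_dual_norm V (\<rho> s) N))"
proof -
  obtain Bd where Bd: "0 \<le> Bd" "\<forall>t\<in>{0..T}. \<forall>e\<in>Basis. \<forall>x. \<bar>drift t e x\<bar> \<le> Bd"
    using drift_bound by blast
  obtain A where A: "\<forall>t\<in>{0..T}. mass (u t) lborel \<le> A \<and> (\<integral>y. \<bar>u t y\<bar> * V1_sum y \<partial>lborel) \<le> A"
    using w_phi_adm_bound unfolding u_def[abs_def] by blast
  show "integrable lborel (\<lambda>x. w x * \<bar>\<phi> t x\<bar>\<^sup>2)"
    using w_phi2_integrable[OF Bd A t] by simp
  let ?h = "LINT s:{t..T}|lborel. h s" and ?a = "LINT s:{t..T}|lborel. a s"
  have h0: "0 \<le> ?h" and a0: "0 \<le> ?a"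
    unfolding set_lebesgue_integral_def using h_nonneg a_nonneg t
    by (auto intro!: Bochner_Integration.integral_nonneg simp: indicator_def)
  have "Q_norm V (\<phi> t) = sqrt (\<integral>x. w x * (\<phi> t x)\<^sup>2 \<partial>lborel)" by (simp add: Q_norm_def)
  also have "\<dots> \<le> exp (2 * (dvg_const * ?a)) * (2 * (sqrt D * ?h))"
    using sqrt_Einf_le[OF Bd A t] by (simp add: Einf_def[OF Bd A])
  also have "\<dots> = (2 * sqrt D * ?h) * exp ((2 * dvg_const) * ?a)" by simp
  also have "\<dots> \<le> (C * ?h) * exp (C * ?a)"
    using C h0 a0 D_pos by (intro mult_mono) (auto intro!: mult_right_mono mult_nonneg_nonneg intro: order_trans[of 0 "2 * sqrt D"])
  finally show "Q_norm V (\<phi> t) \<le> C * (LINT s:{t..T}|lborel. real_of_ereal (Linf_norm (g s)))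
            * exp (C * (LINT s:{t..T}|lborel. BLV_dual_norm V (\<rho> s) N))"
    by (simp add: h_def a_def)
qed

end

theorem theorem1p3:
  fixes K V :: "'a::euclidean_space \<Rightarrow> real"
  assumes K_nonneg: "\<And>x. K x \<ge> 0"
    and K_even: "\<And>x. K x = K (- x)"
    and K_pos: "\<And>\<xi>::'a \<Rightarrow> 'a. test_function \<xi> \<Longrightarrow>
          (\<integral>x. conv (\<lambda>v c. c *\<^sub>R v) \<xi> K x \<bullet> \<xi> x \<partial>lborel) \<ge> 0"
    and V_smooth: "smooth V"
    and V_nonneg: "\<And>x. V x \<ge> 0"
    and V_growth: "\<exists>p C0 R. p > 0 \<and> C0 > 0 \<and> R > 0 \<and> (\<forall>x. norm x > R \<longrightarrow>
          1 / C0 * (norm x powr p - 1) \<le> V x \<and> V x \<le> C0 * (norm x powr p + 1) \<and>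
          1 / C0 * (norm x powr (p - 1) - 1) \<le> norm (grad V x) \<and>
          norm (grad V x) \<le> C0 * (norm x powr (p - 1) + 1) \<and>
          1 / C0 * (norm x powr (p - 2) - 1) \<le> hessian_norm V x \<and>
          hessian_norm V x \<le> C0 * (norm x powr (p - 2) + 1))"
    and K_cont: "continuous_on UNIV K"
    and K_W3inf: "sobolev_Winf 3 K"
    and KV1: "(SUP x. BL_norm (\<lambda>y. ((1 / (1 + V y)) *\<^sub>R grad V x) \<bullet> grad K (x - y))) < \<infinity>"
    and KV2: "(SUP x. BL_norm (\<lambda>y. (grad V x \<bullet> grad V y) / (1 + V y) * K (x - y))) < \<infinity>"
  shows "\<exists>C>0. \<forall>\<rho> T g \<phi>.
     measure_solution K V \<rho> \<and> T > 0 \<and> test_function (\<lambda>(t, x). g t x) \<and>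
     dual_solution K V \<rho> T g \<phi> \<and> (\<forall>x. \<phi> T x = 0) \<longrightarrow>
     (\<forall>t\<in>{0..T}.
        integrable lborel (\<lambda>x. rho_inf V x * \<bar>\<phi> t x\<bar>\<^sup>2) \<and>
        Q_norm V (\<phi> t) \<le>
          C * (LINT s:{t..T}|lborel. real_of_ereal (Linf_norm (g s)))
            * exp (C * (LINT s:{t..T}|lborel. BLV_dual_norm V (\<rho> s) (rho_inf_measure V))))"
proof -
  obtain L where L: "0 \<le> L" "K differentiable_on UNIV" "\<And>e. e \<in> Basis \<Longrightarrow> pd e K differentiable_on UNIV"
    "\<And>x. \<bar>K x\<bar> \<le> L" "\<And>e x. e \<in> Basis \<Longrightarrow> \<bar>pd e K x\<bar> \<le> L"
    "\<And>e f x. e \<in> Basis \<Longrightarrow> f \<in> Basis \<Longrightarrow> \<bar>pd f (pd e K) x\<bar> \<le> L"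
    "\<And>e f x y. e \<in> Basis \<Longrightarrow> f \<in> Basis \<Longrightarrow> \<bar>pd f (pd e K) x - pd f (pd e K) y\<bar> \<le> L * norm (x - y)"
    using C2_of_sobolev_W3inf[OF K_cont K_W3inf] by (elim exE conjE) (rule that; blast)
  have V_facts: "(\<exists>c\<ge>0. \<forall>e\<in>Basis. \<forall>x. \<bar>pd e V x\<bar> \<le> c * (1 + V x) \<and> (\<forall>b\<in>Basis. \<bar>pd b (pd e V) x\<bar> \<le> c * (1 + V x))) \<and>
      integrable lborel (\<lambda>x. exp (- V x) * (1 + V x)\<^sup>2)"
    using V_growth
  proof (elim exE conjE)
    fix p C0 R :: real
    assume p: "p > 0" "C0 > 0" and gr: "\<forall>x. norm x > R \<longrightarrow>
          1 / C0 * (norm x powr p - 1) \<le> V x \<and> V x \<le> C0 * (norm x powr p + 1) \<and>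
          1 / C0 * (norm x powr (p - 1) - 1) \<le> norm (grad V x) \<and>
          norm (grad V x) \<le> C0 * (norm x powr (p - 1) + 1) \<and>
          1 / C0 * (norm x powr (p - 2) - 1) \<le> hessian_norm V x \<and>
          hessian_norm V x \<le> C0 * (norm x powr (p - 2) + 1)"
    show ?thesis
    proof
      show "\<exists>c\<ge>0. \<forall>e\<in>Basis. \<forall>x. \<bar>pd e V x\<bar> \<le> c * (1 + V x) \<and> (\<forall>b\<in>Basis. \<bar>pd b (pd e V) x\<bar> \<le> c * (1 + V x))"
        by (rule potential_derivative_bounds[OF V_smooth V_nonneg p(2), of R p]) (use gr in blast)
      show "integrable lborel (\<lambda>x. exp (- V x) * (1 + V x)\<^sup>2)"
        by (rule potential_integrable[OF smooth_continuous[OF V_smooth] V_nonneg p(2,1), of R]) (use gr in blast)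
    qed
  qed
  then obtain c0 where c0: "c0 \<ge> 0" "\<And>e x. e \<in> Basis \<Longrightarrow> \<bar>pd e V x\<bar> \<le> c0 * (1 + V x)"
    "\<And>e b x. e \<in> Basis \<Longrightarrow> b \<in> Basis \<Longrightarrow> \<bar>pd b (pd e V) x\<bar> \<le> c0 * (1 + V x)"
    by blast
  note V_int = conjunct2[OF V_facts]
  have fin: "\<exists>k. \<forall>x. F x \<le> ereal k" if "(SUP x. F x) < \<infinity>" for F :: "'a \<Rightarrow> ereal"
  proof -
    \<comment> \<open>The maximum with 0 excludes minus infinity, so that the supremum is
      represented by a real number.\<close>
    have "F x \<le> ereal (real_of_ereal (max 0 (SUP x. F x)))" for x
    proof -
      have "F x \<le> max 0 (SUP x. F x)" by (simp add: SUP_upper le_max_iff_disj)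
      also have "\<dots> = ereal (real_of_ereal (max 0 (SUP x. F x)))"
        using that by (intro ereal_real'[symmetric]) (auto simp: max_def)
      finally show ?thesis .
    qed
    then show ?thesis by blast
  qed
  obtain k1 where k1: "\<And>x. BL_norm (\<lambda>y. ((1 / (1 + V y)) *\<^sub>R grad V x) \<bullet> grad K (x - y)) \<le> ereal k1"
    using fin[OF KV1] by blast
  obtain k2 where k2: "\<And>x. BL_norm (\<lambda>y. (grad V x \<bullet> grad V y) / (1 + V y) * K (x - y)) \<le> ereal k2"
    using fin[OF KV2] by blast
  \<comment> \<open>A common constant for the growth of V and the two mixed bounds, as the locale
    has only one.\<close>
  define c where "c = max c0 (max k1 k2)"
  have kc: "k1 \<le> c" "k2 \<le> c" by (simp_all add: c_def)
  have mono: "\<bar>z\<bar> \<le> c * (1 + V x)" if "\<bar>z\<bar> \<le> c0 * (1 + V x)" for z x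
  proof -
    have "c0 * (1 + V x) \<le> c * (1 + V x)" using V_nonneg[of x] by (intro mult_right_mono) (auto simp: c_def)
    with that show ?thesis by linarith
  qed
  have ss: "stein_setting K L V c"
  proof unfold_locales
    show "BL_norm (\<lambda>y. ((1 / (1 + V y)) *\<^sub>R grad V x) \<bullet> grad K (x - y)) \<le> ereal c" for x
      by (rule order_trans[OF k1]) (simp add: kc)
    show "BL_norm (\<lambda>y. (grad V x \<bullet> grad V y) / (1 + V y) * K (x - y)) \<le> ereal c" for x
      by (rule order_trans[OF k2]) (simp add: kc)
    show "c \<ge> 0" using c0(1) by (simp add: c_def)
  qed (use K_cont K_pos V_smooth V_nonneg L V_int mono c0 in auto)
  interpret stein_setting K L V c by (rule ss)
  \<comment> \<open>Fixed before the solution, the horizon and the source are introduced: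
    \<open>dvg_const\<close> and \<open>D\<close> involve only V, the bound \<open>L\<close> of the
    kernel and \<open>c\<close>.\<close>
  define C where "C = max (2 * dvg_const) (2 * sqrt D)"
  show ?thesis
  proof (intro exI[of _ C] conjI allI impI ballI)
    show "C > 0" using dvg_const_pos by (simp add: C_def less_max_iff_disj)
    fix \<rho> T g \<phi> t
    assume *: "measure_solution K V \<rho> \<and> T > 0 \<and> test_function (\<lambda>(t, x). g t x) \<and>
       dual_solution K V \<rho> T g \<phi> \<and> (\<forall>x. \<phi> T x = 0)" and t: "t \<in> {0..T}"
    interpret stein_dual K L V c \<rho> T g \<phi>
      by unfold_locales (use * in auto)
    show "integrable lborel (\<lambda>x. rho_inf V x * \<bar>\<phi> t x\<bar>\<^sup>2)"
      by (rule Q_norm_estimate(1)[OF t, of C]) (auto simp: C_def)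
    show "Q_norm V (\<phi> t) \<le> C * (LINT s:{t..T}|lborel. real_of_ereal (Linf_norm (g s)))
            * exp (C * (LINT s:{t..T}|lborel. BLV_dual_norm V (\<rho> s) (rho_inf_measure V)))"
      by (rule Q_norm_estimate(2)[OF t]) (auto simp: C_def)
  qed
qed

end
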